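(* Let $\mathfrak{p}$ be a perturbation system and $M$ a $\mathfrak{p}$-$\aleph_0$-categorical (separable Banach) space. Then $M$ embeds $c_0$ or $\ell_p$ (for some $1\leqslant p<\infty$) $\mathfrak{p}$-approximately. Moreover, $M$ embeds $\ell_2$ $\mathfrak{p}$-approximately. In particular, if $\mathfrak{p}$ is the Banach--Mazur perturbation system $\mathfrak{p}_{BM}$, then $M$ embeds $\ell_2$ almost isometrically.
   Context: Banach spaces are regarded as structures of continuous first-order logic in the usual language of Banach spaces; structures are taken to be bounded, i.e. Banach spaces are studied through their unit balls. For $1\leqslant p<\infty$, $\ell_p$ is the Banach space of real sequences with $\|x\|_p=(\sum|x_n|^p)^{1/p}<\infty$, and $c_0$ is the Banach space of real null sequences with the supremum norm. $T$ denotes a complete theory (in a countable language of Banach spaces), $\mathcal{U}$ a monster model of $T$, and $S_n(T)$ the space of complete $n$-types over $\emptyset$. **Perturbation systems** (in the sense of Ben Yaacov). A perturbation pre-radius for $T$ is a family $\rho=(\rho_n)_{n<\omega}$ with $\rho_n\subseteq S_n(T)^2$ closed and containing the diagonal. It is a perturbation radius if whenever $(s,q)\in\rho_n$ there are models $N,N'\models T$, a bijection $f:N\to N'$ such that $(\mathrm{tp}^{N}(a'),\mathrm{tp}^{N'}(f(a')))\in\rho_m$ for all $m$ and all $a'\in N^m$, and a tuple $a\in N^n$ with $\mathrm{tp}^N(a)=s$ and $\mathrm{tp}^{N'}(f(a))=q$. A perturbation system for $T$ is a family $\mathfrak{p}=(\mathfrak{p}(\epsilon))_{\epsilon>0}$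 of perturbation radii, increasing in $\epsilon$, such that $\mathfrak{p}(\epsilon)=\bigcap_{\epsilon'>\epsilon}\mathfrak{p}(\epsilon')$; $\mathfrak{p}(\epsilon)$ is symmetric; $\mathfrak{p}(\epsilon)\circ\mathfrak{p}(\epsilon')\subseteq\mathfrak{p}(\epsilon+\epsilon')$; and $\bigcap_{\epsilon>0}\mathfrak{p}(\epsilon)$ is the identity relation on each $S_n(T)$. For types $s,q$ in countably many variables, $(s,q)\in\mathfrak{p}(\epsilon)$ means that all corresponding restrictions to finite subtuples are in $\mathfrak{p}(\epsilon)$. **Banach--Mazur perturbation system.** A $(1+\epsilon)$-isomorphism between $(M,a)$ and $(N,b)$ is an (invertible) linear map $f:M\to N$ with $f(a)=b$ and $\|f\|,\|f^{-1}\|\leqslant 1+\epsilon$. For $s,q\in S_n(T)$, $d_{BM}(s,q)$ is the infimum of $\log(1+\epsilon)$ over all $\epsilon$ for which there is a $(1+\epsilon)$-isomorphism between $(\mathcal{U},a)$ and $(\mathcal{U},b)$ for some $a,b$ with $\mathcal{U}\models s(a),q(b)$. The Banach--Mazur perturbation system is given by $\mathfrak{p}_{BM}(\epsilon)=\{(s,q)\in S_n(T)^2: n<\omega,\ d_{BM}(s,q)<\epsilon\}$ for each $\epsilon>0$. **$\mathfrak{p}$-$\aleph_0$-categoricity.** Two separable models $N,N'$ are $\mathfrak{p}$-isomorphic if for each $\epsilon>0$ there is a bijective map $f:N\to N'$ such that $(\mathrm{tp}^{N}(a),\mathrm{tp}^{N'}(f(a)))\in\mathfrak{p}(\epsilon)$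 for all $a\in N^n$, $n<\omega$. A theory $T$ is $\mathfrak{p}$-$\aleph_0$-categorical if every two separable models of $T$ are $\mathfrak{p}$-isomorphic. A separable Banach space is $\mathfrak{p}$-$\aleph_0$-categorical if its continuous first-order theory (in the usual language) is. **$\ell_p$- and $c_0$-types.** For $1\leqslant p<\infty$ and $\epsilon\geqslant 0$, the $\epsilon$-$\ell_p$-type is the following set of statements in countably many variables $\bar x=(x_0,x_1,\ldots)$: for every natural number $n$ and scalars $r_0,\ldots,r_n$, $$(1+\epsilon)^{-1}\Big\|\sum_{i=0}^n r_ix_i\Big\|\leqslant\Big\|\Big(\sum_{i=0}^n|r_i|^p\Big)^{1/p}x_0\Big\|\leqslant(1+\epsilon)\Big\|\sum_{i=0}^n r_ix_i\Big\|.$$ The $\epsilon$-$c_0$-type is the same with $(\sum_{i=0}^n|r_i|^p)^{1/p}$ replaced by $\max_{0\leqslant i\leqslant n}|r_i|$. **$\mathfrak{p}$-approximate embedding.** For a type $s(\bar x)$ in countably many variables, $s^{\mathfrak{p}(\epsilon)}(\bar x)=\{q(\bar x):(s(\bar x),q(\bar x))\in\mathfrak{p}(\epsilon)\}$ is the $\mathfrak{p}(\epsilon)$-neighbourhood of $s$ (for a partial type, the complete types $q$ with $(s',q)\in\mathfrak{p}(\epsilon)$ for some complete type $s'$ extending $s$), and for a partial type $u(\bar x)$, $u(\bar x^{\epsilon})$ denotes the partial type $\exists\bar x'(u(\bar x')\wedge d(\bar x,\bar x')\leqslant\epsilon)$, where $d$ is the supremum metric on countable tuples. $M$ embeds $\ell_p$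 (or $c_0$) $\mathfrak{p}$-approximately if, with $s(\bar x)$ the $0$-$\ell_p$-type (or the $0$-$c_0$-type), for every $\epsilon>0$ the partial type $s^{\mathfrak{p}(\epsilon)}(\bar x^{\epsilon})$ is realised in $M$. **Almost isometric embedding.** $M$ embeds $Y$ almost isometrically if for each $\lambda>1$ there is a subspace $M_\lambda$ of $M$ and a linear isomorphism $S$ from $M_\lambda$ onto $Y$ with $\lambda^{-1}\|x\|\leqslant\|S(x)\|\leqslant\lambda\|x\|$ for all $x\in M_\lambda$.
   Formalization: M is assumed infinite-dimensional (the claim fails for M = ℝ with 𝔭_BM), and the ℓ_p- and c_0-types used for approximate embedding also require ‖x_0‖ = 1, which excludes the zero sequence. *)

theory Defs
  imports "HOL-Analysis.Analysis"
begin

section \<open>Continuous logic for unit balls of Banach spaces\<close>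

text \<open>
  A Banach space is a complete linear subspace \<open>N\<close> of some real normed space (possibly the
  whole space).  As a structure it is studied through its closed unit ball, in the language
  consisting of the constant \<open>0\<close>, the functions \<open>-x\<close> and \<open>(x + y)/2\<close>, and the \<open>[0,1]\<close>-valued
  predicate \<open>norm\<close>.  The metric needs no symbol of its own:
  \<open>norm ((x + (- y)) / 2)\<close> is half the distance of \<open>x\<close> and \<open>y\<close>.  The connectives
  \<open>1 - u\<close>, \<open>u / 2\<close> and \<open>max 0 (u - v)\<close> form a full system, that is, they generate a uniformly dense
  set of continuous connectives.
\<close>

definition unit_ball :: "'a::real_normed_vector set \<Rightarrow> 'a set" where
  "unit_ball N = {x \<in> N. norm x \<le> 1}"

definition banach_subspace :: "'a::real_normed_vector set \<Rightarrow> bool" where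
  "banach_subspace N \<longleftrightarrow> subspace N \<and> complete N"

definition separable_set :: "'a::metric_space set \<Rightarrow> bool" where
  "separable_set N \<longleftrightarrow> (\<exists>D. countable D \<and> D \<subseteq> N \<and> N \<subseteq> closure D)"

definition infinite_dimensional :: "'a::real_normed_vector set \<Rightarrow> bool" where
  "infinite_dimensional N \<longleftrightarrow> \<not> (\<exists>B. finite B \<and> N \<subseteq> span B)"

datatype bterm = TVar nat | TZero | TNeg bterm | TMid bterm bterm

datatype fm =
    FNorm bterm
  | FNot fm
  | FHalf fm
  | FMinus fm fm
  | FSup nat fm
  | FInf nat fm

primrec tvars :: "bterm \<Rightarrow> nat set" where
  "tvars (TVar i) = {i}"
| "tvars TZero = {}"
| "tvars (TNeg t) = tvars t"
| "tvars (TMid t u) = tvars t \<union> tvars u"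

primrec fvars :: "fm \<Rightarrow> nat set" where
  "fvars (FNorm t) = tvars t"
| "fvars (FNot \<phi>) = fvars \<phi>"
| "fvars (FHalf \<phi>) = fvars \<phi>"
| "fvars (FMinus \<phi> \<psi>) = fvars \<phi> \<union> fvars \<psi>"
| "fvars (FSup i \<phi>) = fvars \<phi> - {i}"
| "fvars (FInf i \<phi>) = fvars \<phi> - {i}"

primrec tval :: "bterm \<Rightarrow> (nat \<Rightarrow> 'a::real_normed_vector) \<Rightarrow> 'a" where
  "tval (TVar i) e = e i"
| "tval TZero e = 0"
| "tval (TNeg t) e = - tval t e"
| "tval (TMid t u) e = (1/2) *\<^sub>R (tval t e + tval u e)"

primrec fval :: "'a::real_normed_vector set \<Rightarrow> fm \<Rightarrow> (nat \<Rightarrow> 'a) \<Rightarrow> real" where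
  "fval N (FNorm t) e = norm (tval t e)"
| "fval N (FNot \<phi>) e = 1 - fval N \<phi> e"
| "fval N (FHalf \<phi>) e = fval N \<phi> e / 2"
| "fval N (FMinus \<phi> \<psi>) e = max 0 (fval N \<phi> e - fval N \<psi> e)"
| "fval N (FSup i \<phi>) e = (SUP x\<in>unit_ball N. fval N \<phi> (e(i := x)))"
| "fval N (FInf i \<phi>) e = (INF x\<in>unit_ball N. fval N \<phi> (e(i := x)))"

text \<open>A theory is a set of sentences, each read as the condition that its value is \<open>0\<close>.\<close>

definition theory_of :: "'a::real_normed_vector set \<Rightarrow> fm set" where
  "theory_of N = {\<phi>. fvars \<phi> = {} \<and> fval N \<phi> (\<lambda>_. 0) = 0}"

definition is_model :: "fm set \<Rightarrow> 'a::real_normed_vector set \<Rightarrow> bool" where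
  "is_model T N \<longleftrightarrow> banach_subspace N \<and> (\<forall>\<phi>\<in>T. fval N \<phi> (\<lambda>_. 0) = 0)"


section \<open>Types\<close>

text \<open>
  Tuples indexed by \<open>I\<close> are functions on \<open>nat\<close> of which only the values on \<open>I\<close> matter.  Finite
  \<open>n\<close>-tuples are the case \<open>I = {..<n}\<close>, countable tuples the case \<open>I = UNIV\<close>.

  A complete type is the function assigning to each formula with free variables in \<open>I\<close> its value
  (and \<open>0\<close> to all other formulas).  Thus the logic topology is the topology of pointwise
  convergence, the library's topology on functions.
\<close>

definition tuples :: "'a::real_normed_vector set \<Rightarrow> nat set \<Rightarrow> (nat \<Rightarrow> 'a) set" where
  "tuples N I = {a. \<forall>i\<in>I. a i \<in> unit_ball N}"

type_synonym ctype = "fm \<Rightarrow> real"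

definition tp :: "'a::real_normed_vector set \<Rightarrow> nat set \<Rightarrow> (nat \<Rightarrow> 'a) \<Rightarrow> ctype" where
  "tp N I a = (\<lambda>\<phi>. if fvars \<phi> \<subseteq> I then fval N \<phi> a else 0)"

text \<open>
  Every separable Banach space is isometrically isomorphic to a closed subspace of the space of
  bounded real sequences.  Hence quantification over all separable models is
  quantification over the models contained in that space.  As the language is countable, every type
  in at most countably many variables is realised in a separable model.
\<close>

type_synonym linf = "(nat, real) bcontfun"

definition sep_model :: "fm set \<Rightarrow> linf set \<Rightarrow> bool" where
  "sep_model T N \<longleftrightarrow> is_model T N \<and> separable_set N"

text \<open>The space of complete types of \<open>T\<close> over the empty set, in the variables indexed by \<open>I\<close>.\<close>

definition type_space :: "fm set \<Rightarrow> nat set \<Rightarrow> ctype set" where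
  "type_space T I = {tp N I a | N a. sep_model T N \<and> a \<in> tuples N I}"


section \<open>Perturbation systems\<close>

type_synonym type_rels = "nat \<Rightarrow> (ctype \<times> ctype) set"

definition perturbation_pre_radius :: "fm set \<Rightarrow> type_rels \<Rightarrow> bool" where
  "perturbation_pre_radius T \<rho> \<longleftrightarrow>
     (\<forall>n. let S = type_space T {..<n} in
        closedin (top_of_set (S \<times> S)) (\<rho> n) \<and> Id_on S \<subseteq> \<rho> n)"

definition perturbation_map ::
    "type_rels \<Rightarrow> 'a::real_normed_vector set \<Rightarrow> 'b::real_normed_vector set \<Rightarrow> ('a \<Rightarrow> 'b) \<Rightarrow> bool" where
  "perturbation_map \<rho> N N' f \<longleftrightarrow>
     bij_betw f (unit_ball N) (unit_ball N') \<and>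
     (\<forall>n. \<forall>a\<in>tuples N {..<n}. (tp N {..<n} a, tp N' {..<n} (f \<circ> a)) \<in> \<rho> n)"

text \<open>
  HOL cannot quantify over all Banach spaces of arbitrary size, so the two
  models witnessing that \<open>\<rho>\<close> is a perturbation radius are taken inside an arbitrary normed space
  \<open>'u\<close>.  This is no restriction when \<open>'u\<close> is a free type variable: any set of models fits into a
  common normed space.
\<close>

definition perturbation_radius :: "'u::real_normed_vector itself \<Rightarrow> fm set \<Rightarrow> type_rels \<Rightarrow> bool" where
  "perturbation_radius _ T \<rho> \<longleftrightarrow>
     perturbation_pre_radius T \<rho> \<and>
     (\<forall>n s q. (s, q) \<in> \<rho> n \<longrightarrow>
        (\<exists>(N::'u set) (N'::'u set) f a.
           is_model T N \<and> is_model T N' \<and> perturbation_map \<rho> N N' f \<and>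
           a \<in> tuples N {..<n} \<and> tp N {..<n} a = s \<and> tp N' {..<n} (f \<circ> a) = q))"

definition perturbation_system ::
    "'u::real_normed_vector itself \<Rightarrow> fm set \<Rightarrow> (real \<Rightarrow> type_rels) \<Rightarrow> bool" where
  "perturbation_system u T \<pp> \<longleftrightarrow>
     (\<forall>\<epsilon>>0. perturbation_radius u T (\<pp> \<epsilon>)) \<and>
     (\<forall>\<epsilon>>0. \<forall>\<epsilon>'\<ge>\<epsilon>. \<forall>n. \<pp> \<epsilon> n \<subseteq> \<pp> \<epsilon>' n) \<and>
     (\<forall>\<epsilon>>0. \<forall>n. \<pp> \<epsilon> n = (\<Inter>\<epsilon>'\<in>{\<epsilon><..}. \<pp> \<epsilon>' n)) \<and>
     (\<forall>\<epsilon>>0. \<forall>n. sym (\<pp> \<epsilon> n)) \<and>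
     (\<forall>\<epsilon>>0. \<forall>\<epsilon>'>0. \<forall>n. \<pp> \<epsilon> n O \<pp> \<epsilon>' n \<subseteq> \<pp> (\<epsilon> + \<epsilon>') n) \<and>
     (\<forall>n. (\<Inter>\<epsilon>\<in>{0<..}. \<pp> \<epsilon> n) = Id_on (type_space T {..<n}))"

text \<open>
  Perturbation of types in countably many variables: all corresponding restrictions to finite
  subtuples are perturbations of each other.  The restriction of a type to the subtuple with indices
  \<open>\<sigma> 0, \<dots>, \<sigma> (n - 1)\<close> is the type of that subtuple of any realisation.
\<close>

definition perturbed_countable :: "fm set \<Rightarrow> type_rels \<Rightarrow> (ctype \<times> ctype) set" where
  "perturbed_countable T \<rho> =
     {(tp N UNIV a, tp N' UNIV b) | N N' a b.
        sep_model T N \<and> sep_model T N' \<and> a \<in> tuples N UNIV \<and> b \<in> tuples N' UNIV \<and>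
        (\<forall>n \<sigma>. inj_on \<sigma> {..<n} \<longrightarrow> (tp N {..<n} (a \<circ> \<sigma>), tp N' {..<n} (b \<circ> \<sigma>)) \<in> \<rho> n)}"

definition p_isomorphic ::
    "(real \<Rightarrow> type_rels) \<Rightarrow> 'a::real_normed_vector set \<Rightarrow> 'b::real_normed_vector set \<Rightarrow> bool" where
  "p_isomorphic \<pp> N N' \<longleftrightarrow> (\<forall>\<epsilon>>0. \<exists>f. perturbation_map (\<pp> \<epsilon>) N N' f)"

definition aleph0_categorical :: "(real \<Rightarrow> type_rels) \<Rightarrow> fm set \<Rightarrow> bool" where
  "aleph0_categorical \<pp> T \<longleftrightarrow> (\<forall>N N'. sep_model T N \<and> sep_model T N' \<longrightarrow> p_isomorphic \<pp> N N')"


section \<open>Monster models and the Banach--Mazur system\<close>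

definition linear_bijection ::
    "'a::real_normed_vector set \<Rightarrow> 'b::real_normed_vector set \<Rightarrow> ('a \<Rightarrow> 'b) \<Rightarrow> bool" where
  "linear_bijection M N f \<longleftrightarrow>
     bij_betw f M N \<and>
     (\<forall>x\<in>M. \<forall>y\<in>M. f (x + y) = f x + f y) \<and> (\<forall>c. \<forall>x\<in>M. f (c *\<^sub>R x) = c *\<^sub>R f x)"

text \<open>
  A condition over \<open>A\<close> in the variables \<open>{..<n}\<close> is a pair \<open>(\<phi>, e)\<close> where \<open>e\<close> assigns elements of \<open>A\<close>
  to the remaining free variables of \<open>\<phi>\<close>.
\<close>

definition saturated :: "'k rel \<Rightarrow> 'u::real_normed_vector set \<Rightarrow> bool" where
  "saturated \<kappa> U \<longleftrightarrow>
     (\<forall>A n \<Sigma>.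
        A \<subseteq> unit_ball U \<and> (card_of A, \<kappa>) \<in> ordLess \<and>
        (\<forall>(\<phi>, e)\<in>\<Sigma>. \<forall>i\<in>fvars \<phi> - {..<n}. e i \<in> A) \<and>
        (\<forall>F \<epsilon>. finite F \<and> F \<subseteq> \<Sigma> \<and> \<epsilon> > 0 \<longrightarrow>
           (\<exists>x\<in>tuples U {..<n}. \<forall>(\<phi>, e)\<in>F. fval U \<phi> (\<lambda>i. if i < n then x i else e i) \<le> \<epsilon>)) \<longrightarrow>
        (\<exists>x\<in>tuples U {..<n}. \<forall>(\<phi>, e)\<in>\<Sigma>. fval U \<phi> (\<lambda>i. if i < n then x i else e i) = 0))"

definition strongly_homogeneous :: "'k rel \<Rightarrow> 'u::real_normed_vector set \<Rightarrow> bool" where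
  "strongly_homogeneous \<kappa> U \<longleftrightarrow>
     (\<forall>A g.
        A \<subseteq> unit_ball U \<and> (card_of A, \<kappa>) \<in> ordLess \<and> g ` A \<subseteq> unit_ball U \<and>
        (\<forall>\<phi> e. (\<forall>i\<in>fvars \<phi>. e i \<in> A) \<longrightarrow> fval U \<phi> (g \<circ> e) = fval U \<phi> e) \<longrightarrow>
        (\<exists>h. linear_bijection U U h \<and> (\<forall>x\<in>U. norm (h x) = norm x) \<and> (\<forall>x\<in>A. h x = g x)))"

text \<open>
  The cardinal \<open>\<kappa>\<close> is only required to be uncountable.  It can be taken over \<open>'u\<close>, since a
  \<open>\<kappa>\<close>-saturated space of infinite dimension has at least \<open>\<kappa>\<close> elements.
\<close>

definition monster_model :: "fm set \<Rightarrow> 'u::real_normed_vector set \<Rightarrow> bool" where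
  "monster_model T U \<longleftrightarrow>
     is_model T U \<and>
     (\<exists>\<kappa>::'u rel. Card_order \<kappa> \<and> (natLeq, \<kappa>) \<in> ordLess \<and> saturated \<kappa> U \<and> strongly_homogeneous \<kappa> U)"

definition almost_isomorphism ::
    "real \<Rightarrow> 'a::real_normed_vector set \<Rightarrow> 'b::real_normed_vector set \<Rightarrow> ('a \<Rightarrow> 'b) \<Rightarrow> bool" where
  "almost_isomorphism \<epsilon> M N f \<longleftrightarrow>
     linear_bijection M N f \<and>
     (\<forall>x\<in>M. norm (f x) \<le> (1 + \<epsilon>) * norm x) \<and> (\<forall>x\<in>M. norm x \<le> (1 + \<epsilon>) * norm (f x))"

definition BM_dist :: "'u::real_normed_vector set \<Rightarrow> nat \<Rightarrow> ctype \<Rightarrow> ctype \<Rightarrow> ereal" where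
  "BM_dist U n s q = Inf {ereal (ln (1 + \<epsilon>)) | \<epsilon>. \<epsilon> \<ge> 0 \<and>
     (\<exists>f. \<exists>a\<in>tuples U {..<n}. \<exists>b\<in>tuples U {..<n}.
        tp U {..<n} a = s \<and> tp U {..<n} b = q \<and>
        almost_isomorphism \<epsilon> U U f \<and> (\<forall>i<n. f (a i) = b i))}"

text \<open>
  With the strict inequality this family need not be closed or right-continuous in \<open>\<epsilon>\<close>, so it is not
  a \<^const>\<open>perturbation_system\<close> in general; replacing \<open><\<close> by \<open>\<le>\<close> does not affect
  \<^const>\<open>aleph0_categorical\<close>.
\<close>

definition BM_system :: "fm set \<Rightarrow> 'u::real_normed_vector set \<Rightarrow> real \<Rightarrow> type_rels" where
  "BM_system T U \<epsilon> n =
     {(s, q). s \<in> type_space T {..<n} \<and> q \<in> type_space T {..<n} \<and> BM_dist U n s q < ereal \<epsilon>}"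


section \<open>Approximate and almost isometric embeddings\<close>

type_synonym coeff_norm = "nat \<Rightarrow> (nat \<Rightarrow> real) \<Rightarrow> real"

definition lp_coeff :: "real \<Rightarrow> coeff_norm" where
  "lp_coeff p n r = (\<Sum>i\<le>n. \<bar>r i\<bar> powr p) powr (1 / p)"

definition c0_coeff :: coeff_norm where
  "c0_coeff n r = Max ((\<lambda>i. \<bar>r i\<bar>) ` {..n})"

definition satisfies_seq_type :: "coeff_norm \<Rightarrow> real \<Rightarrow> (nat \<Rightarrow> 'a::real_normed_vector) \<Rightarrow> bool" where
  "satisfies_seq_type \<nu> \<epsilon> x \<longleftrightarrow>
     (\<forall>n r. inverse (1 + \<epsilon>) * norm (\<Sum>i\<le>n. r i *\<^sub>R x i) \<le> norm (\<nu> n r *\<^sub>R x 0) \<and>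
            norm (\<nu> n r *\<^sub>R x 0) \<le> (1 + \<epsilon>) * norm (\<Sum>i\<le>n. r i *\<^sub>R x i))"

text \<open>
  Partial types in countably many variables are represented by the set of complete types extending
  them.  The zero sequence satisfies all the inequalities defining an \<open>\<epsilon>\<close>-\<open>\<ell>\<^sub>p\<close>-type, which would make
  approximate embedding trivial; therefore the type used for embeddings also
  contains the condition \<open>norm x\<^sub>0 = 1\<close>, so that its realisations are unit vector bases.
\<close>

definition seq_type :: "fm set \<Rightarrow> coeff_norm \<Rightarrow> real \<Rightarrow> ctype set" where
  "seq_type T \<nu> \<epsilon> = {tp N UNIV a | N a. sep_model T N \<and> a \<in> tuples N UNIV \<and> satisfies_seq_type \<nu> \<epsilon> a}"

definition normalised_types :: "fm set \<Rightarrow> ctype set" where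
  "normalised_types T = {s \<in> type_space T UNIV. s (FNorm (TVar 0)) = 1}"

definition p_neighbourhood :: "fm set \<Rightarrow> type_rels \<Rightarrow> ctype set \<Rightarrow> ctype set" where
  "p_neighbourhood T \<rho> s = perturbed_countable T \<rho> `` s"

text \<open>
  The partial type \<open>\<exists>x'. u(x') \<and> d(x, x') \<le> \<epsilon>\<close>, as a set of complete types of \<open>x\<close>.  The witness \<open>x'\<close>
  lives in some model of \<open>T\<close> containing a tuple of the same type as \<open>x\<close>; it need not lie in the
  model in which \<open>x\<close> is realised.
\<close>

definition thickening :: "fm set \<Rightarrow> ctype set \<Rightarrow> real \<Rightarrow> ctype set" where
  "thickening T u \<epsilon> =
     {tp N UNIV x | N x. sep_model T N \<and> x \<in> tuples N UNIV \<and>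
        (\<exists>x'\<in>tuples N UNIV. tp N UNIV x' \<in> u \<and> (\<forall>i. dist (x i) (x' i) \<le> \<epsilon>))}"

definition realised_in :: "'a::real_normed_vector set \<Rightarrow> ctype set \<Rightarrow> bool" where
  "realised_in M u \<longleftrightarrow> (\<exists>x\<in>tuples M UNIV. tp M UNIV x \<in> u)"

definition embeds_approximately ::
    "(real \<Rightarrow> type_rels) \<Rightarrow> coeff_norm \<Rightarrow> 'a::real_normed_vector set \<Rightarrow> bool" where
  "embeds_approximately \<pp> \<nu> M \<longleftrightarrow>
     (let T = theory_of M; s = seq_type T \<nu> 0 \<inter> normalised_types T in
      \<forall>\<epsilon>>0. realised_in M (thickening T (p_neighbourhood T (\<pp> \<epsilon>) s) \<epsilon>))"

definition lp_space :: "real \<Rightarrow> (nat \<Rightarrow> real) set" where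
  "lp_space p = {x. summable (\<lambda>n. \<bar>x n\<bar> powr p)}"

definition lp_norm :: "real \<Rightarrow> (nat \<Rightarrow> real) \<Rightarrow> real" where
  "lp_norm p x = (\<Sum>n. \<bar>x n\<bar> powr p) powr (1 / p)"

definition embeds_lp_almost_isometrically :: "real \<Rightarrow> 'a::real_normed_vector set \<Rightarrow> bool" where
  "embeds_lp_almost_isometrically p M \<longleftrightarrow>
     (\<forall>c>1. \<exists>L S. subspace L \<and> L \<subseteq> M \<and> bij_betw S L (lp_space p) \<and>
        (\<forall>x\<in>L. \<forall>y\<in>L. \<forall>n. S (x + y) n = S x n + S y n) \<and>
        (\<forall>t. \<forall>x\<in>L. \<forall>n. S (t *\<^sub>R x) n = t * S x n) \<and>
        (\<forall>x\<in>L. inverse c * norm x \<le> lp_norm p (S x) \<and> lp_norm p (S x) \<le> c * norm x))"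

end

theory Submission
  imports Defs "HOL-Library.Function_Algebras"
begin

text \<open>
  Suppose that some separable model \<open>N\<close> of the theory of \<open>M\<close> contains a sequence
  \<open>e\<close> with \<open>norm (\<Sum>i<n. r i *\<^sub>R e i) = sqrt (\<Sum>i<n. (r i)\<^sup>2)\<close> for all coefficients.  Such a sequence realises the
  \<open>0\<close>-\<open>\<ell>\<^sub>2\<close>-type.  Categoricity yields, for every \<open>\<epsilon>\<close>, a perturbation map from \<open>N\<close> onto an isometric copy of
  \<open>M\<close>, and the image of \<open>e\<close> is a realisation in \<open>M\<close> of an \<open>\<epsilon>\<close>-perturbation of that type
  (\<open>embeds_l2_approximately\<close>).  The exponent \<open>2\<close> also settles the alternative between \<open>c\<^sub>0\<close> and
  \<open>\<ell>\<^sub>p\<close>.  For the Banach--Mazur system the perturbation map itself need not be linear, but the type of a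
  finite tuple determines the norms of its linear combinations, so types at small Banach--Mazur
  distance have almost the same norms of linear combinations.  Hence the image of \<open>e\<close> is almost
  orthonormal and its closed span is an almost isometric copy of \<open>\<ell>\<^sub>2\<close>
  (\<open>embeds_l2_almost_isometrically\<close>).

  The model \<open>N\<close> comes from compactness and Dvoretzky's theorem.  Compactness is proved for the
  case at hand (\<open>compactness_sequences\<close>): a countable family of sequences in \<open>M\<close>, closed under rational
  linear combinations and under choosing witnesses for suprema, is taken modulo an
  ultrafilter; ultralimits of norming functionals, which exist by the Hahn--Banach theorem, embed it
  isometrically into the space of bounded real sequences, and the theorem of Los holds for the
  closure of its image.

  Dvoretzky's theorem is used in the qualitative form \<open>dvoretzky\<close>: Euclidean spaces are finitely
  representable in \<open>M\<close>.  Its proof follows Krivine.  The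
  seminorms on finite coefficient lists that are finitely representable in \<open>M\<close> are closed
  under limits and under passing to blocks.  Iterated ultralimits of a separated sequence give such a norm
  that depends only on the order of the coefficients; differences of neighbours
  and alternating blocks make it invariant under changes of sign (\<open>ex_sign_invariant\<close>).  The
  operators that repeat a coefficient pattern \<open>m\<close> times commute and are positive, hence have joint
  approximate eigenvectors (\<open>ex_joint_approx_eigen\<close>); blocks shaped like these make \<open>m\<close> equal
  neighbouring coefficients as good as a single larger one, which forces the norm
  to be invariant under all permutations (\<open>ex_symmetric_norm\<close>).  Finally, index the basis of a symmetric norm
  by the lattice points \<open>z\<close> in a large ball of \<open>\<real>\<^sup>n\<close> and map \<open>a\<close> to the vector with the coefficients
  \<open>\<Sum>k<n. a k * z k\<close>.  A rotation, rounded to a bijection of the lattice, turns these coefficients into those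
  for any other vector of the same length up to bounded errors and a permutation, so the norm
  of the image depends almost only on the Euclidean length of \<open>a\<close> (\<open>ex_almost_euclidean\<close>).
\<close>

section \<open>A free ultrafilter on the natural numbers\<close>

text \<open>
  A proper filter that is minimal below \<open>sequentially\<close> decides every property, as otherwise adding the property would
  give a smaller proper filter.
\<close>

lemma ex_free_ultrafilter:
  "\<exists>F::nat filter. F \<noteq> bot \<and> F \<le> sequentially \<and> (\<forall>P. eventually P F \<or> eventually (\<lambda>n. \<not> P n) F)"
proof -
  define R where "R = {(F, G). G \<noteq> bot \<and> G \<le> F \<and> F \<le> (sequentially :: nat filter)}"
  have Fld: "Field R = {G. G \<noteq> bot \<and> G \<le> sequentially}"
    by (auto simp: R_def Field_def bot_unique)
  have "\<exists>m\<in>Field R. \<forall>a\<in>Field R. (m, a) \<in> R \<longrightarrow> a = m"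
  proof (rule Zorns_po_lemma)
    show "Partial_order R"
      by (auto simp: R_def partial_order_on_def preorder_on_def antisym_def refl_on_def trans_def
          Field_def bot_unique)
    show "\<exists>u\<in>Field R. \<forall>a\<in>C. (a, u) \<in> R" if C: "C \<in> Chains R" for C
    proof (cases "C = {}")
      case True
      have "sequentially \<in> Field R" by (simp add: Fld)
      with True show ?thesis by blast
    next
      case False
      have bot: "bot \<notin> C" and sub: "\<And>x. x \<in> C \<Longrightarrow> x \<le> sequentially"
        using C by (auto simp: Chains_def R_def)
      have "Inf C = bot \<longleftrightarrow> (\<exists>x\<in>C. x = bot)"
        unfolding trivial_limit_def using C False
        by (intro eventually_Inf_base) (auto simp: Chains_def R_def)
      with bot have nb: "Inf C \<noteq> bot" by auto
      have "Inf C \<le> sequentially" using False sub by (meson Inf_lower2 ex_in_conv)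
      moreover have "(a, Inf C) \<in> R" if "a \<in> C" for a
        using that nb sub by (auto simp: R_def Inf_lower)
      ultimately show ?thesis using nb by (auto simp: Fld)
    qed
  qed
  then obtain F where FR: "F \<in> Field R" and mxR: "\<And>G. G \<in> Field R \<Longrightarrow> (F, G) \<in> R \<Longrightarrow> G = F"
    by blast
  have F: "F \<noteq> bot" "F \<le> sequentially" using FR by (auto simp: Fld)
  have mx: "G = F" if "G \<noteq> bot" "G \<le> F" for G
  proof (rule mxR)
    show "G \<in> Field R" using F that by (simp add: Fld)
    show "(F, G) \<in> R" using F that by (simp add: R_def)
  qed
  have "eventually P F \<or> eventually (\<lambda>n. \<not> P n) F" for P
  proof (rule disjCI)
    assume "\<not> eventually (\<lambda>n. \<not> P n) F"
    then have "inf F (principal {n. P n}) \<noteq> bot"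
      by (simp add: trivial_limit_def eventually_inf_principal)
    then have eq: "inf F (principal {n. P n}) = F" by (rule mx) simp
    have "eventually P (inf F (principal {n. P n}))" by (simp add: eventually_inf_principal)
    then show "eventually P F" by (simp only: eq)
  qed
  with F show ?thesis by blast
qed

definition free_ultrafilter :: "nat filter" where
  "free_ultrafilter = (SOME F. F \<noteq> bot \<and> F \<le> sequentially \<and>
     (\<forall>P. eventually P F \<or> eventually (\<lambda>n. \<not> P n) F))"

lemma free_ultrafilter_nontrivial [simp]: "free_ultrafilter \<noteq> bot"
  and free_ultrafilter_le_sequentially: "free_ultrafilter \<le> sequentially"
  and free_ultrafilter_ultra:
    "eventually P free_ultrafilter \<or> eventually (\<lambda>n. \<not> P n) free_ultrafilter"
  using someI_ex [OF ex_free_ultrafilter, folded free_ultrafilter_def] by auto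

definition ulim :: "(nat \<Rightarrow> real) \<Rightarrow> real" where
  "ulim f = Lim free_ultrafilter f"

lemma tendsto_ulim:
  assumes "\<And>n. \<bar>f n\<bar> \<le> B"
  shows "(f \<longlongrightarrow> ulim f) free_ultrafilter"
proof -
  have "\<forall>\<^sub>F x in filtermap f free_ultrafilter. x \<in> {-B..B}"
    using assms by (auto simp: eventually_filtermap abs_le_iff minus_le_iff)
  moreover have "filtermap f free_ultrafilter \<noteq> bot" by (simp add: filtermap_bot_iff)
  ultimately obtain l where l: "inf (nhds l) (filtermap f free_ultrafilter) \<noteq> bot"
    using compact_filter [of "{-B..B}"] compact_Icc by blast
  have "(f \<longlongrightarrow> l) free_ultrafilter"
  proof (rule topological_tendstoI)
    fix S assume S: "open S" "l \<in> S"
    show "\<forall>\<^sub>F n in free_ultrafilter. f n \<in> S"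
    proof (rule ccontr)
      assume "\<not> ?thesis"
      then have "\<forall>\<^sub>F n in free_ultrafilter. f n \<notin> S" using free_ultrafilter_ultra by blast
      then have "\<forall>\<^sub>F x in filtermap f free_ultrafilter. x \<notin> S" by (simp add: eventually_filtermap)
      moreover have "\<forall>\<^sub>F x in nhds l. x \<in> S" using S by (auto simp: eventually_nhds)
      ultimately have "\<forall>\<^sub>F x in inf (nhds l) (filtermap f free_ultrafilter). False"
        by (auto simp: eventually_inf)
      with l show False by (simp add: trivial_limit_def)
    qed
  qed
  then show ?thesis unfolding ulim_def by (simp add: tendsto_Lim)
qed

lemma ulim_eqI: "(f \<longlongrightarrow> l) free_ultrafilter \<Longrightarrow> ulim f = l"
  unfolding ulim_def by (rule tendsto_Lim) simp_all

lemma ulim_const [simp]: "ulim (\<lambda>_. c) = c"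
  by (rule ulim_eqI) simp

lemma sequentially_imp_ultra: "eventually P sequentially \<Longrightarrow> eventually P free_ultrafilter"
  using free_ultrafilter_le_sequentially by (auto simp: le_filter_def)

lemma tendsto_ultra: "f \<longlonglongrightarrow> l \<Longrightarrow> (f \<longlongrightarrow> l) free_ultrafilter"
  using free_ultrafilter_le_sequentially by (rule tendsto_mono)

section \<open>Norming functionals\<close>

definition sublinear :: "('a::real_vector \<Rightarrow> real) \<Rightarrow> bool" where
  "sublinear p \<longleftrightarrow> (\<forall>x y. p (x + y) \<le> p x + p y) \<and> (\<forall>t\<ge>0. \<forall>x. p (t *\<^sub>R x) = t * p x)"

lemma sublinear_add: "sublinear p \<Longrightarrow> p (x + y) \<le> p x + p y"
  by (simp add: sublinear_def)

lemma sublinear_scale: "sublinear p \<Longrightarrow> t \<ge> 0 \<Longrightarrow> p (t *\<^sub>R x) = t * p x"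
  by (simp add: sublinear_def)

lemma sublinear_zero: "sublinear p \<Longrightarrow> p 0 = 0"
  using sublinear_scale [of p 0 0] by simp

lemma sublinear_minus: "sublinear p \<Longrightarrow> - p (- x) \<le> p x"
  using sublinear_add [of p x "-x"] sublinear_zero [of p] by simp

lemma sublinear_norm: "sublinear norm"
  by (simp add: sublinear_def norm_triangle_ineq)

text \<open>
  Pushing \<open>p\<close> down along \<open>y\<close> gives a smaller sublinear function whose value at \<open>-y\<close> is at most \<open>-p y\<close>.
  A sublinear function which cannot be pushed down any further is therefore linear, and
  pushing the norm down along \<open>y\<close> first forces the linear function below it to be norming at \<open>y\<close>.
\<close>

definition push_down :: "('a::real_vector \<Rightarrow> real) \<Rightarrow> 'a \<Rightarrow> 'a \<Rightarrow> real" where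
  "push_down p y x = (INF t\<in>{0..}. p (x + t *\<^sub>R y) - t * p y)"

lemma
  assumes p: "sublinear p"
  shows push_down_le: "t \<ge> 0 \<Longrightarrow> push_down p y x \<le> p (x + t *\<^sub>R y) - t * p y"
    and push_down_ge: "(\<And>t. t \<ge> 0 \<Longrightarrow> c \<le> p (x + t *\<^sub>R y) - t * p y) \<Longrightarrow> c \<le> push_down p y x"
    and push_down_sublinear: "sublinear (push_down p y)"
proof -
  have lb: "- p (- x) \<le> p (x + t *\<^sub>R y) - t * p y" if "t \<ge> 0" for t x
    using sublinear_add [OF p, of "- x" "x + t *\<^sub>R y"] sublinear_scale [OF p that, of y] by simp
  have bdd: "bdd_below ((\<lambda>t. p (x + t *\<^sub>R y) - t * p y) ` {0..})" for x
    using lb by (intro bdd_belowI [of _ "- p (- x)"]) auto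
  show le: "push_down p y x \<le> p (x + t *\<^sub>R y) - t * p y" if "t \<ge> 0" for t x
    unfolding push_down_def using that by (intro cINF_lower [OF bdd]) auto
  show ge: "c \<le> push_down p y x" if "\<And>t. t \<ge> 0 \<Longrightarrow> c \<le> p (x + t *\<^sub>R y) - t * p y" for c x
    unfolding push_down_def using that by (intro cINF_greatest) auto
  have add: "push_down p y (u + v) \<le> push_down p y u + push_down p y v" for u v
  proof -
    have "push_down p y (u + v) - (p (v + s *\<^sub>R y) - s * p y) \<le> push_down p y u" if s: "s \<ge> 0" for s
    proof (rule ge)
      fix t :: real assume t: "t \<ge> 0"
      have "push_down p y (u + v) \<le> p (u + v + (t + s) *\<^sub>R y) - (t + s) * p y"
        using s t by (intro le) auto
      also have "u + v + (t + s) *\<^sub>R y = (u + t *\<^sub>R y) + (v + s *\<^sub>R y)" by (simp add: algebra_simps)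
      also have "p \<dots> \<le> p (u + t *\<^sub>R y) + p (v + s *\<^sub>R y)" by (rule sublinear_add [OF p])
      finally show "push_down p y (u + v) - (p (v + s *\<^sub>R y) - s * p y) \<le> p (u + t *\<^sub>R y) - t * p y"
        by (simp add: algebra_simps)
    qed
    then have "push_down p y (u + v) - push_down p y u \<le> push_down p y v"
      by (intro ge) (simp add: algebra_simps)
    then show ?thesis by simp
  qed
  have scale_le: "push_down p y (r *\<^sub>R u) \<le> r * push_down p y u" if r: "r > 0" for r u
  proof -
    have "push_down p y (r *\<^sub>R u) / r \<le> push_down p y u"
    proof (rule ge)
      fix t :: real assume t: "t \<ge> 0"
      have "push_down p y (r *\<^sub>R u) \<le> p (r *\<^sub>R u + (r * t) *\<^sub>R y) - (r * t) * p y"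
        using r t by (intro le) auto
      also have "r *\<^sub>R u + (r * t) *\<^sub>R y = r *\<^sub>R (u + t *\<^sub>R y)" by (simp add: algebra_simps)
      also have "p \<dots> = r * p (u + t *\<^sub>R y)" using r by (intro sublinear_scale [OF p]) auto
      finally show "push_down p y (r *\<^sub>R u) / r \<le> p (u + t *\<^sub>R y) - t * p y"
        using r by (simp add: field_simps)
    qed
    then show ?thesis using r by (simp add: field_simps)
  qed
  have zero: "push_down p y 0 = 0"
  proof (rule antisym)
    show "push_down p y 0 \<le> 0" using le [of 0 0] sublinear_zero [OF p] by simp
    show "0 \<le> push_down p y 0"
      using sublinear_scale [OF p] by (intro ge) simp
  qed
  have "push_down p y (r *\<^sub>R u) = r * push_down p y u" if "r \<ge> 0" for r u
  proof (cases "r = 0")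
    case True then show ?thesis by (simp add: zero)
  next
    case False
    with that have r: "r > 0" by simp
    have "push_down p y u = push_down p y ((1/r) *\<^sub>R (r *\<^sub>R u))" using r by simp
    also have "\<dots> \<le> (1/r) * push_down p y (r *\<^sub>R u)" using r by (intro scale_le) simp
    finally have "r * push_down p y u \<le> push_down p y (r *\<^sub>R u)" using r by (simp add: field_simps)
    with scale_le [OF r, of u] show ?thesis by simp
  qed
  with add show "sublinear (push_down p y)" by (simp add: sublinear_def)
qed

text \<open>
  Zorn's lemma applies because the infimum of a chain is again sublinear: for \<open>p\<close> and \<open>q\<close> in the chain, the
  smaller one alone witnesses \<open>u (x + y) \<le> p x + q y\<close>.  The lower bound \<open>- p0 (- x)\<close> keeps the infimum finite.
\<close>

lemma ex_minimal_sublinear: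
  fixes p0 :: "'a::real_vector \<Rightarrow> real"
  assumes p0: "sublinear p0"
  shows "\<exists>p. sublinear p \<and> (\<forall>x. p x \<le> p0 x) \<and>
    (\<forall>q. sublinear q \<and> (\<forall>x. q x \<le> p x) \<longrightarrow> q = p)"
proof -
  define R where "R = {(p, q). sublinear p \<and> sublinear q \<and> (\<forall>x. q x \<le> p x) \<and> (\<forall>x. p x \<le> p0 x)}"
  have Fld: "Field R = {p. sublinear p \<and> (\<forall>x. p x \<le> p0 x)}"
  proof (rule set_eqI, rule iffI)
    fix p assume "p \<in> Field R"
    then show "p \<in> {p. sublinear p \<and> (\<forall>x. p x \<le> p0 x)}"
      by (auto simp: R_def Field_def intro: order_trans)
  next
    fix p assume "p \<in> {p. sublinear p \<and> (\<forall>x. p x \<le> p0 x)}"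
    then have "(p, p) \<in> R" by (simp add: R_def)
    then show "p \<in> Field R" by (rule FieldI1)
  qed
  have "\<exists>m\<in>Field R. \<forall>a\<in>Field R. (m, a) \<in> R \<longrightarrow> a = m"
  proof (rule Zorns_po_lemma)
    show "Partial_order R"
      unfolding partial_order_on_def preorder_on_def
    proof (intro conjI)
      show "R \<subseteq> Field R \<times> Field R" by (auto simp: Field_def)
      show "refl_on (Field R) R" by (auto simp: refl_on_def Fld) (auto simp: R_def)
      show "trans R" by (auto simp: trans_def R_def) (meson order_trans)
      show "antisym R" by (auto simp: antisym_def R_def intro!: ext order_antisym)
    qed
    show "\<exists>u\<in>Field R. \<forall>a\<in>C. (a, u) \<in> R" if C: "C \<in> Chains R" for C
    proof (cases "C = {}")
      case True
      have "p0 \<in> Field R" using p0 by (simp add: Fld)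
      with True show ?thesis by blast
    next
      case False
      then obtain p1 where p1: "p1 \<in> C" by blast
      have sub: "sublinear p" "p x \<le> p0 x" if "p \<in> C" for p x
        using C that by (auto simp: Chains_def R_def)
      have chain: "(\<forall>x. p x \<le> q x) \<or> (\<forall>x. q x \<le> p x)" if "p \<in> C" "q \<in> C" for p q
        using C that by (auto simp: Chains_def R_def)
      define u where "u x = (INF p\<in>C. p x)" for x
      have lb: "- p0 (- x) \<le> p x" if "p \<in> C" for p x
        using sublinear_minus [OF sub(1) [OF that], of x] sub(2) [OF that, of "-x"] by simp
      have bdd: "bdd_below ((\<lambda>p. p x) ` C)" for x
        using lb by (intro bdd_belowI [of _ "- p0 (- x)"]) auto
      have le: "u x \<le> p x" if "p \<in> C" for p x
        unfolding u_def by (rule cINF_lower [OF bdd that])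
      have ge: "c \<le> u x" if "\<And>p. p \<in> C \<Longrightarrow> c \<le> p x" for c x
        unfolding u_def using False that by (intro cINF_greatest) auto
      have "u (x + y) \<le> u x + u y" for x y
      proof -
        have "u (x + y) - q y \<le> p x" if "p \<in> C" "q \<in> C" for p q
          using chain [OF that]
        proof
          assume "\<forall>x. p x \<le> q x"
          then show ?thesis
            using le [OF that(1), of "x + y"] sublinear_add [OF sub(1) [OF that(1)], of x y] by (smt (verit))
        next
          assume "\<forall>x. q x \<le> p x"
          then show ?thesis
            using le [OF that(2), of "x + y"] sublinear_add [OF sub(1) [OF that(2)], of x y] by (smt (verit))
        qed
        then have "u (x + y) - q y \<le> u x" if "q \<in> C" for q using that by (intro ge) auto
        then have "u (x + y) - u x \<le> u y" by (intro ge) (auto simp: algebra_simps)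
        then show ?thesis by simp
      qed
      moreover have "u (t *\<^sub>R x) = t * u x" if t: "t \<ge> 0" for t x
      proof (cases "t = 0")
        case True
        have "u 0 = 0"
          unfolding u_def using False sub(1) by (simp add: sublinear_zero)
        with True show ?thesis by simp
      next
        case False
        with t have t: "t > 0" by simp
        show ?thesis
        proof (rule antisym)
          have "u (t *\<^sub>R x) / t \<le> u x"
            using t le [of _ "t *\<^sub>R x"] sublinear_scale [OF sub(1)]
            by (intro ge) (force simp: field_simps)
          then show "u (t *\<^sub>R x) \<le> t * u x" using t by (simp add: field_simps)
          show "t * u x \<le> u (t *\<^sub>R x)"
          proof (rule ge)
            fix p assume pC: "p \<in> C"
            have "t * u x \<le> t * p x" using t le [OF pC] by simp
            then show "t * u x \<le> p (t *\<^sub>R x)" using t sublinear_scale [OF sub(1) [OF pC]] by simp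
          qed
        qed
      qed
      ultimately have "sublinear u" by (simp add: sublinear_def)
      then have "u \<in> Field R" using le [OF p1] sub(2) [OF p1] by (auto simp: Fld intro: order_trans)
      moreover have "(a, u) \<in> R" if "a \<in> C" for a
        using that le sub \<open>sublinear u\<close> by (auto simp: R_def)
      ultimately show ?thesis by blast
    qed
  qed
  then obtain p where p: "sublinear p" "\<And>x. p x \<le> p0 x"
    and mn: "\<And>a. a \<in> Field R \<Longrightarrow> (p, a) \<in> R \<Longrightarrow> a = p" by (auto simp: Fld)
  have "q = p" if "sublinear q" "\<And>x. q x \<le> p x" for q
  proof (rule mn)
    have "q x \<le> p0 x" for x using that(2) [of x] p(2) [of x] by simp
    then show "q \<in> Field R" using that(1) by (simp add: Fld)
    show "(p, q) \<in> R" using that p by (simp add: R_def)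
  qed
  with p show ?thesis by blast
qed

text \<open>
  This form of the Hahn--Banach theorem gives a norming functional for each vector; both the embedding of
  \<open>M\<close> into the bounded sequences and the choice of separated vectors rest on it.
\<close>

theorem ex_norming_functional:
  fixes x0 :: "'a::real_normed_vector"
  shows "\<exists>f::'a \<Rightarrow> real. linear f \<and> (\<forall>x. \<bar>f x\<bar> \<le> norm x) \<and> f x0 = norm x0"
proof -
  have s0: "sublinear (push_down norm x0)" by (rule push_down_sublinear [OF sublinear_norm])
  obtain p where p: "sublinear p" "\<And>x. p x \<le> push_down norm x0 x"
    and mn: "\<And>q. sublinear q \<Longrightarrow> (\<And>x. q x \<le> p x) \<Longrightarrow> q = p"
    using ex_minimal_sublinear [OF s0] by metis
  have le_norm: "p x \<le> norm x" for x
    using p(2) [of x] push_down_le [OF sublinear_norm, of 0 x0 x] by simp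
  have superadd: "p x + p y \<le> p (x + y)" for x y
  proof -
    have "push_down p y = p"
      using push_down_le [OF p(1), of 0 y] by (intro mn push_down_sublinear p(1)) simp
    then have "p x = push_down p y x" by simp
    also have "\<dots> \<le> p (x + y) - p y" using push_down_le [OF p(1), of 1 y x] by simp
    finally show ?thesis by simp
  qed
  then have add: "p (x + y) = p x + p y" for x y
    using sublinear_add [OF p(1), of x y] by (simp add: antisym)
  have neg: "p (- x) = - p x" for x using add [of x "-x"] sublinear_zero [OF p(1)] by simp
  have "p (t *\<^sub>R x) = t * p x" for t x
  proof (cases "t \<ge> 0")
    case True then show ?thesis by (rule sublinear_scale [OF p(1)])
  next
    case False
    then have "p ((-t) *\<^sub>R x) = (-t) * p x" by (intro sublinear_scale [OF p(1)]) simp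
    then show ?thesis using neg [of "t *\<^sub>R x"] by simp
  qed
  with add have "linear p" by (intro linearI) auto
  moreover have "\<bar>p x\<bar> \<le> norm x" for x
    using le_norm [of x] le_norm [of "-x"] neg [of x] by simp
  moreover have "p x0 = norm x0"
  proof (rule antisym)
    show "p x0 \<le> norm x0" by (rule le_norm)
    have "p (- x0) \<le> - norm x0"
      using p(2) [of "-x0"] push_down_le [OF sublinear_norm, of 1 x0 "-x0"] by simp
    then show "norm x0 \<le> p x0" by (simp add: neg)
  qed
  ultimately show ?thesis by blast
qed

section \<open>Spreading seminorms on coefficient lists\<close>

definition strip :: "real list \<Rightarrow> real list" where
  "strip xs = filter (\<lambda>x. x \<noteq> 0) xs"

text \<open>
  The value at a coefficient list is thought of as the norm of the combination of basis vectors with these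
  coefficients.  Invariance under \<open>strip\<close> means that only the order of the basis vectors matters and not which
  of them occur.  It is called a norm below although vectors may have value \<open>0\<close>.
\<close>

definition spreading :: "(real list \<Rightarrow> real) \<Rightarrow> bool" where
  "spreading \<nu> \<longleftrightarrow>
     (\<forall>xs ys. length xs = length ys \<longrightarrow> \<nu> (map2 (+) xs ys) \<le> \<nu> xs + \<nu> ys) \<and>
     (\<forall>c xs. \<nu> (map ((*) c) xs) = \<bar>c\<bar> * \<nu> xs) \<and>
     (\<forall>xs. \<nu> (strip xs) = \<nu> xs)"

lemma strip_simps [simp]:
  "strip [] = []" "strip (x # xs) = (if x = 0 then strip xs else x # strip xs)"
  "strip (xs @ ys) = strip xs @ strip ys" "strip (replicate n 0) = []" "strip (strip xs) = strip xs"
  by (auto simp: strip_def)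

context
  fixes \<nu> :: "real list \<Rightarrow> real"
  assumes \<nu>: "spreading \<nu>"
begin

lemma spreading_triangle: "length xs = length ys \<Longrightarrow> \<nu> (map2 (+) xs ys) \<le> \<nu> xs + \<nu> ys"
  using \<nu> by (simp add: spreading_def)

lemma spreading_scale: "\<nu> (map ((*) c) xs) = \<bar>c\<bar> * \<nu> xs"
  using \<nu> by (simp add: spreading_def)

lemma spreading_strip: "\<nu> (strip xs) = \<nu> xs"
  using \<nu> by (simp add: spreading_def)

lemma spreading_strip_eq: "strip xs = strip ys \<Longrightarrow> \<nu> xs = \<nu> ys"
  by (metis spreading_strip)

lemma spreading_Nil: "\<nu> [] = 0"
  using spreading_scale [of 0 "[]"] by simp

lemma spreading_triangle_diff:
  assumes "length xs = length ys"
  shows "\<nu> xs \<le> \<nu> ys + \<nu> (map2 (-) xs ys)"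
proof -
  have "xs = map2 (+) ys (map2 (-) xs ys)" using assms by (induction rule: list_induct2) auto
  then show ?thesis using spreading_triangle [of ys "map2 (-) xs ys"] assms by simp
qed

lemma spreading_nonneg: "0 \<le> \<nu> xs"
proof -
  have "strip (map2 (-) xs xs) = []" by (induction xs) auto
  then have "\<nu> (map2 (-) xs xs) = 0" using spreading_strip [of "map2 (-) xs xs"] spreading_Nil by simp
  moreover have "map2 (-) xs xs = map2 (+) xs (map ((*) (-1)) xs)" by (induction xs) auto
  ultimately have "0 \<le> \<nu> xs + \<nu> (map ((*) (-1)) xs)"
    using spreading_triangle [of xs "map ((*) (-1)) xs"] by simp
  then show ?thesis by (simp add: spreading_scale)
qed

lemma spreading_minus: "\<nu> (map uminus xs) = \<nu> xs"
proof -
  have "map uminus xs = map ((*) (-1)) xs" by simp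
  then have "\<nu> (map uminus xs) = \<bar>-1\<bar> * \<nu> xs" by (simp only: spreading_scale)
  then show ?thesis by simp
qed

text \<open>
  Replacing a segment of a combination costs at most the norm of the difference of the two segments.  This
  is the form in which approximate identities between vectors are used inside larger combinations.
\<close>

lemma spreading_context:
  assumes "length xs = length ys"
  shows "\<bar>\<nu> (P @ xs @ Q) - \<nu> (P @ ys @ Q)\<bar> \<le> \<nu> (map2 (-) xs ys)"
proof -
  have z: "strip (map2 (-) R R) = []" for R by (induction R) auto
  have d: "\<nu> (map2 (-) (P @ us @ Q) (P @ vs @ Q)) = \<nu> (map2 (-) us vs)"
    if "length us = length vs" for us vs
    using that by (intro spreading_strip_eq) (simp add: z)
  have "map2 (-) ys xs = map uminus (map2 (-) xs ys)" using assms by (induction rule: list_induct2) auto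
  then have s: "\<nu> (map2 (-) ys xs) = \<nu> (map2 (-) xs ys)" by (simp only: spreading_minus)
  have "\<nu> (P @ xs @ Q) \<le> \<nu> (P @ ys @ Q) + \<nu> (map2 (-) xs ys)"
    using spreading_triangle_diff [of "P @ xs @ Q" "P @ ys @ Q"] assms by (simp only: d [OF assms]) simp
  moreover have "\<nu> (P @ ys @ Q) \<le> \<nu> (P @ xs @ Q) + \<nu> (map2 (-) xs ys)"
    using spreading_triangle_diff [of "P @ ys @ Q" "P @ xs @ Q"] assms
    by (simp only: d [OF assms [symmetric]] s) simp
  ultimately show ?thesis by linarith
qed

lemma spreading_single: "\<nu> [c] = \<bar>c\<bar> * \<nu> [1]"
  using spreading_scale [of c "[1]"] by simp

lemma spreading_change: "\<bar>\<nu> (P @ a # Q) - \<nu> (P @ b # Q)\<bar> \<le> \<bar>a - b\<bar> * \<nu> [1]"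
  using spreading_context [of "[a]" "[b]" P Q] spreading_single [of "a - b"] by simp

lemma spreading_append: "\<nu> (xs @ ys) \<le> \<nu> xs + \<nu> ys"
proof -
  have 1: "map2 (+) xs (replicate (length xs) 0) = xs" by (induction xs) auto
  have 2: "map2 (+) (replicate (length ys) 0) ys = ys" by (induction ys) auto
  have "\<nu> (map2 (+) (xs @ replicate (length ys) 0) (replicate (length xs) 0 @ ys))
      \<le> \<nu> (xs @ replicate (length ys) 0) + \<nu> (replicate (length xs) 0 @ ys)"
    by (rule spreading_triangle) simp
  moreover have "\<nu> (xs @ replicate (length ys) 0) = \<nu> xs" "\<nu> (replicate (length xs) 0 @ ys) = \<nu> ys"
    by (auto intro!: spreading_strip_eq)
  ultimately show ?thesis by (simp add: 1 2)
qed

lemma spreading_le_sum: "\<nu> xs \<le> (\<Sum>x\<leftarrow>xs. \<bar>x\<bar>) * \<nu> [1]"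
proof (induction xs)
  case Nil
  then show ?case by (simp add: spreading_Nil)
next
  case (Cons x xs)
  have "\<nu> (x # xs) \<le> \<nu> [x] + \<nu> xs" using spreading_append [of "[x]" xs] by simp
  with Cons show ?case by (simp add: spreading_single [of x] algebra_simps)
qed

end

text \<open>\<open>block w cs\<close> is the coefficient list of \<open>\<Sum>i. cs ! i * w\<^sub>i\<close> for consecutive copies \<open>w\<^sub>i\<close> of \<open>w\<close>.\<close>

definition block :: "real list \<Rightarrow> real list \<Rightarrow> real list" where
  "block w cs = concat (map (\<lambda>c. map ((*) c) w) cs)"

lemma block_simps [simp]:
  "block w [] = []" "block w (c # cs) = map ((*) c) w @ block w cs"
  "block w (cs @ ds) = block w cs @ block w ds"
  by (simp_all add: block_def)

lemma length_block [simp]: "length (block w cs) = length cs * length w"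
  by (induction cs) auto

lemma strip_scale: "strip (map ((*) c) xs) = (if c = 0 then [] else map ((*) c) (strip xs))"
  by (induction xs) auto

lemma spreading_block:
  assumes \<nu>: "spreading \<nu>"
  shows "spreading (\<lambda>cs. \<nu> (block w cs))"
  unfolding spreading_def
proof (intro conjI allI impI)
  show "\<nu> (block w (map2 (+) xs ys)) \<le> \<nu> (block w xs) + \<nu> (block w ys)"
    if len: "length xs = length ys" for xs ys
  proof -
    have *: "map ((*) (x + y)) w = map2 (+) (map ((*) x) w) (map ((*) y) w)" for x y
      by (induction w) (auto simp: algebra_simps)
    have "block w (map2 (+) xs ys) = map2 (+) (block w xs) (block w ys)"
      using len by (induction rule: list_induct2) (auto simp: *)
    then show ?thesis using spreading_triangle [OF \<nu>, of "block w xs" "block w ys"] len by simp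
  qed
  show "\<nu> (block w (map ((*) c) xs)) = \<bar>c\<bar> * \<nu> (block w xs)" for c xs
  proof -
    have "block w (map ((*) c) xs) = map ((*) c) (block w xs)"
      by (induction xs) (auto simp: mult.assoc)
    then show ?thesis by (simp add: spreading_scale [OF \<nu>])
  qed
  show "\<nu> (block w (strip xs)) = \<nu> (block w xs)" for xs
  proof (rule spreading_strip_eq [OF \<nu>])
    show "strip (block w (strip xs)) = strip (block w xs)"
      by (induction xs) (auto simp: strip_scale)
  qed
qed

lemma spreading_cmult: "spreading \<nu> \<Longrightarrow> 0 \<le> a \<Longrightarrow> spreading (\<lambda>cs. a * \<nu> cs)"
  unfolding spreading_def distrib_left [symmetric]
  by (auto simp: mult_left_mono simp del: distrib_left)

lemma spreading_tendsto:
  assumes sp: "\<And>j. spreading (\<nu> j)" and bd: "\<And>j. \<nu> j [1] \<le> B"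
  shows "((\<lambda>j. \<nu> j cs) \<longlongrightarrow> ulim (\<lambda>j. \<nu> j cs)) free_ultrafilter"
proof (rule tendsto_ulim)
  fix j
  have "0 \<le> \<nu> j cs" by (rule spreading_nonneg [OF sp])
  moreover have "\<nu> j cs \<le> (\<Sum>x\<leftarrow>cs. \<bar>x\<bar>) * \<nu> j [1]" by (rule spreading_le_sum [OF sp])
  moreover have "\<dots> \<le> (\<Sum>x\<leftarrow>cs. \<bar>x\<bar>) * B" using bd by (intro mult_left_mono sum_list_nonneg) auto
  ultimately show "\<bar>\<nu> j cs\<bar> \<le> (\<Sum>x\<leftarrow>cs. \<bar>x\<bar>) * B" by simp
qed

lemma spreading_ulim:
  assumes sp: "\<And>j. spreading (\<nu> j)" and bd: "\<And>j. \<nu> j [1] \<le> B"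
  shows "spreading (\<lambda>cs. ulim (\<lambda>j. \<nu> j cs))"
  unfolding spreading_def
proof (intro conjI allI impI)
  note t = spreading_tendsto [of \<nu>, OF sp bd]
  show "ulim (\<lambda>j. \<nu> j (map2 (+) xs ys)) \<le> ulim (\<lambda>j. \<nu> j xs) + ulim (\<lambda>j. \<nu> j ys)"
    if "length xs = length ys" for xs ys
    using spreading_triangle [OF sp that]
    by (intro tendsto_le [OF free_ultrafilter_nontrivial tendsto_add [OF t t] t]) auto
  show "ulim (\<lambda>j. \<nu> j (map ((*) c) xs)) = \<bar>c\<bar> * ulim (\<lambda>j. \<nu> j xs)" for c xs
    unfolding spreading_scale [OF sp] by (intro ulim_eqI tendsto_mult_left t)
  show "ulim (\<lambda>j. \<nu> j (strip xs)) = ulim (\<lambda>j. \<nu> j xs)" for xs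
    by (simp only: spreading_strip [OF sp])
qed

section \<open>Finite representability\<close>

primrec lincomb :: "real list \<Rightarrow> (nat \<Rightarrow> 'a::real_vector) \<Rightarrow> 'a" where
  "lincomb [] x = 0"
| "lincomb (c # cs) x = c *\<^sub>R x 0 + lincomb cs (\<lambda>i. x (Suc i))"

lemma lincomb_sum: "lincomb cs x = (\<Sum>i<length cs. (cs ! i) *\<^sub>R x i)"
  by (induction cs arbitrary: x) (simp_all add: sum.lessThan_Suc_shift del: sum.lessThan_Suc)

lemma lincomb_append: "lincomb (cs @ ds) x = lincomb cs x + lincomb ds (\<lambda>i. x (i + length cs))"
  by (induction cs arbitrary: x) (simp_all add: add.assoc)

lemma lincomb_scale: "lincomb (map ((*) c) cs) x = c *\<^sub>R lincomb cs x"
  by (induction cs arbitrary: x) (simp_all add: scaleR_add_right)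

lemma lincomb_scale_right: "lincomb cs (\<lambda>i. c *\<^sub>R x i) = c *\<^sub>R lincomb cs x"
  by (induction cs arbitrary: x) (simp_all add: scaleR_add_right)

lemma lincomb_in: "subspace M \<Longrightarrow> (\<And>i. x i \<in> M) \<Longrightarrow> lincomb cs x \<in> M"
  by (induction cs arbitrary: x) (simp_all add: subspace_0 subspace_add subspace_scale)

text \<open>
  Only finitely many combinations are controlled at a time.  This makes finite representability stable under
  pointwise limits, and compactness turns it into the existence of an exact copy in another model.
\<close>

definition fin_rep :: "'a::real_normed_vector set \<Rightarrow> (real list \<Rightarrow> real) \<Rightarrow> bool" where
  "fin_rep M \<nu> \<longleftrightarrow> (\<forall>P \<epsilon>. finite P \<and> \<epsilon> > 0 \<longrightarrow>
     (\<exists>x. (\<forall>i. x i \<in> M) \<and> (\<forall>cs\<in>P. \<bar>norm (lincomb cs x) - \<nu> cs\<bar> \<le> \<epsilon>)))"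

lemma fin_repD:
  assumes "fin_rep M \<nu>" "finite P" "\<epsilon> > 0"
  shows "\<exists>x. (\<forall>i. x i \<in> M) \<and> (\<forall>cs\<in>P. \<bar>norm (lincomb cs x) - \<nu> cs\<bar> \<le> \<epsilon>)"
  using assms by (simp add: fin_rep_def)

lemma lincomb_block: "lincomb (block w cs) x = lincomb cs (\<lambda>i. lincomb w (\<lambda>k. x (k + i * length w)))"
  by (induction cs arbitrary: x) (simp_all add: lincomb_append lincomb_scale ac_simps)

lemma fin_rep_block:
  assumes M: "subspace M" and fr: "fin_rep M \<nu>"
  shows "fin_rep M (\<lambda>cs. \<nu> (block w cs))"
  unfolding fin_rep_def
proof (intro allI impI)
  fix P :: "real list set" and \<epsilon> :: real assume "finite P \<and> \<epsilon> > 0"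
  then have P: "finite (block w ` P)" "\<epsilon> > 0" by auto
  obtain x where x: "\<And>i. x i \<in> M"
    "\<And>cs. cs \<in> block w ` P \<Longrightarrow> \<bar>norm (lincomb cs x) - \<nu> cs\<bar> \<le> \<epsilon>"
    using fin_repD [OF fr P] by blast
  then show "\<exists>x. (\<forall>i. x i \<in> M) \<and> (\<forall>cs\<in>P. \<bar>norm (lincomb cs x) - \<nu> (block w cs)\<bar> \<le> \<epsilon>)"
    by (intro exI [of _ "\<lambda>i. lincomb w (\<lambda>k. x (k + i * length w))"])
       (auto simp: lincomb_block [symmetric] intro!: lincomb_in [OF M])
qed

lemma fin_rep_cmult:
  assumes M: "subspace M" and fr: "fin_rep M \<nu>" and a: "a > 0"
  shows "fin_rep M (\<lambda>cs. a * \<nu> cs)"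
  unfolding fin_rep_def
proof (intro allI impI)
  fix P :: "real list set" and \<epsilon> :: real assume "finite P \<and> \<epsilon> > 0"
  then have P: "finite P" "\<epsilon> / a > 0" using a by auto
  obtain x where x: "\<And>i. x i \<in> M" "\<And>cs. cs \<in> P \<Longrightarrow> \<bar>norm (lincomb cs x) - \<nu> cs\<bar> \<le> \<epsilon> / a"
    using fin_repD [OF fr P] by blast
  have "\<bar>norm (lincomb cs (\<lambda>i. a *\<^sub>R x i)) - a * \<nu> cs\<bar> \<le> \<epsilon>" if "cs \<in> P" for cs
  proof -
    have "norm (lincomb cs (\<lambda>i. a *\<^sub>R x i)) - a * \<nu> cs = a * (norm (lincomb cs x) - \<nu> cs)"
      using a by (simp add: lincomb_scale_right algebra_simps)
    then have "\<bar>norm (lincomb cs (\<lambda>i. a *\<^sub>R x i)) - a * \<nu> cs\<bar> = a * \<bar>norm (lincomb cs x) - \<nu> cs\<bar>"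
      using a by (simp add: abs_mult)
    with x(2) [OF that] a show ?thesis by (simp add: field_simps)
  qed
  moreover have "a *\<^sub>R x i \<in> M" for i using M x(1) by (simp add: subspace_scale)
  ultimately show "\<exists>x. (\<forall>i. x i \<in> M) \<and> (\<forall>cs\<in>P. \<bar>norm (lincomb cs x) - a * \<nu> cs\<bar> \<le> \<epsilon>)"
    by (intro exI [of _ "\<lambda>i. a *\<^sub>R x i"]) auto
qed

lemma fin_rep_limit:
  assumes fr: "\<And>j::nat. fin_rep M (\<nu> j)" and lim: "\<And>cs. ((\<lambda>j. \<nu> j cs) \<longlongrightarrow> \<nu>' cs) free_ultrafilter"
  shows "fin_rep M \<nu>'"
  unfolding fin_rep_def
proof (intro allI impI)
  fix P :: "real list set" and \<epsilon> :: real assume P: "finite P \<and> \<epsilon> > 0"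
  then have e: "\<epsilon> / 2 > 0" and fP: "finite P" by auto
  have "\<forall>\<^sub>F j in free_ultrafilter. \<forall>cs\<in>P. dist (\<nu> j cs) (\<nu>' cs) < \<epsilon> / 2"
    using fP tendstoD [OF lim e] by (simp add: eventually_ball_finite)
  then obtain j where j: "\<And>cs. cs \<in> P \<Longrightarrow> \<bar>\<nu> j cs - \<nu>' cs\<bar> < \<epsilon> / 2"
    using eventually_happens'[OF free_ultrafilter_nontrivial] unfolding dist_real_def by blast
  obtain x where x: "\<And>i. x i \<in> M" "\<And>cs. cs \<in> P \<Longrightarrow> \<bar>norm (lincomb cs x) - \<nu> j cs\<bar> \<le> \<epsilon> / 2"
    using fin_repD [OF fr fP e] by blast
  have "\<bar>norm (lincomb cs x) - \<nu>' cs\<bar> \<le> \<epsilon>" if "cs \<in> P" for cs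
    using j [OF that] x(2) [OF that] by linarith
  with x(1) show "\<exists>x. (\<forall>i. x i \<in> M) \<and> (\<forall>cs\<in>P. \<bar>norm (lincomb cs x) - \<nu>' cs\<bar> \<le> \<epsilon>)" by blast
qed

section \<open>The iterated limit of a bounded sequence\<close>

text \<open>
  The iterated limit assigns a separate limit to each coefficient in turn.  A vanishing coefficient does not
  see its limit, so that the resulting seminorm is spreading.
\<close>

primrec iter_lim :: "(nat \<Rightarrow> 'a::real_normed_vector) \<Rightarrow> real list \<Rightarrow> 'a \<Rightarrow> real" where
  "iter_lim x [] y = norm y"
| "iter_lim x (c # cs) y = ulim (\<lambda>i. iter_lim x cs (y + c *\<^sub>R x i))"

context
  fixes x :: "nat \<Rightarrow> 'a::real_normed_vector"
  assumes x: "\<And>i. norm (x i) \<le> 1"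
begin

lemma iter_lim_bound: "0 \<le> iter_lim x cs y \<and> iter_lim x cs y \<le> norm y + (\<Sum>c\<leftarrow>cs. \<bar>c\<bar>)"
proof (induction cs arbitrary: y)
  case (Cons c cs)
  have le: "norm (y + c *\<^sub>R x i) \<le> norm y + \<bar>c\<bar>" for i
    using x [of i] mult_left_mono [of "norm (x i)" 1 "\<bar>c\<bar>"] by (intro norm_triangle_le) simp
  have b: "0 \<le> iter_lim x cs (y + c *\<^sub>R x i)"
    "iter_lim x cs (y + c *\<^sub>R x i) \<le> norm y + (\<Sum>c\<leftarrow>c # cs. \<bar>c\<bar>)" for i
    using Cons [of "y + c *\<^sub>R x i"] le [of i] by auto
  have t: "((\<lambda>i. iter_lim x cs (y + c *\<^sub>R x i)) \<longlongrightarrow> iter_lim x (c # cs) y) free_ultrafilter"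
    unfolding iter_lim.simps
    by (rule tendsto_ulim [of _ "norm y + (\<Sum>c\<leftarrow>c # cs. \<bar>c\<bar>)"]) (use b in auto)
  show ?case
    using tendsto_le [OF free_ultrafilter_nontrivial t tendsto_const, of 0]
      tendsto_le [OF free_ultrafilter_nontrivial tendsto_const t, of "norm y + (\<Sum>c\<leftarrow>c # cs. \<bar>c\<bar>)"] b
    by auto
qed simp

lemma iter_lim_tendsto:
  "((\<lambda>i. iter_lim x cs (y + c *\<^sub>R x i)) \<longlongrightarrow> iter_lim x (c # cs) y) free_ultrafilter"
  unfolding iter_lim.simps
proof (rule tendsto_ulim)
  fix i
  have "norm (y + c *\<^sub>R x i) \<le> norm y + \<bar>c\<bar>"
    using x [of i] mult_left_mono [of "norm (x i)" 1 "\<bar>c\<bar>"] by (intro norm_triangle_le) simp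
  then show "\<bar>iter_lim x cs (y + c *\<^sub>R x i)\<bar> \<le> norm y + \<bar>c\<bar> + (\<Sum>c\<leftarrow>cs. \<bar>c\<bar>)"
    using iter_lim_bound [of cs "y + c *\<^sub>R x i"] by auto
qed

lemma iter_lim_triangle:
  "length cs = length ds \<Longrightarrow> iter_lim x (map2 (+) cs ds) (y + z) \<le> iter_lim x cs y + iter_lim x ds z"
proof (induction cs ds arbitrary: y z rule: list_induct2)
  case Nil
  then show ?case by (simp add: norm_triangle_ineq)
next
  case (Cons c cs d ds)
  have "iter_lim x (map2 (+) cs ds) ((y + z) + (c + d) *\<^sub>R x i)
      \<le> iter_lim x cs (y + c *\<^sub>R x i) + iter_lim x ds (z + d *\<^sub>R x i)" for i
  proof -
    have "(y + z) + (c + d) *\<^sub>R x i = (y + c *\<^sub>R x i) + (z + d *\<^sub>R x i)" by (simp add: algebra_simps)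
    then show ?thesis using Cons.IH [of "y + c *\<^sub>R x i" "z + d *\<^sub>R x i"] by (simp only:)
  qed
  then have "iter_lim x ((c + d) # map2 (+) cs ds) (y + z) \<le> iter_lim x (c # cs) y + iter_lim x (d # ds) z"
    by (intro tendsto_le [OF free_ultrafilter_nontrivial
          tendsto_add [OF iter_lim_tendsto iter_lim_tendsto] iter_lim_tendsto]) auto
  then show ?case by simp
qed

lemma iter_lim_scale: "iter_lim x (map ((*) a) cs) (a *\<^sub>R y) = \<bar>a\<bar> * iter_lim x cs y"
proof (induction cs arbitrary: y)
  case (Cons c cs)
  have "a *\<^sub>R y + (a * c) *\<^sub>R x i = a *\<^sub>R (y + c *\<^sub>R x i)" for i by (simp add: algebra_simps)
  then have "iter_lim x (map ((*) a) (c # cs)) (a *\<^sub>R y) = ulim (\<lambda>i. \<bar>a\<bar> * iter_lim x cs (y + c *\<^sub>R x i))"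
    by (simp add: Cons)
  also have "\<dots> = \<bar>a\<bar> * iter_lim x (c # cs) y"
    by (intro ulim_eqI tendsto_mult_left iter_lim_tendsto)
  finally show ?case .
qed simp

lemma iter_lim_strip: "iter_lim x (strip cs) y = iter_lim x cs y"
  by (induction cs arbitrary: y) simp_all

lemma spreading_iter_lim: "spreading (\<lambda>cs. iter_lim x cs 0)"
  unfolding spreading_def
  using iter_lim_triangle [of _ _ 0 0] iter_lim_scale [of _ _ 0] iter_lim_strip by auto

text \<open>
  The outermost index is chosen first, so that it is good for all of the finitely many combinations; it is
  then absorbed into the vectors \<open>y\<close>, and one coefficient less remains.
\<close>

lemma fin_rep_iter_lim:
  assumes M: "\<And>i. x i \<in> M"
  shows "fin_rep M (\<lambda>cs. iter_lim x cs 0)"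
proof -
  have *: "\<exists>z. (\<forall>i. z i \<in> M) \<and> (\<forall>(cs, y)\<in>Q. \<bar>norm (y + lincomb cs z) - iter_lim x cs y\<bar> \<le> \<epsilon>)"
    if "finite Q" "\<epsilon> > 0" "\<And>cs y. (cs, y) \<in> Q \<Longrightarrow> length cs \<le> n" for n \<epsilon> and Q :: "(real list \<times> 'a) set"
    using that
  proof (induction n arbitrary: Q \<epsilon>)
    case 0
    have "\<forall>(cs, y)\<in>Q. \<bar>norm (y + lincomb cs (\<lambda>_. x 0)) - iter_lim x cs y\<bar> \<le> \<epsilon>"
      using "0.prems" by fastforce
    then show ?case using M by (intro exI [of _ "\<lambda>_. x 0"]) simp
  next
    case (Suc n)
    have e: "\<epsilon> / 2 > 0" using Suc.prems by simp
    define Q1 where "Q1 = {q\<in>Q. fst q \<noteq> []}"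
    have "finite Q1" using Suc.prems(1) by (simp add: Q1_def)
    moreover have "\<forall>\<^sub>F i in free_ultrafilter. dist (iter_lim x (tl (fst q)) (snd q + hd (fst q) *\<^sub>R x i))
        (iter_lim x (fst q) (snd q)) < \<epsilon> / 2" if "q \<in> Q1" for q
    proof -
      have "fst q = hd (fst q) # tl (fst q)" using that by (simp add: Q1_def)
      then show ?thesis using tendstoD [OF iter_lim_tendsto [of "tl (fst q)" "snd q" "hd (fst q)"] e] by simp
    qed
    ultimately have "\<forall>\<^sub>F i in free_ultrafilter. \<forall>q\<in>Q1.
        dist (iter_lim x (tl (fst q)) (snd q + hd (fst q) *\<^sub>R x i)) (iter_lim x (fst q) (snd q)) < \<epsilon> / 2"
      by (simp add: eventually_ball_finite)
    then obtain i where i: "\<And>q. q \<in> Q1 \<Longrightarrow>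
        \<bar>iter_lim x (tl (fst q)) (snd q + hd (fst q) *\<^sub>R x i) - iter_lim x (fst q) (snd q)\<bar> < \<epsilon> / 2"
      using eventually_happens' [OF free_ultrafilter_nontrivial] unfolding dist_real_def by blast
    define Q2 where "Q2 = (\<lambda>q. (tl (fst q), snd q + hd (fst q) *\<^sub>R x i)) ` Q1"
    have "finite Q2" using \<open>finite Q1\<close> by (simp add: Q2_def)
    moreover have "length cs \<le> n" if "(cs, y) \<in> Q2" for cs y
      using that Suc.prems(3) unfolding Q2_def Q1_def by force
    ultimately obtain z where z: "\<And>i. z i \<in> M"
      "\<And>cs y. (cs, y) \<in> Q2 \<Longrightarrow> \<bar>norm (y + lincomb cs z) - iter_lim x cs y\<bar> \<le> \<epsilon> / 2"
      using Suc.IH [of Q2 "\<epsilon> / 2"] e by blast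
    define z' where "z' = (\<lambda>k. case k of 0 \<Rightarrow> x i | Suc k \<Rightarrow> z k)"
    have "\<bar>norm (y + lincomb cs z') - iter_lim x cs y\<bar> \<le> \<epsilon>" if q: "(cs, y) \<in> Q" for cs y
    proof (cases cs)
      case Nil
      then show ?thesis using e by simp
    next
      case (Cons c cs')
      have q1: "(cs, y) \<in> Q1" using q Cons by (simp add: Q1_def)
      then have "(cs', y + c *\<^sub>R x i) \<in> Q2" using Cons by (force simp: Q2_def)
      then have "\<bar>norm ((y + c *\<^sub>R x i) + lincomb cs' z) - iter_lim x cs' (y + c *\<^sub>R x i)\<bar> \<le> \<epsilon> / 2"
        by (rule z(2))
      moreover have "y + lincomb cs z' = (y + c *\<^sub>R x i) + lincomb cs' z"
        by (simp add: Cons z'_def add.assoc)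
      moreover have "\<bar>iter_lim x cs' (y + c *\<^sub>R x i) - iter_lim x cs y\<bar> < \<epsilon> / 2"
        using i [OF q1] unfolding Cons by simp
      ultimately show ?thesis by (simp only:)
    qed
    moreover have "z' k \<in> M" for k using z(1) M by (simp add: z'_def split: nat.split)
    ultimately show ?case by blast
  qed
  show ?thesis
    unfolding fin_rep_def
  proof (intro allI impI)
    fix P :: "real list set" and \<epsilon> :: real assume P: "finite P \<and> \<epsilon> > 0"
    then have "finite (length ` P)" by simp
    then obtain n where "\<And>cs. cs \<in> P \<Longrightarrow> length cs \<le> n" by (meson finite_nat_set_iff_bounded_le image_eqI)
    then have "\<exists>z. (\<forall>i. z i \<in> M) \<and> (\<forall>(cs, y)\<in>(\<lambda>cs. (cs, 0)) ` P. \<bar>norm (y + lincomb cs z) - iter_lim x cs y\<bar> \<le> \<epsilon>)"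
      using P by (intro * [where n = n]) auto
    then show "\<exists>x'. (\<forall>i. x' i \<in> M) \<and> (\<forall>cs\<in>P. \<bar>norm (lincomb cs x') - iter_lim x cs 0\<bar> \<le> \<epsilon>)" by simp
  qed
qed

lemma iter_lim_separated:
  assumes sep: "\<And>i j. i < j \<Longrightarrow> 1 \<le> norm (x i - x j)"
  shows "1 \<le> iter_lim x [1, -1] 0"
proof -
  \<comment> \<open>For a fixed first index \<open>i\<close>, almost all second indices are larger.\<close>
  have inner: "1 \<le> iter_lim x [-1] (x i)" for i
  proof (rule tendsto_lowerbound [OF iter_lim_tendsto _ free_ultrafilter_nontrivial])
    show "\<forall>\<^sub>F j in free_ultrafilter. 1 \<le> iter_lim x [] (x i + -1 *\<^sub>R x j)"
      by (rule sequentially_imp_ultra, rule eventually_mono [OF eventually_gt_at_top [of i]]) (simp add: sep)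
  qed
  have "1 \<le> iter_lim x (1 # [-1]) 0"
    by (rule tendsto_lowerbound [OF iter_lim_tendsto _ free_ultrafilter_nontrivial])
       (simp add: inner del: iter_lim.simps)
  then show ?thesis by simp
qed

end

text \<open>
  In infinite dimensions one can choose each new vector in the joint kernel of norming functionals
  of the earlier ones.
\<close>

lemma ex_separated_sequence:
  fixes M :: "'a::real_normed_vector set"
  assumes M: "subspace M" and inf: "infinite_dimensional M"
  shows "\<exists>x::nat \<Rightarrow> 'a. (\<forall>i. x i \<in> M \<and> norm (x i) = 1) \<and> (\<forall>i j. i < j \<longrightarrow> 1 \<le> norm (x i - x j))"
proof -
  define Q where "Q = (\<lambda>(\<phi> :: 'a \<Rightarrow> 'a \<Rightarrow> real) (f :: nat \<Rightarrow> 'a) (n :: nat) r.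
    r \<in> M \<and> norm r = 1 \<and> (\<forall>i<n. \<phi> (f i) r = 0))"
  obtain \<phi> :: "'a \<Rightarrow> 'a \<Rightarrow> real" where \<phi>: "\<And>x. linear (\<phi> x)" "\<And>x y. \<bar>\<phi> x y\<bar> \<le> norm y" "\<And>x. \<phi> x x = norm x"
    using ex_norming_functional by metis
  have "\<exists>f. \<forall>n. Q \<phi> f n (f n)"
  proof (rule dependent_wellorder_choice)
    show "\<And>r f g n. (\<And>i. i < n \<Longrightarrow> f i = g i) \<Longrightarrow> Q \<phi> f n r = Q \<phi> g n r" by (simp add: Q_def)
    fix n :: nat and f :: "nat \<Rightarrow> 'a" assume f: "\<And>i. i < n \<Longrightarrow> Q \<phi> f i (f i)"
    show "\<exists>r. Q \<phi> f n r"
    proof (rule ccontr)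
      assume no: "\<nexists>r. Q \<phi> f n r"
      have zero: "r = 0" if "r \<in> M" "\<And>i. i < n \<Longrightarrow> \<phi> (f i) r = 0" for r
      proof (rule ccontr)
        assume "r \<noteq> 0"
        then have "Q \<phi> f n ((1 / norm r) *\<^sub>R r)"
          using that by (simp add: Q_def subspace_scale [OF M] linear_cmul [OF \<phi>(1)])
        with no show False by blast
      qed
      \<comment> \<open>The system of the \<open>\<phi> (f i)\<close> and \<open>f k\<close> is triangular, so \<open>y\<close> can be corrected one functional at a time.\<close>
      have "\<exists>v\<in>span (f ` {..<k}). \<forall>i<k. \<phi> (f i) (y - v) = 0" if "k \<le> n" for k y
        using that
      proof (induction k)
        case 0
        then show ?case by (simp add: span_zero)
      next
        case (Suc k)
        then obtain v where v: "v \<in> span (f ` {..<k})" "\<And>i. i < k \<Longrightarrow> \<phi> (f i) (y - v) = 0" by auto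
        define \<alpha> where "\<alpha> = \<phi> (f k) (y - v)"
        have fk: "norm (f k) = 1" "\<And>i. i < k \<Longrightarrow> \<phi> (f i) (f k) = 0"
          using f [of k] Suc.prems by (auto simp: Q_def)
        have "v + \<alpha> *\<^sub>R f k \<in> span (f ` {..<Suc k})"
        proof (intro span_add span_scale)
          show "v \<in> span (f ` {..<Suc k})" 
          proof (rule subsetD [OF span_mono v(1)])
            show "f ` {..<k} \<subseteq> f ` {..<Suc k}" by (intro image_mono) auto
          qed
          show "f k \<in> span (f ` {..<Suc k})" by (intro span_base) simp
        qed
        moreover have "\<phi> (f i) (y - (v + \<alpha> *\<^sub>R f k)) = 0" if "i < Suc k" for i
        proof -
          have "y - (v + \<alpha> *\<^sub>R f k) = (y - v) - \<alpha> *\<^sub>R f k" by simp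
          then have "\<phi> (f i) (y - (v + \<alpha> *\<^sub>R f k)) = \<phi> (f i) (y - v) - \<alpha> * \<phi> (f i) (f k)"
            by (simp only: linear_diff [OF \<phi>(1)] linear_cmul [OF \<phi>(1)]) simp
          then show ?thesis
            using that v(2) [of i] fk \<phi>(3) [of "f k"] by (cases "i = k") (auto simp: \<alpha>_def)
        qed
        ultimately show ?case by blast
      qed
      then have v: "\<exists>v\<in>span (f ` {..<n}). \<forall>i<n. \<phi> (f i) (y - v) = 0" for y by blast
      have fM: "f ` {..<n} \<subseteq> M" using f by (auto simp: Q_def)
      have "M \<subseteq> span (f ` {..<n})"
      proof
        fix y assume "y \<in> M"
        obtain v where v: "v \<in> span (f ` {..<n})" "\<And>i. i < n \<Longrightarrow> \<phi> (f i) (y - v) = 0" using v by blast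
        have "v \<in> M" using v(1) span_minimal [OF fM M] by blast
        then have "y - v = 0" using v(2) \<open>y \<in> M\<close> by (intro zero subspace_diff [OF M])
        then show "y \<in> span (f ` {..<n})" using v(1) by simp
      qed
      then show False using inf unfolding infinite_dimensional_def by blast
    qed
  qed
  then obtain f where f: "\<And>n. Q \<phi> f n (f n)" by blast
  have "1 \<le> norm (f i - f j)" if "i < j" for i j
  proof -
    have "\<phi> (f i) (f i - f j) = 1"
      using f [of i] f [of j] that \<phi>(3) [of "f i"] by (simp add: Q_def linear_diff [OF \<phi>(1)])
    then show ?thesis using \<phi>(2) [of "f i" "f i - f j"] by simp
  qed
  then show ?thesis using f by (intro exI [of _ f]) (simp add: Q_def)
qed

section \<open>Unconditionality\<close>

definition suppression :: "(real list \<Rightarrow> real) \<Rightarrow> bool" where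
  "suppression \<nu> \<longleftrightarrow> (\<forall>P c Q. \<nu> (P @ Q) \<le> \<nu> (P @ c # Q))"

definition sign_invariant :: "(real list \<Rightarrow> real) \<Rightarrow> bool" where
  "sign_invariant \<nu> \<longleftrightarrow> (\<forall>P c Q. \<nu> (P @ (- c) # Q) = \<nu> (P @ c # Q))"

text \<open>
  Over a spreading norm, \<open>n\<close> copies of the pair \<open>c, -c\<close> in successive positions telescope to a single pair,
  so that its contribution is negligible against that of \<open>n\<close> copies of the other entries.
\<close>

lemma suppression_differences:
  assumes \<nu>: "spreading \<nu>"
  shows "suppression (\<lambda>cs. \<nu> (block [1, -1] cs))"
  unfolding suppression_def
proof (intro allI)
  fix P c Q
  define p q where "p = block [1, -1] P" and "q = block [1, -1] Q"
  let ?A = "\<nu> (p @ [c, -c] @ q)"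
  have up: "\<nu> (map ((*) (real n)) p @ [c, -c] @ map ((*) (real n)) q) \<le> real n * ?A" if "n \<ge> 1" for n
    using that
  proof (induction n rule: dec_induct)
    case base
    then show ?case by simp
  next
    case (step n)
    have a: "map2 (+) (map ((*) (real n)) u) u = map ((*) (real (Suc n))) u" for u
      by (induction u) (auto simp: algebra_simps)
    have "\<nu> (map ((*) (real (Suc n))) p @ [c, -c] @ map ((*) (real (Suc n))) q)
        = \<nu> (map2 (+) (map ((*) (real n)) p @ [c, -c, 0] @ map ((*) (real n)) q) (p @ [0, c, -c] @ q))"
      by (rule spreading_strip_eq [OF \<nu>]) (simp add: a)
    also have "\<dots> \<le> \<nu> (map ((*) (real n)) p @ [c, -c, 0] @ map ((*) (real n)) q) + \<nu> (p @ [0, c, -c] @ q)"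
      by (rule spreading_triangle [OF \<nu>]) simp
    also have "\<nu> (map ((*) (real n)) p @ [c, -c, 0] @ map ((*) (real n)) q)
        = \<nu> (map ((*) (real n)) p @ [c, -c] @ map ((*) (real n)) q)"
      by (rule spreading_strip_eq [OF \<nu>]) simp
    also have "\<nu> (p @ [0, c, -c] @ q) = ?A"
      by (rule spreading_strip_eq [OF \<nu>]) simp
    finally show ?case using step by (simp add: algebra_simps)
  qed
  have low: "real n * \<nu> (p @ q) \<le> \<nu> (map ((*) (real n)) p @ [c, -c] @ map ((*) (real n)) q) + \<nu> [c, -c]" for n
  proof -
    have "\<nu> (map ((*) (real n)) p @ [0, 0] @ map ((*) (real n)) q) = \<nu> (map ((*) (real n)) (p @ q))"
      by (rule spreading_strip_eq [OF \<nu>]) simp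
    also have "\<dots> = real n * \<nu> (p @ q)" using spreading_scale [OF \<nu>, of "real n" "p @ q"] by simp
    finally show ?thesis
      using spreading_context [OF \<nu>, of "[c, -c]" "[0, 0]" "map ((*) (real n)) p" "map ((*) (real n)) q"]
      by simp
  qed
  have "\<nu> (p @ q) \<le> ?A"
  proof (rule ccontr)
    assume "\<not> ?thesis"
    then have pos: "\<nu> (p @ q) - ?A > 0" by simp
    then obtain n where n: "\<nu> [c, -c] < real n * (\<nu> (p @ q) - ?A)"
      using reals_Archimedean3 by blast
    then have "n \<ge> 1" using spreading_nonneg [OF \<nu>, of "[c, -c]"] by (cases n) auto
    then show False using up [of n] low [of n] n by (simp add: algebra_simps)
  qed
  then show "\<nu> (block [1, -1] (P @ Q)) \<le> \<nu> (block [1, -1] (P @ c # Q))" by (simp add: p_def q_def)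
qed

lemma suppressionD: "suppression \<nu> \<Longrightarrow> \<nu> (P @ Q) \<le> \<nu> (P @ xs @ Q)"
proof (induction xs)
  case (Cons x xs)
  then have "\<nu> (P @ xs @ Q) \<le> \<nu> (P @ x # (xs @ Q))" unfolding suppression_def by blast
  with Cons show ?case by simp
qed simp

text \<open>As a function of one coefficient the norm is convex and minimal at \<open>0\<close>.\<close>

lemma suppression_mono1:
  assumes \<nu>: "spreading \<nu>" and sup: "suppression \<nu>" and t: "0 \<le> t" "t \<le> 1"
  shows "\<nu> (P @ (t * b) # Q) \<le> \<nu> (P @ b # Q)"
proof -
  have eq: "map2 (+) (map ((*) t) xs) (map ((*) (1 - t)) xs) = xs" for xs
    by (induction xs) (auto simp: algebra_simps)
  have "P @ (t * b) # Q = map2 (+) (map ((*) t) (P @ b # Q)) (map ((*) (1 - t)) (P @ 0 # Q))"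
    by (simp add: eq)
  then have "\<nu> (P @ (t * b) # Q) \<le> \<nu> (map ((*) t) (P @ b # Q)) + \<nu> (map ((*) (1 - t)) (P @ 0 # Q))"
    using spreading_triangle [OF \<nu>, of "map ((*) t) (P @ b # Q)" "map ((*) (1 - t)) (P @ 0 # Q)"] by simp
  also have "\<dots> = t * \<nu> (P @ b # Q) + (1 - t) * \<nu> (P @ 0 # Q)"
    using t by (simp only: spreading_scale [OF \<nu>] abs_of_nonneg diff_ge_0_iff_ge)
  also have "\<nu> (P @ 0 # Q) = \<nu> (P @ Q)" by (rule spreading_strip_eq [OF \<nu>]) simp
  also have "t * \<nu> (P @ b # Q) + (1 - t) * \<nu> (P @ Q) \<le> t * \<nu> (P @ b # Q) + (1 - t) * \<nu> (P @ b # Q)"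
    using t sup by (intro add_left_mono mult_left_mono) (auto simp: suppression_def)
  also have "\<dots> = \<nu> (P @ b # Q)" by (simp add: algebra_simps)
  finally show ?thesis .
qed

lemma sign_invariant_imp_suppression:
  assumes \<nu>: "spreading \<nu>" and si: "sign_invariant \<nu>"
  shows "suppression \<nu>"
  unfolding suppression_def
proof (intro allI)
  fix P c Q
  have d: "map2 (+) xs xs = map ((*) 2) xs" for xs :: "real list" by (induction xs) auto
  have "2 * \<nu> (P @ Q) = \<nu> (map ((*) 2) (P @ Q))" by (simp only: spreading_scale [OF \<nu>])
  also have "\<dots> = \<nu> (map2 (+) (P @ c # Q) (P @ (- c) # Q))"
    by (rule spreading_strip_eq [OF \<nu>]) (simp add: d)
  also have "\<dots> \<le> \<nu> (P @ c # Q) + \<nu> (P @ (- c) # Q)" by (rule spreading_triangle [OF \<nu>]) simp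
  also have "\<dots> = 2 * \<nu> (P @ c # Q)" using si by (simp add: sign_invariant_def)
  finally show "\<nu> (P @ Q) \<le> \<nu> (P @ c # Q)" by simp
qed

primrec alternating :: "nat \<Rightarrow> real list" where
  "alternating 0 = []"
| "alternating (Suc n) = 1 # -1 # alternating n"

lemma length_alternating [simp]: "length (alternating n) = 2 * n"
  by (induction n) auto

text \<open>Moving an alternating block by one position is the same as changing its sign, up to the two end points.\<close>

lemma alternating_shift:
  assumes \<nu>: "spreading \<nu>"
  shows "\<bar>\<nu> (P @ map ((*) (- c)) (alternating n) @ Q) - \<nu> (P @ map ((*) c) (alternating n) @ Q)\<bar>
    \<le> 2 * \<bar>c\<bar> * \<nu> [1]"
proof -
  have tail: "map2 (-) (map ((*) c) (alternating n) @ [0]) (c # map ((*) (- c)) (alternating n))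
      = replicate (2 * n) 0 @ [- c]" for n
    by (induction n) auto
  have shift: "map2 (-) (map ((*) c) (alternating (Suc n) ) @ [0]) (0 # map ((*) (- c)) (alternating (Suc n)))
      = c # 0 # replicate (2 * n) 0 @ [- c]" for n
    using tail [of n] by simp
  have "\<bar>\<nu> (P @ (map ((*) c) (alternating n) @ [0]) @ Q) - \<nu> (P @ (0 # map ((*) (- c)) (alternating n)) @ Q)\<bar>
      \<le> \<nu> (map2 (-) (map ((*) c) (alternating n) @ [0]) (0 # map ((*) (- c)) (alternating n)))"
    by (rule spreading_context [OF \<nu>]) simp
  also have "\<dots> \<le> 2 * \<bar>c\<bar> * \<nu> [1]"
  proof (cases n)
    case 0
    then have "\<nu> (map2 (-) (map ((*) c) (alternating n) @ [0]) (0 # map ((*) (- c)) (alternating n))) = \<nu> []"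
      by (intro spreading_strip_eq [OF \<nu>]) simp
    then show ?thesis using spreading_nonneg [OF \<nu>, of "[1]"] by (simp add: spreading_Nil [OF \<nu>])
  next
    case (Suc m)
    then have "\<nu> (map2 (-) (map ((*) c) (alternating n) @ [0]) (0 # map ((*) (- c)) (alternating n))) = \<nu> [c, - c]"
      by (intro spreading_strip_eq [OF \<nu>]) (simp only: shift, simp)
    then show ?thesis using spreading_le_sum [OF \<nu>, of "[c, -c]"] by simp
  qed
  also have "\<nu> (P @ (map ((*) c) (alternating n) @ [0]) @ Q) = \<nu> (P @ map ((*) c) (alternating n) @ Q)"
    by (rule spreading_strip_eq [OF \<nu>]) simp
  also have "\<nu> (P @ (0 # map ((*) (- c)) (alternating n)) @ Q) = \<nu> (P @ map ((*) (- c)) (alternating n) @ Q)"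
    by (rule spreading_strip_eq [OF \<nu>]) simp
  finally show ?thesis by (simp add: abs_minus_commute)
qed

text \<open>
  An entry in \<open>[0, 1]\<close> is raised to the first and an entry in \<open>[-1, 0]\<close> lowered to the second member of a pair
  \<open>1, -1\<close>; the other member is then inserted.
\<close>

lemma le_alternating:
  assumes \<nu>: "spreading \<nu>" and sup: "suppression \<nu>"
  shows "(\<And>x. x \<in> set xs \<Longrightarrow> \<bar>x\<bar> \<le> 1) \<Longrightarrow> \<nu> (P @ xs) \<le> \<nu> (P @ alternating (length xs))"
proof (induction xs arbitrary: P)
  case (Cons x xs)
  have x: "\<bar>x\<bar> \<le> 1" using Cons.prems by simp
  have "\<nu> (P @ x # xs) \<le> \<nu> (P @ [1, -1] @ xs)"
  proof (cases "x \<ge> 0")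
    case True
    then have "\<nu> (P @ (x * 1) # xs) \<le> \<nu> (P @ 1 # xs)" using x by (intro suppression_mono1 [OF \<nu> sup]) auto
    also have "\<dots> \<le> \<nu> ((P @ [1]) @ [-1] @ xs)" using suppressionD [OF sup, of "P @ [1]" xs "[-1]"] by simp
    finally show ?thesis by simp
  next
    case False
    then have "\<nu> (P @ ((- x) * (-1)) # xs) \<le> \<nu> (P @ (-1) # xs)"
      using x by (intro suppression_mono1 [OF \<nu> sup]) auto
    also have "\<dots> \<le> \<nu> (P @ [1] @ (-1) # xs)" by (rule suppressionD [OF sup])
    finally show ?thesis by simp
  qed
  also have "\<dots> \<le> \<nu> ((P @ [1, -1]) @ alternating (length xs))"
    using Cons.IH [of "P @ [1, -1]"] Cons.prems by simp
  finally show ?case by simp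
qed simp

primrec max_abs :: "real list \<Rightarrow> real" where
  "max_abs [] = 0"
| "max_abs (x # xs) = max \<bar>x\<bar> (max_abs xs)"

lemma max_abs_nonneg: "0 \<le> max_abs xs"
  by (induction xs) auto

lemma abs_le_max_abs: "x \<in> set xs \<Longrightarrow> \<bar>x\<bar> \<le> max_abs xs"
  by (induction xs) auto

lemma max_abs_cases: "max_abs xs = 0 \<or> (\<exists>x\<in>set xs. max_abs xs = \<bar>x\<bar>)"
  by (induction xs) (auto simp: max_def)

lemma max_abs_append: "max_abs (xs @ ys) = max (max_abs xs) (max_abs ys)"
  by (induction xs) (auto simp: max_abs_nonneg)

lemma abs_alternating: "x \<in> set (alternating n) \<Longrightarrow> \<bar>x\<bar> = 1"
  by (induction n) auto

text \<open>
  Take normalised alternating blocks of growing length.  If their original norms are unbounded, the two end points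
  by which a shifted block differs from the block with the opposite sign become negligible.  If the norms are bounded,
  then arbitrary combinations of long blocks are hardly larger than a single block, and the limit is
  the supremum norm.
\<close>

theorem ex_sign_invariant:
  fixes M :: "'a::real_normed_vector set"
  assumes M: "subspace M" and inf: "infinite_dimensional M"
  shows "\<exists>\<nu>. spreading \<nu> \<and> fin_rep M \<nu> \<and> sign_invariant \<nu> \<and> \<nu> [1] = 1"
proof -
  obtain x :: "nat \<Rightarrow> 'a" where x: "\<And>i. x i \<in> M" "\<And>i. norm (x i) = 1"
    "\<And>i j. i < j \<Longrightarrow> 1 \<le> norm (x i - x j)" using ex_separated_sequence [OF M inf] by metis
  have x1: "norm (x i) \<le> 1" for i using x(2) by simp
  define \<nu>0 where "\<nu>0 cs = iter_lim x cs 0" for cs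
  have \<nu>0: "spreading \<nu>0" "fin_rep M \<nu>0" "1 \<le> \<nu>0 [1, -1]"
    unfolding \<nu>0_def using spreading_iter_lim [OF x1] fin_rep_iter_lim [OF x1 x(1)]
      iter_lim_separated [OF x1 x(3)] by simp_all
  define \<nu> where "\<nu> cs = \<nu>0 (block [1, -1] cs)" for cs
  have \<nu>: "spreading \<nu>" and fr: "fin_rep M \<nu>" and sup: "suppression \<nu>" and pos: "1 \<le> \<nu> [1]"
    unfolding \<nu>_def using spreading_block [OF \<nu>0(1)] fin_rep_block [OF M \<nu>0(2)]
      suppression_differences [OF \<nu>0(1)] \<nu>0(3) by simp_all
  define a where "a n = \<nu> (alternating (Suc n))" for n
  have a1: "1 \<le> a n" for n
    using pos suppressionD [OF sup, of "[1]" "[]" "-1 # alternating n"] by (simp add: a_def)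
  have a_mono: "a m \<le> a n" if "m \<le> n" for m n
    using that
  proof (induction n rule: dec_induct)
    case (step n)
    have "a n \<le> a (Suc n)"
      unfolding a_def using suppressionD [OF sup, of "[]" "alternating (Suc n)" "[1, -1]"] by simp
    with step show ?case by simp
  qed simp
  define \<mu> where "\<mu> n cs = (1 / a n) * \<nu> (block (alternating (Suc n)) cs)" for n cs
  have sp: "spreading (\<mu> n)" for n
    unfolding \<mu>_def using a1 [of n] by (intro spreading_cmult spreading_block \<nu>) simp
  have frm: "fin_rep M (\<mu> n)" for n
    unfolding \<mu>_def using a1 [of n] by (intro fin_rep_cmult [OF M] fin_rep_block [OF M] fr) simp
  have one: "\<mu> n [1] = 1" for n
  proof -
    have "map ((*) 1) (alternating (Suc n)) = alternating (Suc n)" by (rule map_idI) simp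
    then have "\<mu> n [1] = (1 / a n) * a n" by (simp only: \<mu>_def a_def block_simps append_Nil2)
    then show ?thesis using a1 [of n] by simp
  qed
  define \<nu>' where "\<nu>' cs = ulim (\<lambda>n. \<mu> n cs)" for cs
  have lim: "((\<lambda>n. \<mu> n cs) \<longlongrightarrow> \<nu>' cs) free_ultrafilter" for cs
    unfolding \<nu>'_def by (rule spreading_tendsto [of \<mu> 1, OF sp]) (simp add: one)
  have "spreading \<nu>'" unfolding \<nu>'_def by (rule spreading_ulim [of \<mu> 1, OF sp]) (simp add: one)
  moreover have "fin_rep M \<nu>'" by (rule fin_rep_limit [OF frm lim])
  moreover have "\<nu>' [1] = 1" using one by (simp add: \<nu>'_def)
  moreover have "sign_invariant \<nu>'"
  proof (cases "\<exists>B. \<forall>n. a n \<le> B")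
    case True
    then have bdd: "bdd_above (range a)" by (auto simp: bdd_above_def)
    define L where "L = (SUP n. a n)"
    have aL: "a n \<le> L" for n unfolding L_def by (rule cSUP_upper [OF _ bdd]) simp
    have "a \<longlonglongrightarrow> L"
      unfolding L_def using a_mono by (intro LIMSEQ_incseq_SUP bdd) (simp add: incseq_def)
    moreover have "L \<noteq> 0" using a1 [of 0] aL [of 0] by linarith
    ultimately have ratio: "((\<lambda>n. L / a n) \<longlongrightarrow> L / L) free_ultrafilter"
      by (intro tendsto_ultra tendsto_divide tendsto_const)
    \<comment> \<open>Scaled into \<open>[-1, 1]\<close>, the coefficients form part of an alternating list.\<close>
    have upper: "\<mu> n cs \<le> max_abs cs * (L / a n)" for n cs
    proof -
      define C where "C = max_abs cs"
      have C0: "C \<ge> 0" unfolding C_def by (rule max_abs_nonneg)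
      have ent: "\<bar>y\<bar> \<le> C" if "y \<in> set (block (alternating (Suc n)) cs)" for y
        using that abs_alternating [of _ "Suc n"] abs_le_max_abs [of _ cs]
        by (auto simp: block_def C_def abs_mult simp del: alternating.simps)
      have "\<nu> (block (alternating (Suc n)) cs) \<le> C * L"
      proof (cases "C = 0")
        case True
        have "strip xs = []" if "\<And>y. y \<in> set xs \<Longrightarrow> \<bar>y\<bar> \<le> 0" for xs
          using that by (induction xs) auto
        then have "strip (block (alternating (Suc n)) cs) = strip []" using ent True by simp
        then have "\<nu> (block (alternating (Suc n)) cs) = \<nu> []" by (rule spreading_strip_eq [OF \<nu>])
        with True show ?thesis by (simp add: spreading_Nil [OF \<nu>])
      next
        case False
        with C0 have C: "C > 0" by simp
        let ?xs = "map ((*) (1 / C)) (block (alternating (Suc n)) cs)"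
        have "\<nu> ([] @ ?xs) \<le> \<nu> ([] @ alternating (length ?xs))"
          using ent C by (intro le_alternating [OF \<nu> sup]) (auto simp: abs_mult simp del: alternating.simps)
        also have "\<dots> \<le> L"
        proof (cases "length ?xs")
          case 0
          then show ?thesis using aL [of 0] a1 [of 0] by (simp add: spreading_Nil [OF \<nu>])
        next
          case (Suc m)
          then show ?thesis using aL [of m] by (simp only: a_def append_Nil)
        qed
        finally have "(1 / C) * \<nu> (block (alternating (Suc n)) cs) \<le> L"
          using C by (simp only: append_Nil spreading_scale [OF \<nu>]) simp
        with C show ?thesis by (simp add: field_simps)
      qed
      then show ?thesis using a1 [of n] by (simp add: \<mu>_def C_def divide_right_mono)
    qed
    have lower: "max_abs cs \<le> \<mu> n cs" for n cs
      using max_abs_cases [of cs]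
    proof
      assume "max_abs cs = 0"
      then show ?thesis using spreading_nonneg [OF sp, of n cs] by simp
    next
      assume "\<exists>x\<in>set cs. max_abs cs = \<bar>x\<bar>"
      then obtain c where c: "c \<in> set cs" "max_abs cs = \<bar>c\<bar>" by blast
      then obtain us vs where cs: "cs = us @ c # vs" by (meson split_list)
      let ?b = "block (alternating (Suc n))" and ?m = "map ((*) c) (alternating (Suc n))"
      have "\<nu> ([] @ ?m) \<le> \<nu> ([] @ ?b us @ ?m)" by (rule suppressionD [OF sup])
      also have "\<dots> \<le> \<nu> (?b cs)"
        using suppressionD [OF sup, of "?b us @ ?m" "[]" "?b vs"] by (simp add: cs del: alternating.simps)
      finally have "\<bar>c\<bar> * a n \<le> \<nu> (?b cs)" by (simp only: append_Nil spreading_scale [OF \<nu>] a_def)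
      then show ?thesis using a1 [of n] by (simp add: \<mu>_def c(2) field_simps del: alternating.simps)
    qed
    have "\<nu>' cs = max_abs cs" for cs
    proof (rule antisym)
      have "\<nu>' cs \<le> max_abs cs * (L / L)"
        by (rule tendsto_le [OF free_ultrafilter_nontrivial tendsto_mult_left [OF ratio] lim])
           (simp add: upper del: times_divide_eq_right)
      then show "\<nu>' cs \<le> max_abs cs" using \<open>L \<noteq> 0\<close> by simp
      show "max_abs cs \<le> \<nu>' cs"
        by (rule tendsto_le [OF free_ultrafilter_nontrivial lim tendsto_const]) (simp add: lower)
    qed
    then show ?thesis by (simp add: sign_invariant_def max_abs_append)
  next
    case False
    have "filterlim a at_top sequentially"
      unfolding filterlim_at_top eventually_sequentially
    proof (intro allI)
      fix Z
      obtain n where "Z < a n" using False by (meson not_le)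
      then show "\<exists>N. \<forall>n\<ge>N. Z \<le> a n" using a_mono by (meson less_imp_le order_trans)
    qed
    show ?thesis unfolding sign_invariant_def
    proof (intro allI)
      fix P c Q
      let ?K = "2 * \<bar>c\<bar> * \<nu> [1]"
      have "\<bar>\<mu> n (P @ (- c) # Q) - \<mu> n (P @ c # Q)\<bar> \<le> ?K / a n" for n
      proof -
        have "\<bar>\<nu> (block (alternating (Suc n)) (P @ (- c) # Q)) - \<nu> (block (alternating (Suc n)) (P @ c # Q))\<bar> \<le> ?K"
          unfolding block_simps by (rule alternating_shift [OF \<nu>])
        then have "(1 / a n) * \<bar>\<nu> (block (alternating (Suc n)) (P @ (- c) # Q))
            - \<nu> (block (alternating (Suc n)) (P @ c # Q))\<bar> \<le> (1 / a n) * ?K"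
          using a1 [of n] by (intro mult_left_mono) auto
        moreover have "\<mu> n (P @ (- c) # Q) - \<mu> n (P @ c # Q)
            = (1 / a n) * (\<nu> (block (alternating (Suc n)) (P @ (- c) # Q))
            - \<nu> (block (alternating (Suc n)) (P @ c # Q)))"
          by (simp only: \<mu>_def right_diff_distrib)
        ultimately show ?thesis using a1 [of n] by (simp add: abs_mult)
      qed
      moreover have "((\<lambda>n. ?K / a n) \<longlongrightarrow> 0) free_ultrafilter"
        by (intro tendsto_ultra tendsto_divide_0 [OF tendsto_const] filterlim_at_top_imp_at_infinity) fact
      ultimately have "\<bar>\<nu>' (P @ (- c) # Q) - \<nu>' (P @ c # Q)\<bar> \<le> 0"
        by (intro tendsto_le [OF free_ultrafilter_nontrivial _ tendsto_rabs [OF tendsto_diff [OF lim lim]]]) auto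
      then show "\<nu>' (P @ (- c) # Q) = \<nu>' (P @ c # Q)" by simp
    qed
  qed
  ultimately show ?thesis by blast
qed

section \<open>Approximate eigenvectors of commuting positive operators\<close>

text \<open>
  \<open>K\<close> plays the role of the positive cone.  Monotonicity of \<open>q\<close> on \<open>K\<close> is what makes approximate
  eigenvectors exist: sums of vectors in \<open>K\<close> cannot cancel.
\<close>

locale positive_operators =
  fixes q :: "'v::real_vector \<Rightarrow> real" and W K :: "'v set" and T :: "'k \<Rightarrow> 'v \<Rightarrow> 'v" and B :: "'k \<Rightarrow> real"
  assumes W: "subspace W" and KW: "K \<subseteq> W"
    and K_add: "x \<in> K \<Longrightarrow> y \<in> K \<Longrightarrow> x + y \<in> K"
    and K_scale: "0 \<le> c \<Longrightarrow> x \<in> K \<Longrightarrow> c *\<^sub>R x \<in> K"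
    and q_add: "x \<in> W \<Longrightarrow> y \<in> W \<Longrightarrow> q (x + y) \<le> q x + q y"
    and q_scale: "x \<in> W \<Longrightarrow> q (c *\<^sub>R x) = \<bar>c\<bar> * q x"
    and q_mono: "x \<in> K \<Longrightarrow> y \<in> K \<Longrightarrow> q x \<le> q (x + y)"
    and T_linear: "linear (T i)"
    and T_W: "x \<in> W \<Longrightarrow> T i x \<in> W" and T_K: "x \<in> K \<Longrightarrow> T i x \<in> K"
    and T_bound: "x \<in> W \<Longrightarrow> q (T i x) \<le> B i * q x" and B: "1 \<le> B i"
    and T_ge: "x \<in> K \<Longrightarrow> q x \<le> q (T i x)"
    and T_commute: "T i (T j x) = T j (T i x)"
    and ex_pos: "\<exists>x\<in>K. 0 < q x"
begin

lemma K_0: "0 \<in> K"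
  using K_scale [of 0] ex_pos by force

lemma K_sum: "finite A \<Longrightarrow> (\<And>i. i \<in> A \<Longrightarrow> f i \<in> K) \<Longrightarrow> sum f A \<in> K"
  by (induction A rule: finite_induct) (auto simp: K_0 K_add)

lemma q_0: "q 0 = 0"
  using q_scale [of 0 0] subspace_0 [OF W] by simp

lemma q_sum: "finite A \<Longrightarrow> (\<And>i. i \<in> A \<Longrightarrow> f i \<in> W) \<Longrightarrow> q (sum f A) \<le> (\<Sum>i\<in>A. q (f i))"
proof (induction A rule: finite_induct)
  case (insert a A)
  have "q (f a + sum f A) \<le> q (f a) + q (sum f A)"
    using insert by (intro q_add subspace_sum [OF W]) auto
  with insert show ?case by simp
qed (simp add: q_0)

lemma pow_linear: "linear (T k ^^ n)"
proof (induction n)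
  case 0
  show ?case using linear_id by (simp add: id_def)
next
  case (Suc n)
  show ?case using linear_compose [OF Suc T_linear] by (simp add: o_def)
qed

lemma pow_K: "x \<in> K \<Longrightarrow> (T k ^^ n) x \<in> K"
  by (induction n) (auto intro: T_K)

lemma pow_W: "x \<in> W \<Longrightarrow> (T k ^^ n) x \<in> W"
  by (induction n) (auto intro: T_W)

lemma pow_bound: "x \<in> W \<Longrightarrow> q ((T k ^^ n) x) \<le> B k ^ n * q x"
proof (induction n)
  case (Suc n)
  have "q (T k ((T k ^^ n) x)) \<le> B k * q ((T k ^^ n) x)" by (intro T_bound pow_W Suc.prems)
  also have "\<dots> \<le> B k * (B k ^ n * q x)" using Suc B [of k] by (intro mult_left_mono) auto
  finally show ?case by (simp add: mult.assoc)
qed simp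

lemma pow_ge: "x \<in> K \<Longrightarrow> q x \<le> q ((T k ^^ n) x)"
proof (induction n)
  case (Suc n)
  then show ?case using T_ge [OF pow_K [of x n k], of k] by simp
qed simp

lemma pow_commute: "T i ((T k ^^ n) x) = (T k ^^ n) (T i x)"
  by (induction n) (simp_all add: T_commute [of i k])

definition approx_eigen :: "'k set \<Rightarrow> ('k \<Rightarrow> real) \<Rightarrow> real \<Rightarrow> 'v set" where
  "approx_eigen I lam \<delta> = {x\<in>K. 0 < q x \<and> (\<forall>i\<in>I. q (T i x - lam i *\<^sub>R x) \<le> \<delta> * q x)}"

lemma approx_eigen_mono: "\<delta> \<le> \<delta>' \<Longrightarrow> x \<in> approx_eigen I lam \<delta> \<Longrightarrow> x \<in> approx_eigen I lam \<delta>'"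
  unfolding approx_eigen_def by (auto intro: order_trans mult_right_mono)

text \<open>As \<open>T k\<close> commutes with the other operators, its polynomials preserve approximate eigenvectors.\<close>

lemma approx_eigen_combination:
  assumes x: "x \<in> approx_eigen I lam \<delta>" and a: "\<And>j. j < n \<Longrightarrow> 0 \<le> a j"
    and y: "y = (\<Sum>j<n. a j *\<^sub>R (T k ^^ j) x)" and xy: "q x \<le> q y"
    and \<delta>: "0 \<le> \<delta>"
  shows "y \<in> approx_eigen I lam ((\<Sum>j<n. a j * B k ^ j) * \<delta>)"
proof -
  have xK: "x \<in> K" and x0: "0 < q x" and xW: "x \<in> W" using x KW by (auto simp: approx_eigen_def)
  have nn: "0 \<le> (\<Sum>j<n. a j * B k ^ j)"
    using a B [of k] by (intro sum_nonneg mult_nonneg_nonneg zero_le_power) auto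
  have yK: "y \<in> K" unfolding y using a xK by (intro K_sum K_scale pow_K) auto
  have "q (T i y - lam i *\<^sub>R y) \<le> (\<Sum>j<n. a j * B k ^ j) * \<delta> * q y" if i: "i \<in> I" for i
  proof -
    define d where "d = T i x - lam i *\<^sub>R x"
    have dW: "d \<in> W" unfolding d_def using xW by (intro subspace_diff [OF W] subspace_scale [OF W] T_W)
    have "T i y - lam i *\<^sub>R y = (\<Sum>j<n. a j *\<^sub>R (T k ^^ j) d)"
      unfolding y d_def
      by (simp add: linear_sum [OF T_linear] linear_cmul [OF T_linear] pow_commute linear_diff [OF pow_linear]
          linear_cmul [OF pow_linear] scaleR_sum_right sum_subtractf scaleR_diff_right mult.commute)
    also have "q \<dots> \<le> (\<Sum>j<n. q (a j *\<^sub>R (T k ^^ j) d))"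
      by (intro q_sum subspace_scale [OF W] pow_W dW) auto
    also have "\<dots> \<le> (\<Sum>j<n. a j * B k ^ j * q d)"
    proof (rule sum_mono)
      fix j assume "j \<in> {..<n}"
      then have "q (a j *\<^sub>R (T k ^^ j) d) = a j * q ((T k ^^ j) d)"
        using a by (simp add: q_scale [OF pow_W [OF dW]])
      also have "\<dots> \<le> a j * (B k ^ j * q d)"
        using a \<open>j \<in> {..<n}\<close> by (intro mult_left_mono pow_bound dW) auto
      finally show "q (a j *\<^sub>R (T k ^^ j) d) \<le> a j * B k ^ j * q d" by (simp add: mult.assoc)
    qed
    also have "\<dots> = (\<Sum>j<n. a j * B k ^ j) * q d" by (simp add: sum_distrib_right)
    also have "\<dots> \<le> (\<Sum>j<n. a j * B k ^ j) * (\<delta> * q y)"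
    proof (intro mult_left_mono nn)
      have "q d \<le> \<delta> * q x" using x i by (simp add: approx_eigen_def d_def)
      also have "\<dots> \<le> \<delta> * q y" using xy \<delta> by (rule mult_left_mono)
      finally show "q d \<le> \<delta> * q y" .
    qed
    finally show ?thesis by (simp add: mult.assoc)
  qed
  then show ?thesis using yK x0 xy by (simp add: approx_eigen_def)
qed

text \<open>
  The number \<open>r\<close> below is the spectral radius of \<open>T k\<close> relative to the approximate eigenvectors
  of the other operators.  For \<open>s\<close> slightly above \<open>r\<close>, let \<open>R = \<Sum>j<n. s\<^sup>-\<^sup>j T\<^sup>j\<close> with \<open>n\<close> so large that
  \<open>T\<^sup>n x\<close> is at most \<open>s\<^sup>n\<close> times as large as \<open>x\<close>.  Then \<open>T (R x) - s R x\<close> is at most of the size of \<open>x\<close>, so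
  \<open>R x\<close> is an approximate eigenvector unless \<open>R x\<close> is comparable with \<open>x\<close>.  If this failed both for \<open>x\<close> and
  for \<open>R x\<close>, then \<open>R (R x)\<close> would be comparable with \<open>x\<close>;  but it dominates
  \<open>(m + 1) s\<^sup>-\<^sup>m T\<^sup>m x\<close> for every \<open>m < n\<close>, which is large for a suitable \<open>x\<close> by the choice of \<open>r\<close>.
\<close>

lemma approx_eigen_extend:
  assumes ne: "\<And>\<delta>. 0 < \<delta> \<Longrightarrow> approx_eigen I lam \<delta> \<noteq> {}"
  shows "\<exists>r\<ge>1. \<forall>\<epsilon>>0. \<exists>y\<in>approx_eigen I lam \<epsilon>. q (T k y - r *\<^sub>R y) \<le> \<epsilon> * q y"
proof -
  let ?S = "approx_eigen I lam" and ?T = "T k"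
  have SK: "x \<in> K" "x \<in> W" "0 < q x" if "x \<in> ?S \<delta>" for x \<delta>
    using that KW by (auto simp: approx_eigen_def)
  define G where "G = {s. 0 < s \<and> (\<exists>n\<ge>1. \<exists>\<delta>>0. \<forall>x\<in>?S \<delta>. q ((?T ^^ n) x) \<le> s ^ n * q x)}"
  have G1: "1 \<le> s" if sG: "s \<in> G" for s
  proof -
    obtain n \<delta> where n: "n \<ge> 1" "0 < \<delta>" "0 < s" "\<And>x. x \<in> ?S \<delta> \<Longrightarrow> q ((?T ^^ n) x) \<le> s ^ n * q x"
      using sG unfolding G_def by blast
    obtain x where x: "x \<in> ?S \<delta>" using ne [OF n(2)] by blast
    have "1 * q x \<le> s ^ n * q x" using n(4) [OF x] pow_ge [OF SK(1) [OF x], of n k] by simp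
    then have "1 \<le> s ^ n" using SK(3) [OF x] by (simp add: mult_le_cancel_right)
    then show ?thesis using n(1,3) power_less_one_iff [of s n] by (cases "s < 1") auto
  qed
  have BG: "B k \<in> G"
    unfolding G_def
  proof (intro CollectI conjI exI [of _ "1::nat"] exI [of _ "1::real"] ballI)
    show "0 < B k" using B [of k] by simp
    show "q ((?T ^^ 1) x) \<le> B k ^ 1 * q x" if "x \<in> ?S 1" for x
      using T_bound [OF SK(2) [OF that], of k] by simp
  qed auto
  have bdd: "bdd_below G" using G1 by (rule bdd_belowI)
  define r where "r = Inf G"
  have r1: "1 \<le> r" unfolding r_def using G1 BG by (intro cInf_greatest) auto
  have small: "\<exists>x\<in>?S \<delta>. s ^ n * q x < q ((?T ^^ n) x)" if "0 < s" "s < r" "n \<ge> 1" "0 < \<delta>" for s n \<delta>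
  proof (rule ccontr)
    assume "\<not> ?thesis"
    then have "s \<in> G" using that unfolding G_def by (force simp: not_less)
    then have "r \<le> s" unfolding r_def by (rule cInf_lower [OF _ bdd])
    with that show False by simp
  qed
  have large: "\<exists>n\<ge>m. \<exists>\<delta>>0. \<forall>x\<in>?S \<delta>. q ((?T ^^ n) x) \<le> s ^ n * q x" if s: "r < s" for s m
  proof -
    obtain g where g: "g \<in> G" "g < s" using s BG cInf_lessD [of G s] unfolding r_def by blast
    obtain p \<delta>0 where p: "p \<ge> 1" "0 < \<delta>0" "0 < g" "\<And>x. x \<in> ?S \<delta>0 \<Longrightarrow> q ((?T ^^ p) x) \<le> g ^ p * q x"
      using g(1) unfolding G_def by blast
    have gs: "g ^ p \<le> s ^ p" using p(3) g(2) by (intro power_mono) auto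
    have s0: "0 < s" using r1 s by simp
    have p': "q ((?T ^^ p) x) \<le> s ^ p * q x" if "x \<in> ?S \<delta>0" for x
      using p(4) [OF that] mult_right_mono [OF gs, of "q x"] SK(3) [OF that] by linarith
    have "\<exists>\<delta>>0. \<forall>x\<in>?S \<delta>. q ((?T ^^ (p * j)) x) \<le> s ^ (p * j) * q x" for j
    proof (induction j)
      case 0
      then show ?case by (auto intro: exI [of _ 1])
    next
      case (Suc j)
      then obtain \<delta> where \<delta>: "0 < \<delta>" "\<And>x. x \<in> ?S \<delta> \<Longrightarrow> q ((?T ^^ (p * j)) x) \<le> s ^ (p * j) * q x" by blast
      have Bp: "0 < B k ^ (p * j)" using B [of k] by simp
      define \<delta>' where "\<delta>' = min \<delta> (\<delta>0 / B k ^ (p * j))"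
      have \<delta>': "0 < \<delta>'" "\<delta>' \<le> \<delta>" "B k ^ (p * j) * \<delta>' \<le> \<delta>0"
        using \<delta>(1) p(2) Bp by (auto simp: \<delta>'_def min_def field_simps)
      have "q ((?T ^^ (p * Suc j)) x) \<le> s ^ (p * Suc j) * q x" if x: "x \<in> ?S \<delta>'" for x
      proof -
        let ?y = "(?T ^^ (p * j)) x"
        have "?y \<in> ?S ((\<Sum>i<Suc (p * j). (if i = p * j then 1 else 0) * B k ^ i) * \<delta>')"
          using \<delta>'(1) pow_ge [OF SK(1) [OF x]]
          by (intro approx_eigen_combination [OF x, where k = k]) (auto simp: if_distrib [of "\<lambda>c. c *\<^sub>R _"] cong: if_cong)
        also have "(\<Sum>i<Suc (p * j). (if i = p * j then 1 else 0) * B k ^ i) = B k ^ (p * j)"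
          by (simp add: if_distrib [of "\<lambda>c. c * _"] cong: if_cong)
        finally have "?y \<in> ?S \<delta>0" using approx_eigen_mono [OF \<delta>'(3)] by blast
        then have "q ((?T ^^ p) ?y) \<le> s ^ p * q ?y" by (rule p')
        also have "\<dots> \<le> s ^ p * (s ^ (p * j) * q x)"
          using s0 \<delta>(2) [OF approx_eigen_mono [OF \<delta>'(2) x]] by (intro mult_left_mono) auto
        finally show ?thesis by (simp add: funpow_add power_add mult.assoc)
      qed
      then show ?case using \<delta>'(1) by blast
    qed
    then obtain \<delta> where "0 < \<delta>" "\<forall>x\<in>?S \<delta>. q ((?T ^^ (p * m)) x) \<le> s ^ (p * m) * q x" by blast
    moreover have "m \<le> p * m" using p(1) by simp
    ultimately show ?thesis by blast
  qed
  have "\<exists>y\<in>?S \<epsilon>. q (?T y - r *\<^sub>R y) \<le> \<epsilon> * q y" if \<epsilon>: "0 < \<epsilon>" for \<epsilon>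
  proof -
    define C where "C = 4 * (r + \<epsilon> / 2) / \<epsilon>"
    have C0: "0 < C" using r1 \<epsilon> by (simp add: C_def)
    obtain m0 :: nat where m0: "2 * C\<^sup>2 < real m0" using reals_Archimedean2 by blast
    define m where "m = Suc m0"
    have m: "m \<ge> 1" "2 * C\<^sup>2 < real m + 1" using m0 by (auto simp: m_def)
    define \<eta> where "\<eta> = min (\<epsilon> / 2) (1 / (4 * (real m + 1)))"
    have \<eta>: "0 < \<eta>" "\<eta> \<le> \<epsilon> / 2" "\<eta> * (4 * (real m + 1)) \<le> 1"
      using \<epsilon> by (auto simp: \<eta>_def min_def field_simps)
    have "\<eta> * 4 \<le> \<eta> * (4 * (real m + 1))" using \<eta>(1) by (intro mult_left_mono) auto
    with \<eta>(3) have \<eta>4: "\<eta> \<le> 1 / 4" by simp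
    define s where "s = r + \<eta>"
    have s: "r < s" "0 < s" "1 \<le> s" "s \<le> r + \<epsilon> / 2" using r1 \<eta> by (auto simp: s_def)
    \<comment> \<open>The choice of \<open>\<eta>\<close> keeps \<open>((r - \<eta>) / (r + \<eta>))^m\<close> above \<open>1 / 2\<close>, by Bernoulli.\<close>
    have half: "1 / 2 * s ^ m \<le> (r - \<eta>) ^ m"
    proof -
      have "(r - \<eta>) / s = 1 + (- (2 * \<eta> / s))" using s by (simp add: s_def field_simps)
      moreover have "2 * \<eta> / s \<le> 2 * \<eta>" using s \<eta>(1) by (simp add: field_simps)
      moreover have "1 + real m * (- (2 * \<eta> / s)) \<le> (1 + (- (2 * \<eta> / s))) ^ m"
        using \<open>2 * \<eta> / s \<le> 2 * \<eta>\<close> \<eta>4 by (intro Bernoulli_inequality) simp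
      moreover have "real m * (2 * \<eta> / s) \<le> real m * (2 * \<eta>)"
        using \<open>2 * \<eta> / s \<le> 2 * \<eta>\<close> by (intro mult_left_mono) auto
      moreover have "real m * (2 * \<eta>) \<le> 1 / 2" using \<eta>(1,3) by (simp add: algebra_simps)
      ultimately have "1 / 2 \<le> ((r - \<eta>) / s) ^ m" by simp
      then show ?thesis using s by (simp add: power_divide field_simps)
    qed
    obtain n \<delta>1 where n: "m + 1 \<le> n" "0 < \<delta>1" "\<And>x. x \<in> ?S \<delta>1 \<Longrightarrow> q ((?T ^^ n) x) \<le> s ^ n * q x"
      using large [OF s(1), of "m + 1"] by blast
    define R where "R x = (\<Sum>j<n. (1 / s ^ j) *\<^sub>R (?T ^^ j) x)" for x
    define A where "A = (\<Sum>j<n. (1 / s ^ j) * B k ^ j)"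
    have A1: "1 \<le> A"
    proof -
      have "(\<Sum>j\<in>{0::nat}. (1 / s ^ j) * B k ^ j) \<le> A"
        unfolding A_def using n(1) s(2) B [of k] by (intro sum_mono2) auto
      then show ?thesis by simp
    qed
    have Rj: "\<exists>e\<in>K. R x = (1 / s ^ j) *\<^sub>R (?T ^^ j) x + e" if "x \<in> K" "j < n" for x j
    proof -
      have "R x = (1 / s ^ j) *\<^sub>R (?T ^^ j) x + (\<Sum>i\<in>{..<n} - {j}. (1 / s ^ i) *\<^sub>R (?T ^^ i) x)"
        unfolding R_def using that(2) by (intro sum.remove) auto
      moreover have "(\<Sum>i\<in>{..<n} - {j}. (1 / s ^ i) *\<^sub>R (?T ^^ i) x) \<in> K"
        using s(2) that(1) by (intro K_sum K_scale pow_K) auto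
      ultimately show ?thesis by blast
    qed
    have R_ge: "q x \<le> q (R x)" if xK: "x \<in> K" for x
    proof -
      obtain e where "e \<in> K" "R x = (1 / s ^ 0) *\<^sub>R (?T ^^ 0) x + e" using Rj [OF xK, of 0] n(1) by auto
      then show ?thesis using q_mono [OF xK] by simp
    qed
    have R_S: "R x \<in> ?S (A * \<delta>)" if "x \<in> ?S \<delta>" "0 \<le> \<delta>" for x \<delta>
      unfolding A_def using s(2) R_ge [OF SK(1) [OF that(1)]]
      by (intro approx_eigen_combination [OF that(1)]) (auto simp: R_def that(2))
    \<comment> \<open>The sum telescopes: \<open>T (R x) - s R x = s (s\<^sup>-\<^sup>n T\<^sup>n x - x)\<close>.\<close>
    have eigen: "q (?T (R x) - r *\<^sub>R R x) \<le> \<epsilon> * q (R x)" if x: "x \<in> ?S \<delta>1" and C: "C * q x \<le> q (R x)" for x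
    proof -
      have RW: "R x \<in> W" unfolding R_def
        by (intro subspace_sum [OF W] subspace_scale [OF W] pow_W SK(2) [OF x])
      let ?u = "(1 / s ^ n) *\<^sub>R (?T ^^ n) x"
      have uW: "?u \<in> W" by (intro subspace_scale [OF W] pow_W SK(2) [OF x])
      have "?T (R x) = (\<Sum>j<n. s *\<^sub>R ((1 / s ^ Suc j) *\<^sub>R (?T ^^ Suc j) x))"
        unfolding R_def using s(2) by (simp add: linear_sum [OF T_linear] linear_cmul [OF T_linear])
      also have "\<dots> = s *\<^sub>R (\<Sum>j<n. (1 / s ^ Suc j) *\<^sub>R (?T ^^ Suc j) x)" by (simp only: scaleR_sum_right)
      also have "(\<Sum>j<n. (1 / s ^ Suc j) *\<^sub>R (?T ^^ Suc j) x) = R x + ?u - x"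
      proof -
        have "(\<Sum>j<Suc n. (1 / s ^ j) *\<^sub>R (?T ^^ j) x) = x + (\<Sum>j<n. (1 / s ^ Suc j) *\<^sub>R (?T ^^ Suc j) x)"
          by (subst sum.lessThan_Suc_shift) simp
        moreover have "(\<Sum>j<Suc n. (1 / s ^ j) *\<^sub>R (?T ^^ j) x) = R x + ?u" by (simp add: R_def)
        ultimately show ?thesis by (simp add: algebra_simps)
      qed
      finally have eq: "?T (R x) - r *\<^sub>R R x = s *\<^sub>R ?u + ((- s) *\<^sub>R x + (s - r) *\<^sub>R R x)"
        by (simp add: algebra_simps)
      have 1: "q (?T (R x) - r *\<^sub>R R x) \<le> q (s *\<^sub>R ?u) + q ((- s) *\<^sub>R x + (s - r) *\<^sub>R R x)"
        unfolding eq by (intro q_add subspace_add [OF W] subspace_scale [OF W] uW RW SK(2) [OF x])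
      have 2: "q ((- s) *\<^sub>R x + (s - r) *\<^sub>R R x) \<le> q ((- s) *\<^sub>R x) + q ((s - r) *\<^sub>R R x)"
        by (intro q_add subspace_scale [OF W] RW SK(2) [OF x])
      from 1 2 have "q (?T (R x) - r *\<^sub>R R x) \<le> q (s *\<^sub>R ?u) + (q ((- s) *\<^sub>R x) + q ((s - r) *\<^sub>R R x))"
        by linarith
      also have "q (s *\<^sub>R ?u) + (q ((- s) *\<^sub>R x) + q ((s - r) *\<^sub>R R x))
          = s * q ?u + (s * q x + (s - r) * q (R x))"
        using s by (simp only: q_scale [OF uW] q_scale [OF RW] q_scale [OF SK(2) [OF x]] abs_minus_cancel)
      also have "s * q ?u + (s * q x + (s - r) * q (R x)) \<le> s * q x + (s * q x + \<epsilon> / 2 * q (R x))"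
      proof (intro add_mono mult_left_mono mult_right_mono order_refl)
        have "q ?u = (1 / s ^ n) * q ((?T ^^ n) x)" using s(2) by (simp add: q_scale pow_W SK(2) [OF x])
        also have "\<dots> \<le> (1 / s ^ n) * (s ^ n * q x)" using s(2) n(3) [OF x] by (intro mult_left_mono) auto
        finally show "q ?u \<le> q x" using s(2) by simp
        show "0 \<le> q (R x)" using R_ge [OF SK(1) [OF x]] SK(3) [OF x] by simp
      qed (use s in auto)
      also have "s * q x + (s * q x + \<epsilon> / 2 * q (R x)) \<le> \<epsilon> * q (R x)"
      proof -
        have "2 * s * q x \<le> 2 * (r + \<epsilon> / 2) * q x"
          using s(4) SK(3) [OF x] by (intro mult_right_mono) auto
        also have "\<dots> = \<epsilon> / 2 * (C * q x)" using \<epsilon> by (simp add: C_def field_simps)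
        also have "\<dots> \<le> \<epsilon> / 2 * q (R x)" using \<epsilon> C by (intro mult_left_mono) auto
        finally show ?thesis by simp
      qed
      finally show ?thesis .
    qed
    define \<delta> where "\<delta> = min \<delta>1 \<epsilon> / (A * A)"
    have d0: "0 < \<delta>" using n(2) \<epsilon> A1 by (simp add: \<delta>_def)
    have dAA: "A * (A * \<delta>) = min \<delta>1 \<epsilon>" using A1 by (simp add: \<delta>_def)
    have d: "\<delta> \<le> A * \<delta>" using A1 d0 by (simp add: mult_le_cancel_right1)
    then have dA: "A * \<delta> \<le> A * (A * \<delta>)" using A1 by (intro mult_left_mono) auto
    have rn: "0 < r - \<eta>" "r - \<eta> < r" using r1 \<eta>(1) \<eta>4 by auto
    obtain x where x: "x \<in> ?S \<delta>" "(r - \<eta>) ^ m * q x < q ((?T ^^ m) x)"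
      using small [OF rn m(1) d0] by blast
    let ?y = "R x" let ?z = "R (R x)"
    have y: "?y \<in> ?S (A * \<delta>)" using R_S [OF x(1)] d0 by simp
    have z: "?z \<in> ?S (A * (A * \<delta>))" using R_S [OF y] d0 A1 by simp
    have "min \<delta>1 \<epsilon> \<le> \<delta>1" "min \<delta>1 \<epsilon> \<le> \<epsilon>" by simp_all
    with d dA dAA have le: "\<delta> \<le> \<delta>1" "A * \<delta> \<le> \<delta>1" "A * \<delta> \<le> \<epsilon>" "A * (A * \<delta>) \<le> \<epsilon>"
      by linarith+
    have in1: "x \<in> ?S \<delta>1" "?y \<in> ?S \<delta>1"
      using approx_eigen_mono [OF le(1) x(1)] approx_eigen_mono [OF le(2) y] by auto
    have in2: "?y \<in> ?S \<epsilon>" "?z \<in> ?S \<epsilon>"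
      using approx_eigen_mono [OF le(3) y] approx_eigen_mono [OF le(4) z] by auto
    show ?thesis
    proof (cases "C * q x \<le> q ?y \<or> C * q ?y \<le> q ?z")
      case True
      then show ?thesis using eigen in1 in2 by blast
    next
      case False
      then have "q ?z < C * q ?y" "q ?y < C * q x" by auto
      then have "q ?z < C * (C * q x)" using C0 by (meson less_trans mult_strict_left_mono)
      then have up: "q ?z < C\<^sup>2 * q x" by (simp add: power2_eq_square mult.assoc)
      define v where "v = (1 / s ^ m) *\<^sub>R (?T ^^ m) x"
      have xK: "x \<in> K" and yK: "?y \<in> K" using SK x(1) y by blast+
      have vK: "v \<in> K" unfolding v_def using s(2) xK by (intro K_scale pow_K) auto
      have "\<exists>e\<in>K. (1 / s ^ i) *\<^sub>R (?T ^^ i) ?y = (if i \<le> m then v else 0) + e" if "i < n" for i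
      proof (cases "i \<le> m")
        case True
        have "m - i < n" using n(1) by simp
        then obtain e where e: "e \<in> K" "?y = (1 / s ^ (m - i)) *\<^sub>R (?T ^^ (m - i)) x + e"
          using Rj [OF xK, of "m - i"] by blast
        have "s ^ i * s ^ (m - i) = s ^ m" using True by (simp flip: power_add)
        moreover have "(?T ^^ i) ((?T ^^ (m - i)) x) = (?T ^^ m) x"
          using True by (simp flip: funpow_add [THEN fun_cong, unfolded o_def])
        ultimately have "(1 / s ^ i) *\<^sub>R (?T ^^ i) ?y = v + (1 / s ^ i) *\<^sub>R (?T ^^ i) e"
          unfolding e(2) v_def
          by (simp add: linear_add [OF pow_linear] linear_cmul [OF pow_linear] scaleR_add_right)
        moreover have "(1 / s ^ i) *\<^sub>R (?T ^^ i) e \<in> K" using s(2) e(1) by (intro K_scale pow_K) auto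
        ultimately show ?thesis using True by auto
      next
        case False
        have "(1 / s ^ i) *\<^sub>R (?T ^^ i) ?y \<in> K" using s(2) yK by (intro K_scale pow_K) auto
        then show ?thesis using False by auto
      qed
      then obtain e where e: "\<And>i. i < n \<Longrightarrow> e i \<in> K"
        "\<And>i. i < n \<Longrightarrow> (1 / s ^ i) *\<^sub>R (?T ^^ i) ?y = (if i \<le> m then v else 0) + e i" by metis
      have "?z = (\<Sum>i<n. (if i \<le> m then v else 0) + e i)"
        unfolding R_def [of "R x"] using e(2) by (intro sum.cong) auto
      also have "\<dots> = (\<Sum>i<n. if i \<le> m then v else 0) + (\<Sum>i<n. e i)" by (rule sum.distrib)
      also have "(\<Sum>i<n. if i \<le> m then v else 0) = (\<Sum>i\<in>{..m}. v)"
        using n(1) by (intro sum.mono_neutral_cong_right) auto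
      finally have "?z = (real m + 1) *\<^sub>R v + (\<Sum>i<n. e i)" by (simp add: sum_constant_scaleR add.commute)
      moreover have "(real m + 1) *\<^sub>R v \<in> K" "(\<Sum>i<n. e i) \<in> K" using vK e(1) by (auto intro: K_scale K_sum)
      ultimately have "q ((real m + 1) *\<^sub>R v) \<le> q ?z" using q_mono by simp
      moreover have "q ((real m + 1) *\<^sub>R v) = (real m + 1) * ((1 / s ^ m) * q ((?T ^^ m) x))"
        using s(2) xK vK KW by (simp add: v_def q_scale pow_W subspace_scale [OF W] subset_iff del: scaleR_scaleR)
      moreover have "(real m + 1) * (1 / 2 * q x) \<le> (real m + 1) * ((1 / s ^ m) * q ((?T ^^ m) x))"
      proof (rule mult_left_mono)
        have "1 / 2 * q x = (1 / s ^ m) * (1 / 2 * s ^ m * q x)" using s(2) by simp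
        also have "\<dots> \<le> (1 / s ^ m) * ((r - \<eta>) ^ m * q x)"
          using s(2) half SK(3) [OF x(1)] by (intro mult_left_mono mult_right_mono) auto
        also have "\<dots> \<le> (1 / s ^ m) * q ((?T ^^ m) x)" using s(2) x(2) by (intro mult_left_mono) auto
        finally show "1 / 2 * q x \<le> (1 / s ^ m) * q ((?T ^^ m) x)" .
      qed simp
      ultimately have "(real m + 1) * (1 / 2 * q x) < C\<^sup>2 * q x" using up by linarith
      moreover have "2 * C\<^sup>2 * q x < (real m + 1) * q x"
        using m(2) SK(3) [OF x(1)] by (intro mult_strict_right_mono)
      ultimately show ?thesis by simp
    qed
  qed
  with r1 show ?thesis by blast
qed

text \<open>
  One operator is added at a time; the approximate eigenvectors of the earlier ones form the set in which
  those of the new one are found.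
\<close>

theorem ex_joint_approx_eigen:
  assumes "finite I"
  shows "\<exists>lam. (\<forall>i. 1 \<le> lam i) \<and> (\<forall>\<epsilon>>0. \<exists>x\<in>K. 0 < q x \<and> (\<forall>i\<in>I. q (T i x - lam i *\<^sub>R x) \<le> \<epsilon> * q x))"
  using assms
proof (induction I rule: finite_induct)
  case empty
  then show ?case using ex_pos by (intro exI [of _ "\<lambda>_. 1"]) auto
next
  case (insert k I)
  then obtain lam where lam: "\<And>i. 1 \<le> lam i"
    "\<And>\<epsilon>. 0 < \<epsilon> \<Longrightarrow> \<exists>x\<in>K. 0 < q x \<and> (\<forall>i\<in>I. q (T i x - lam i *\<^sub>R x) \<le> \<epsilon> * q x)" by blast
  have "approx_eigen I lam \<delta> \<noteq> {}" if "0 < \<delta>" for \<delta>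
    using lam(2) [OF that] by (auto simp: approx_eigen_def)
  then obtain r where r: "1 \<le> r"
    "\<And>\<epsilon>. 0 < \<epsilon> \<Longrightarrow> \<exists>y\<in>approx_eigen I lam \<epsilon>. q (T k y - r *\<^sub>R y) \<le> \<epsilon> * q y"
    using approx_eigen_extend [of I lam k] by blast
  have "\<exists>x\<in>K. 0 < q x \<and> (\<forall>i\<in>insert k I. q (T i x - (lam(k := r)) i *\<^sub>R x) \<le> \<epsilon> * q x)" if "0 < \<epsilon>" for \<epsilon>
    using r(2) [OF that] insert.hyps(2) unfolding approx_eigen_def by fastforce
  then show ?case using lam(1) r(1) by (intro exI [of _ "lam(k := r)"]) auto
qed

end

section \<open>Coefficient functions on the unit interval\<close>

text \<open>
  Coefficient patterns are added and scaled pointwise, so that the results on positive operators apply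
  to them as vectors.
\<close>

instantiation "fun" :: (type, real_vector) real_vector
begin

definition scaleR_fun :: "real \<Rightarrow> ('a \<Rightarrow> 'b) \<Rightarrow> 'a \<Rightarrow> 'b" where
  "scaleR_fun c f = (\<lambda>x. c *\<^sub>R f x)"

instance
  by standard (simp_all add: scaleR_fun_def fun_eq_iff scaleR_add_right scaleR_add_left)

end

lemma scaleR_fun_apply [simp]: "(c *\<^sub>R f) x = c *\<^sub>R f x"
  by (simp add: scaleR_fun_def)

text \<open>
  Since a spreading norm sees only the order of the coefficients, a pattern can be placed at any positions
  in \<open>[0, 1)\<close>.  Placing patterns of different lengths in the same interval makes it
  meaningful to compare \<open>m\<close> copies of a pattern with a multiple of the pattern itself.
\<close>

definition coeff_support :: "(real \<Rightarrow> real) \<Rightarrow> real set" where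
  "coeff_support c = {t. c t \<noteq> 0}"

definition coeff_space :: "(real \<Rightarrow> real) set" where
  "coeff_space = {c. finite (coeff_support c) \<and> coeff_support c \<subseteq> {0..<1}}"

definition coeff_list :: "(real \<Rightarrow> real) \<Rightarrow> real list" where
  "coeff_list c = map c (sorted_list_of_set (coeff_support c))"

text \<open>\<open>repeat m c\<close> puts \<open>m\<close> copies of \<open>c\<close>, shrunk by the factor \<open>m\<close>, next to each other.\<close>

definition repeat :: "nat \<Rightarrow> (real \<Rightarrow> real) \<Rightarrow> real \<Rightarrow> real" where
  "repeat m c = (\<lambda>t. if t \<in> {0..<1} then c (frac (real m * t)) else 0)"

lemma sorted_list_of_set_eqI: "sorted_wrt (<) xs \<Longrightarrow> set xs = A \<Longrightarrow> sorted_list_of_set A = xs"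
  for xs :: "real list"
  by (metis List.finite_set distinct_card sorted_list_of_set_unique strict_sorted_iff)

lemma strip_map_coeff:
  assumes F: "finite F" "coeff_support c \<subseteq> F"
  shows "strip (map c (sorted_list_of_set F)) = coeff_list c"
proof -
  have "sorted_list_of_set (coeff_support c) = filter (\<lambda>t. c t \<noteq> 0) (sorted_list_of_set F)"
    using F strict_sorted_list_of_set [of F]
    by (intro sorted_list_of_set_eqI sorted_wrt_filter) (auto simp: coeff_support_def)
  then show ?thesis by (simp add: strip_def coeff_list_def filter_map o_def)
qed

lemma frac_mult_frac: "frac (real m * frac x) = frac (real m * x)"
proof -
  have "real m * frac x = real m * x - of_int (int m * \<lfloor>x\<rfloor>)" by (simp add: frac_def algebra_simps)
  then show ?thesis by (simp only: frac_def floor_diff_of_int of_int_diff)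
qed

lemma repeat_commute: "repeat m (repeat n c) = repeat n (repeat m c)"
proof
  fix t :: real
  have "frac x \<in> {0..<1}" for x :: real by (simp add: frac_lt_1)
  then show "repeat m (repeat n c) t = repeat n (repeat m c) t"
    by (simp add: repeat_def frac_mult_frac mult.left_commute)
qed

lemma linear_repeat: "linear (repeat m)"
  by (rule linearI) (auto simp: repeat_def fun_eq_iff)

lemma coeff_support_repeat:
  assumes m: "1 \<le> m" and c: "coeff_support c \<subseteq> {0..<1}"
  shows "coeff_support (repeat m c) = (\<Union>j<m. (\<lambda>u. (u + real j) / real m) ` coeff_support c)"
proof (intro equalityI subsetI)
  fix t assume "t \<in> coeff_support (repeat m c)"
  then have t: "0 \<le> t" "t < 1" "frac (real m * t) \<in> coeff_support c"
    by (auto simp: coeff_support_def repeat_def split: if_splits)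
  define j where "j = nat \<lfloor>real m * t\<rfloor>"
  have "real m * t < real m" using m t by simp
  then have "j < m" using m t by (auto simp: j_def nat_less_iff floor_less_iff)
  moreover have "t = (frac (real m * t) + real j) / real m"
    using m t by (simp add: j_def frac_def field_simps)
  ultimately show "t \<in> (\<Union>j<m. (\<lambda>u. (u + real j) / real m) ` coeff_support c)" using t(3) by blast
next
  fix t assume "t \<in> (\<Union>j<m. (\<lambda>u. (u + real j) / real m) ` coeff_support c)"
  then obtain j u where j: "j < m" "u \<in> coeff_support c" "t = (u + real j) / real m" by blast
  have u: "0 \<le> u" "u < 1" using j(2) c by auto
  have "real j + 1 \<le> real m" using j(1) by linarith
  then have "0 \<le> t" "t < 1" using u m by (auto simp: j(3) field_simps)
  moreover have "frac (real m * t) = u"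
    using u m by (simp add: j(3) frac_unique_iff)
  ultimately show "t \<in> coeff_support (repeat m c)" using j(2) by (simp add: coeff_support_def repeat_def)
qed

text \<open>
  As a list, the repeated pattern is the concatenation of \<open>m\<close> copies: the copy with number \<open>j\<close> occupies
  \<open>[j / m, (j + 1) / m)\<close>, so the copies do not interleave.
\<close>

lemma coeff_list_repeat:
  assumes m: "1 \<le> m" and c: "c \<in> coeff_space"
  shows "coeff_list (repeat m c) = concat (replicate m (coeff_list c))"
proof -
  have fin: "finite (coeff_support c)" and sub: "coeff_support c \<subseteq> {0..<1}"
    using c by (auto simp: coeff_space_def)
  define L where "L = sorted_list_of_set (coeff_support c)"
  have L: "set L = coeff_support c" "sorted_wrt (<) L" using fin by (auto simp: L_def)
  define sh where "sh j = map (\<lambda>u. (u + real j) / real m) L" for j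
  have sh: "t < (real j + 1) / real m" "real j / real m \<le> t" if "t \<in> set (sh j)" for t j
    using that sub m by (auto simp: sh_def L(1) subset_iff divide_right_mono divide_strict_right_mono)
  have "sorted_wrt (<) (concat (map sh [0..<k]))" if "k \<le> m" for k
    using that
  proof (induction k)
    case (Suc k)
    have "sorted_wrt (<) (sh k)"
      using L(2) m by (auto simp: sh_def sorted_wrt_map divide_strict_right_mono elim!: sorted_wrt_mono_rel [rotated])
    moreover have "a < b" if a: "a \<in> set (concat (map sh [0..<k]))" and b: "b \<in> set (sh k)" for a b
    proof -
      obtain j where j: "j < k" "a \<in> set (sh j)" using a by auto
      have "a < (real j + 1) / real m" by (rule sh(1) [OF j(2)])
      also have "\<dots> \<le> real k / real m" using j(1) by (intro divide_right_mono) auto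
      also have "\<dots> \<le> b" by (rule sh(2) [OF b])
      finally show ?thesis .
    qed
    ultimately show ?case using Suc by (auto simp: sorted_wrt_append)
  qed simp
  then have "sorted_list_of_set (coeff_support (repeat m c)) = concat (map sh [0..<m])"
    by (intro sorted_list_of_set_eqI) (auto simp: coeff_support_repeat [OF m sub] sh_def L(1))
  moreover have "map (repeat m c) (sh j) = coeff_list c" if "j < m" for j
  proof -
    have "repeat m c ((u + real j) / real m) = c u" if u: "u \<in> set L" for u
    proof -
      have u1: "0 \<le> u" "u < 1" using u sub by (auto simp: L(1))
      have "real j + 1 \<le> real m" using \<open>j < m\<close> by linarith
      then have "(u + real j) / real m \<in> {0..<1}" using u1 m by (auto simp: field_simps)
      moreover have "frac (real m * ((u + real j) / real m)) = u"
        using u1 m by (simp add: frac_unique_iff)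
      ultimately show ?thesis by (simp add: repeat_def)
    qed
    then show ?thesis by (simp add: sh_def coeff_list_def L_def)
  qed
  then have "map (\<lambda>j. map (repeat m c) (sh j)) [0..<m] = replicate m (coeff_list c)"
    by (intro nth_equalityI) auto
  ultimately show ?thesis by (simp add: coeff_list_def [of "repeat m c"] map_concat o_def)
qed

lemma coeff_space_repeat: "1 \<le> m \<Longrightarrow> c \<in> coeff_space \<Longrightarrow> repeat m c \<in> coeff_space"
  by (auto simp: coeff_space_def coeff_support_repeat)

lemma map2_map: "map2 f (map g xs) (map h xs) = map (\<lambda>x. f (g x) (h x)) xs"
  by (induction xs) auto

lemma abs_mono:
  assumes \<nu>: "spreading \<nu>" and si: "sign_invariant \<nu>"
  shows "list_all2 (\<lambda>x y. \<bar>x\<bar> \<le> \<bar>y\<bar>) xs ys \<Longrightarrow> \<nu> (P @ xs @ Q) \<le> \<nu> (P @ ys @ Q)"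
proof (induction xs ys arbitrary: P rule: list_all2_induct)
  case (Cons x xs y ys)
  have one: "\<nu> (P @ x # (xs @ Q)) \<le> \<nu> (P @ y # (xs @ Q))"
  proof (cases "y = 0")
    case True
    with Cons.hyps(1) show ?thesis by simp
  next
    case False
    define t where "t = \<bar>x\<bar> / \<bar>y\<bar>"
    have t: "0 \<le> t" "t \<le> 1" using Cons.hyps(1) False by (auto simp: t_def)
    have "\<bar>x\<bar> = \<bar>t * y\<bar>" using False by (simp add: t_def abs_mult)
    then have "x = t * y \<or> x = - (t * y)" by (auto simp: abs_eq_iff)
    then have "\<nu> (P @ x # (xs @ Q)) = \<nu> (P @ (t * y) # (xs @ Q))"
      using si unfolding sign_invariant_def by metis
    also have "\<dots> \<le> \<nu> (P @ y # (xs @ Q))"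
      by (rule suppression_mono1 [OF \<nu> sign_invariant_imp_suppression [OF \<nu> si] t])
    finally show ?thesis .
  qed
  also have "\<dots> \<le> \<nu> ((P @ [y]) @ ys @ Q)" using Cons.IH [of "P @ [y]"] by simp
  finally show ?case by simp
qed simp

context
  fixes \<nu> :: "real list \<Rightarrow> real"
  assumes \<nu>: "spreading \<nu>" and si: "sign_invariant \<nu>" and one: "\<nu> [1] = 1"
begin

lemma coeff_norm_eq:
  assumes "finite F" "coeff_support c \<subseteq> F"
  shows "\<nu> (coeff_list c) = \<nu> (map c (sorted_list_of_set F))"
  using strip_map_coeff [OF assms] spreading_strip [OF \<nu>, of "map c (sorted_list_of_set F)"] by simp

lemma coeff_space_add: "c \<in> coeff_space \<Longrightarrow> d \<in> coeff_space \<Longrightarrow> c + d \<in> coeff_space"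
proof -
  assume *: "c \<in> coeff_space" "d \<in> coeff_space"
  have "coeff_support (c + d) \<subseteq> coeff_support c \<union> coeff_support d" by (auto simp: coeff_support_def)
  moreover have "finite (coeff_support c \<union> coeff_support d)" "coeff_support c \<union> coeff_support d \<subseteq> {0..<1}"
    using * by (auto simp: coeff_space_def)
  ultimately show ?thesis unfolding coeff_space_def by (blast intro: finite_subset)
qed

lemma coeff_space_scale: "c \<in> coeff_space \<Longrightarrow> a *\<^sub>R c \<in> coeff_space"
proof -
  assume *: "c \<in> coeff_space"
  have "coeff_support (a *\<^sub>R c) \<subseteq> coeff_support c" by (auto simp: coeff_support_def)
  with * show ?thesis unfolding coeff_space_def by (blast intro: finite_subset)
qed

lemma positive_operators_repeat:
  "positive_operators (\<lambda>c. \<nu> (coeff_list c)) coeff_space {c\<in>coeff_space. \<forall>t. 0 \<le> c t}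
     (\<lambda>m. repeat (Suc m)) (\<lambda>m. real (Suc m))"
proof (rule positive_operators.intro)
  let ?q = "\<lambda>c. \<nu> (coeff_list c)"
  have two: "\<exists>F. finite F \<and> coeff_support c \<subseteq> F \<and> coeff_support d \<subseteq> F \<and> coeff_support (c + d) \<subseteq> F"
    if "c \<in> coeff_space" "d \<in> coeff_space" for c d
    using that by (intro exI [of _ "coeff_support c \<union> coeff_support d"])
      (auto simp: coeff_space_def coeff_support_def)
  have sup: "suppression \<nu>" by (rule sign_invariant_imp_suppression [OF \<nu> si])
  show "subspace coeff_space"
    unfolding subspace_def using coeff_space_add coeff_space_scale
    by (auto simp: coeff_space_def coeff_support_def)
  show "?q (c + d) \<le> ?q c + ?q d" if cd: "c \<in> coeff_space" "d \<in> coeff_space" for c d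
  proof -
    obtain F where F: "finite F" "coeff_support c \<subseteq> F" "coeff_support d \<subseteq> F" "coeff_support (c + d) \<subseteq> F"
      using two [OF cd] by blast
    let ?L = "sorted_list_of_set F"
    have "map (c + d) ?L = map2 (+) (map c ?L) (map d ?L)" by (simp add: map2_map)
    then show ?thesis
      using spreading_triangle [OF \<nu>, of "map c ?L" "map d ?L"]
      by (simp add: coeff_norm_eq [OF F(1,2)] coeff_norm_eq [OF F(1,3)] coeff_norm_eq [OF F(1,4)])
  qed
  show "?q (a *\<^sub>R c) = \<bar>a\<bar> * ?q c" if c: "c \<in> coeff_space" for a c
  proof -
    let ?F = "coeff_support c"
    have F: "finite ?F" "coeff_support (a *\<^sub>R c) \<subseteq> ?F"
      using c by (auto simp: coeff_space_def coeff_support_def)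
    have "?q (a *\<^sub>R c) = \<nu> (map (a *\<^sub>R c) (sorted_list_of_set ?F))" by (rule coeff_norm_eq [OF F])
    also have "map (a *\<^sub>R c) (sorted_list_of_set ?F) = map ((*) a) (coeff_list c)"
      by (simp add: coeff_list_def)
    finally show ?thesis by (simp only: spreading_scale [OF \<nu>])
  qed
  show "?q c \<le> ?q (c + d)"
    if c: "c \<in> {c\<in>coeff_space. \<forall>t. 0 \<le> c t}" and d: "d \<in> {c\<in>coeff_space. \<forall>t. 0 \<le> c t}" for c d
  proof -
    obtain F where F: "finite F" "coeff_support c \<subseteq> F" "coeff_support (c + d) \<subseteq> F"
      using two [of c d] c d by blast
    let ?L = "sorted_list_of_set F"
    have "list_all2 (\<lambda>x y. \<bar>x\<bar> \<le> \<bar>y\<bar>) (map c ?L) (map (c + d) ?L)"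
      using c d by (auto simp: list.rel_map intro!: list.rel_refl)
    then have "\<nu> ([] @ map c ?L @ []) \<le> \<nu> ([] @ map (c + d) ?L @ [])" by (rule abs_mono [OF \<nu> si])
    then show ?thesis by (simp add: coeff_norm_eq [OF F(1,2)] coeff_norm_eq [OF F(1,3)])
  qed
  show "linear (repeat (Suc m))" for m by (rule linear_repeat)
  show "repeat (Suc m) c \<in> coeff_space" if "c \<in> coeff_space" for m c
    using that by (intro coeff_space_repeat) auto
  then show "repeat (Suc m) c \<in> {c\<in>coeff_space. \<forall>t. 0 \<le> c t}"
    if "c \<in> {c\<in>coeff_space. \<forall>t. 0 \<le> c t}" for m c
    using that by (auto simp: repeat_def)
  show "?q (repeat (Suc m) c) \<le> real (Suc m) * ?q c" if c: "c \<in> coeff_space" for m c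
  proof -
    have "\<nu> (concat (replicate k (coeff_list c))) \<le> real k * ?q c" for k
    proof (induction k)
      case (Suc k)
      have "\<nu> (coeff_list c @ concat (replicate k (coeff_list c)))
          \<le> ?q c + \<nu> (concat (replicate k (coeff_list c)))" by (rule spreading_append [OF \<nu>])
      with Suc show ?case by (simp add: algebra_simps)
    qed (simp add: spreading_Nil [OF \<nu>])
    from this [of "Suc m"] show ?thesis using coeff_list_repeat [of "Suc m" c] c by simp
  qed
  show "?q c \<le> ?q (repeat (Suc m) c)" if c: "c \<in> {c\<in>coeff_space. \<forall>t. 0 \<le> c t}" for m c
    using suppressionD [OF sup, of "coeff_list c" "[]" "concat (replicate m (coeff_list c))"]
      coeff_list_repeat [of "Suc m" c] c by simp
  show "repeat (Suc m) (repeat (Suc n) c) = repeat (Suc n) (repeat (Suc m) c)" for m n c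
    by (rule repeat_commute)
  show "\<exists>c\<in>{c\<in>coeff_space. \<forall>t. 0 \<le> c t}. 0 < ?q c"
  proof
    let ?c = "\<lambda>t::real. if t = 0 then 1 else 0 :: real"
    have s: "coeff_support ?c = {0}" by (auto simp: coeff_support_def)
    show "?c \<in> {c\<in>coeff_space. \<forall>t. 0 \<le> c t}" by (simp add: coeff_space_def s)
    show "0 < ?q ?c" by (simp add: coeff_list_def s one)
  qed
qed (auto simp: coeff_space_add coeff_space_scale)

text \<open>
  A joint approximate eigenvector \<open>c\<close> turns into a sequence of successive copies in which \<open>m\<close> neighbours
  may be replaced by a multiple of a single copy, wherever they occur.
\<close>

lemma ex_almost_eigen_block:
  assumes \<delta>: "0 < \<delta>"
  shows "\<exists>w lam a. 0 < a \<and> (\<forall>m. 0 \<le> lam m) \<and> a * \<nu> w = 1 \<and> (\<forall>m c P Q. 1 \<le> m \<and> m \<le> N \<longrightarrow>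
    \<bar>a * \<nu> (block w (P @ replicate m c @ Q)) - a * \<nu> (block w (P @ [lam m * c] @ Q))\<bar> \<le> \<delta> * \<bar>c\<bar>)"
proof -
  interpret positive_operators "\<lambda>c. \<nu> (coeff_list c)" coeff_space "{c\<in>coeff_space. \<forall>t. 0 \<le> c t}"
    "\<lambda>m. repeat (Suc m)" "\<lambda>m. real (Suc m)" by (rule positive_operators_repeat)
  obtain lam0 where lam0: "\<forall>i. 1 \<le> lam0 i"
    "\<forall>\<epsilon>>0. \<exists>x\<in>{c\<in>coeff_space. \<forall>t. 0 \<le> c t}. 0 < \<nu> (coeff_list x) \<and>
      (\<forall>i\<in>{..N}. \<nu> (coeff_list (repeat (Suc i) x - lam0 i *\<^sub>R x)) \<le> \<epsilon> * \<nu> (coeff_list x))"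
    using ex_joint_approx_eigen [OF finite_atMost [of N]] by blast
  from lam0(2) [rule_format, OF \<delta>] obtain x where x: "x \<in> coeff_space" "0 < \<nu> (coeff_list x)"
    "\<And>i. i \<le> N \<Longrightarrow> \<nu> (coeff_list (repeat (Suc i) x - lam0 i *\<^sub>R x)) \<le> \<delta> * \<nu> (coeff_list x)" by auto
  define w a lam where "w = coeff_list x" and "a = 1 / \<nu> w" and "lam m = lam0 (m - 1)" for m
  have a: "0 < a" "a * \<nu> w = 1" using x(2) by (auto simp: a_def w_def)
  have "\<bar>a * \<nu> (block w (P @ replicate m c @ Q)) - a * \<nu> (block w (P @ [lam m * c] @ Q))\<bar> \<le> \<delta> * \<bar>c\<bar>"
    if m: "1 \<le> m" "m \<le> N" for m c P Q
  proof -
    let ?R = "repeat m x" and ?p = "block w P" and ?q = "block w Q"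
    define F where "F = coeff_support x \<union> coeff_support ?R"
    have RW: "?R \<in> coeff_space" by (rule coeff_space_repeat [OF m(1) x(1)])
    have F: "finite F" "coeff_support x \<subseteq> F" "coeff_support ?R \<subseteq> F"
      "coeff_support (?R - lam m *\<^sub>R x) \<subseteq> F"
      using x(1) RW by (auto simp: F_def coeff_space_def coeff_support_def)
    let ?L = "sorted_list_of_set F"
    have sc: "strip (map (\<lambda>t. b * f t) ?L) = strip (map ((*) b) (coeff_list f))" if "coeff_support f \<subseteq> F" for b f
    proof -
      have "map (\<lambda>t. b * f t) ?L = map ((*) b) (map f ?L)" by simp
      then show ?thesis
        by (simp only: strip_scale strip_map_coeff [OF F(1) that])
           (simp add: strip_map_coeff [OF F(1) that, symmetric] del: map_map)
    qed
    have rep: "map ((*) c) (concat (replicate n w)) = block w (replicate n c)" for n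
      by (induction n) auto
    have "block w (P @ replicate m c @ Q) = ?p @ block w (replicate m c) @ ?q" by simp
    also have "\<nu> \<dots> = \<nu> (?p @ map (\<lambda>t. c * ?R t) ?L @ ?q)"
      by (rule spreading_strip_eq [OF \<nu>])
         (simp add: sc [OF F(3)] coeff_list_repeat [OF m(1) x(1)] w_def [symmetric] rep)
    finally have 1: "\<nu> (block w (P @ replicate m c @ Q)) = \<nu> (?p @ map (\<lambda>t. c * ?R t) ?L @ ?q)" .
    have "block w (P @ [lam m * c] @ Q) = ?p @ map ((*) (lam m * c)) w @ ?q" by simp
    also have "\<nu> \<dots> = \<nu> (?p @ map (\<lambda>t. (lam m * c) * x t) ?L @ ?q)"
      by (rule spreading_strip_eq [OF \<nu>]) (simp add: sc [OF F(2)] w_def [symmetric])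
    finally have 2: "\<nu> (block w (P @ [lam m * c] @ Q)) = \<nu> (?p @ map (\<lambda>t. (lam m * c) * x t) ?L @ ?q)" .
    have "\<bar>\<nu> (block w (P @ replicate m c @ Q)) - \<nu> (block w (P @ [lam m * c] @ Q))\<bar>
        \<le> \<nu> (map2 (-) (map (\<lambda>t. c * ?R t) ?L) (map (\<lambda>t. (lam m * c) * x t) ?L))"
      unfolding 1 2 by (rule spreading_context [OF \<nu>]) simp
    also have "map2 (-) (map (\<lambda>t. c * ?R t) ?L) (map (\<lambda>t. (lam m * c) * x t) ?L)
        = map ((*) c) (map (?R - lam m *\<^sub>R x) ?L)" by (simp add: map2_map algebra_simps)
    also have "\<nu> \<dots> = \<bar>c\<bar> * \<nu> (coeff_list (?R - lam m *\<^sub>R x))"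
      by (simp only: spreading_scale [OF \<nu>] coeff_norm_eq [OF F(1,4)])
    also have "\<dots> \<le> \<bar>c\<bar> * (\<delta> * \<nu> w)"
    proof (rule mult_left_mono)
      have "Suc (m - 1) = m" using m by simp
      then show "\<nu> (coeff_list (?R - lam m *\<^sub>R x)) \<le> \<delta> * \<nu> w"
        using x(3) [of "m - 1"] m by (simp add: lam_def w_def)
    qed simp
    finally have "a * \<bar>\<nu> (block w (P @ replicate m c @ Q)) - \<nu> (block w (P @ [lam m * c] @ Q))\<bar>
        \<le> a * (\<bar>c\<bar> * (\<delta> * \<nu> w))" using a(1) by (intro mult_left_mono) auto
    also have "\<dots> = \<delta> * \<bar>c\<bar>" using a(2) by (simp add: algebra_simps)
    also have "a * \<bar>\<nu> (block w (P @ replicate m c @ Q)) - \<nu> (block w (P @ [lam m * c] @ Q))\<bar>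
        = \<bar>a * \<nu> (block w (P @ replicate m c @ Q)) - a * \<nu> (block w (P @ [lam m * c] @ Q))\<bar>"
      using a(1) by (simp add: abs_mult flip: right_diff_distrib)
    finally show ?thesis .
  qed
  moreover have "0 \<le> lam m" for m using lam0(1) by (auto simp: lam_def intro: order_trans [OF zero_le_one])
  ultimately show ?thesis using a by blast
qed

lemma sign_invariant_block: "sign_invariant (\<lambda>cs. \<nu> (block w cs))"
  unfolding sign_invariant_def
proof (intro allI)
  fix P c Q
  have "list_all2 (\<lambda>x y. \<bar>x\<bar> \<le> \<bar>y\<bar>) (map ((*) (- c)) w) (map ((*) c) w)"
    "list_all2 (\<lambda>x y. \<bar>x\<bar> \<le> \<bar>y\<bar>) (map ((*) c) w) (map ((*) (- c)) w)"
    by (auto simp: list.rel_map intro!: list.rel_refl)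
  then have "\<nu> (block w P @ map ((*) (- c)) w @ block w Q) = \<nu> (block w P @ map ((*) c) w @ block w Q)"
    by (intro antisym abs_mono [OF \<nu> si])
  then show "\<nu> (block w (P @ (- c) # Q)) = \<nu> (block w (P @ c # Q))" by simp
qed

end

section \<open>A symmetric norm\<close>

text \<open>
  Along the blocks for \<open>1, \<dots>, j\<close> repetitions with error \<open>1 / (j + 1)\<close>, the approximate eigenvalues for \<open>m\<close>
  repetitions converge to the norm of \<open>m\<close> ones, and in the limit the replacement rule is exact.
\<close>

lemma ex_exact_replacement:
  fixes M :: "'a::real_normed_vector set"
  assumes M: "subspace M" and inf: "infinite_dimensional M"
  shows "\<exists>\<nu>. spreading \<nu> \<and> fin_rep M \<nu> \<and> sign_invariant \<nu> \<and> \<nu> [1] = 1 \<and>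
    (\<forall>m\<ge>1. \<forall>c P Q. \<nu> (P @ replicate m c @ Q) = \<nu> (P @ [\<nu> (replicate m 1) * c] @ Q))"
proof -
  obtain \<nu>0 where \<nu>0: "spreading \<nu>0" and fr0: "fin_rep M \<nu>0" and si0: "sign_invariant \<nu>0"
    and one0: "\<nu>0 [1] = 1" using ex_sign_invariant [OF M inf] by blast
  have "\<forall>j. \<exists>w lam a. 0 < a \<and> (\<forall>m. 0 \<le> lam m) \<and> a * \<nu>0 w = 1 \<and> (\<forall>m c P Q. 1 \<le> m \<and> m \<le> j \<longrightarrow>
    \<bar>a * \<nu>0 (block w (P @ replicate m c @ Q)) - a * \<nu>0 (block w (P @ [lam m * c] @ Q))\<bar>
      \<le> 1 / (real j + 1) * \<bar>c\<bar>)"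
    by (intro allI ex_almost_eigen_block [OF \<nu>0 si0 one0]) simp
  then obtain w lam a where a: "\<And>j. 0 < a j" "\<And>j. a j * \<nu>0 (w j) = 1" and lam: "\<And>j m. (0::real) \<le> lam j m"
    and appr: "\<And>j m c P Q. 1 \<le> m \<Longrightarrow> m \<le> j \<Longrightarrow>
      \<bar>a j * \<nu>0 (block (w j) (P @ replicate m c @ Q)) - a j * \<nu>0 (block (w j) (P @ [lam j m * c] @ Q))\<bar>
      \<le> 1 / (real j + 1) * \<bar>c\<bar>"
    by metis
  define \<mu> where "\<mu> j cs = a j * \<nu>0 (block (w j) cs)" for j cs
  have sp: "spreading (\<mu> j)" for j
    unfolding \<mu>_def using a(1) [of j] by (intro spreading_cmult spreading_block \<nu>0) simp
  have frm: "fin_rep M (\<mu> j)" for j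
    unfolding \<mu>_def by (intro fin_rep_cmult [OF M] fin_rep_block [OF M] fr0 a)
  have si: "sign_invariant (\<mu> j)" for j
    using sign_invariant_block [OF \<nu>0 si0 one0, of "w j"] by (simp add: sign_invariant_def \<mu>_def)
  have one: "\<mu> j [1] = 1" for j
    using a(2) [of j] by (simp add: \<mu>_def map_idI)
  define \<nu> where "\<nu> cs = ulim (\<lambda>j. \<mu> j cs)" for cs
  have lim: "((\<lambda>j. \<mu> j cs) \<longlongrightarrow> \<nu> cs) free_ultrafilter" for cs
    unfolding \<nu>_def by (rule spreading_tendsto [of \<mu> 1, OF sp]) (simp add: one)
  have zero: "((\<lambda>j. 1 / (real j + 1) * C) \<longlongrightarrow> 0) free_ultrafilter" for C
  proof -
    have "((\<lambda>j. 1 / (real j + 1)) \<longlongrightarrow> 0) free_ultrafilter"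
      using LIMSEQ_inverse_real_of_nat by (intro tendsto_ultra) (simp add: inverse_eq_divide add.commute)
    then show ?thesis by (rule tendsto_mult_left_zero)
  qed
  have ev: "\<forall>\<^sub>F j in free_ultrafilter. m \<le> j" for m
    using eventually_ge_at_top [of m] by (rule sequentially_imp_ultra)
  have lam_lim: "((\<lambda>j. lam j m) \<longlongrightarrow> \<nu> (replicate m 1)) free_ultrafilter" if m: "1 \<le> m" for m
  proof -
    have "((\<lambda>j. \<mu> j (replicate m 1) - lam j m) \<longlongrightarrow> 0) free_ultrafilter"
    proof (rule Lim_null_comparison [OF _ zero [of 1]], rule eventually_mono [OF ev [of m]])
      fix j assume "m \<le> j"
      then have "\<bar>\<mu> j ([] @ replicate m 1 @ []) - \<mu> j ([] @ [lam j m * 1] @ [])\<bar> \<le> 1 / (real j + 1) * \<bar>1\<bar>"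
        unfolding \<mu>_def by (rule appr [OF m])
      moreover have "\<mu> j [lam j m] = lam j m"
        using spreading_single [OF sp, of j "lam j m"] lam [of j m] one by simp
      ultimately show "norm (\<mu> j (replicate m 1) - lam j m) \<le> 1 / (real j + 1) * 1" by simp
    qed
    from tendsto_diff [OF lim [of "replicate m 1"] this] show ?thesis by simp
  qed
  have "\<nu> (P @ replicate m c @ Q) = \<nu> (P @ [\<nu> (replicate m 1) * c] @ Q)" if m: "1 \<le> m" for m c P Q
  proof -
    let ?m = "\<nu> (replicate m 1)"
    have "((\<lambda>j. \<mu> j (P @ replicate m c @ Q) - \<mu> j (P @ [?m * c] @ Q)) \<longlongrightarrow> 0) free_ultrafilter"
    proof (rule Lim_null_comparison)
      show "\<forall>\<^sub>F j in free_ultrafilter. norm (\<mu> j (P @ replicate m c @ Q) - \<mu> j (P @ [?m * c] @ Q))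
        \<le> 1 / (real j + 1) * \<bar>c\<bar> + \<bar>lam j m - ?m\<bar> * \<bar>c\<bar>"
      proof (rule eventually_mono [OF ev [of m]])
        fix j assume "m \<le> j"
        then have "\<bar>\<mu> j (P @ replicate m c @ Q) - \<mu> j (P @ [lam j m * c] @ Q)\<bar> \<le> 1 / (real j + 1) * \<bar>c\<bar>"
          unfolding \<mu>_def by (rule appr [OF m])
        moreover have "\<bar>\<mu> j (P @ [lam j m * c] @ Q) - \<mu> j (P @ [?m * c] @ Q)\<bar> \<le> \<bar>lam j m - ?m\<bar> * \<bar>c\<bar>"
          using spreading_change [OF sp, of j P "lam j m * c" Q "?m * c"]
          by (simp add: one abs_mult flip: left_diff_distrib)
        ultimately show "norm (\<mu> j (P @ replicate m c @ Q) - \<mu> j (P @ [?m * c] @ Q))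
          \<le> 1 / (real j + 1) * \<bar>c\<bar> + \<bar>lam j m - ?m\<bar> * \<bar>c\<bar>" unfolding real_norm_def by linarith
      qed
      have "((\<lambda>j. \<bar>lam j m - ?m\<bar> * \<bar>c\<bar>) \<longlongrightarrow> 0) free_ultrafilter"
        using lam_lim [OF m] by (intro tendsto_mult_left_zero tendsto_rabs_zero) (simp add: LIM_zero)
      from tendsto_add [OF zero [of "\<bar>c\<bar>"] this]
      show "((\<lambda>j. 1 / (real j + 1) * \<bar>c\<bar> + \<bar>lam j m - ?m\<bar> * \<bar>c\<bar>) \<longlongrightarrow> 0) free_ultrafilter" by simp
    qed
    from tendsto_unique [OF free_ultrafilter_nontrivial this tendsto_diff [OF lim lim]] show ?thesis by simp
  qed
  moreover have "spreading \<nu>" unfolding \<nu>_def by (rule spreading_ulim [of \<mu> 1, OF sp]) (simp add: one)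
  moreover have "fin_rep M \<nu>" by (rule fin_rep_limit [OF frm lim])
  moreover have "sign_invariant \<nu>" using si by (simp add: sign_invariant_def \<nu>_def)
  moreover have "\<nu> [1] = 1" using one by (simp add: \<nu>_def)
  ultimately show ?thesis by blast
qed

text \<open>
  Writing \<open>\<mu> n\<close> for the norm of \<open>n\<close> ones, a list with entries \<open>\<mu> n\<^sub>i\<close> has norm \<open>\<mu> (\<Sum>i. n\<^sub>i)\<close>,
  whatever the order of its entries.  If \<open>\<mu>\<close> is unbounded, every list is, after scaling it up,
  at bounded distance from such a list.  If \<open>\<mu>\<close> is bounded, then \<open>\<mu> n = 1\<close> for \<open>n \<ge> 1\<close> by
  multiplicativity, and the norm is the supremum norm.
\<close>

lemma symmetric_if_replacement:
  assumes \<nu>: "spreading \<nu>" and si: "sign_invariant \<nu>" and one: "\<nu> [1] = 1"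
    and repl: "\<And>m c P Q. 1 \<le> m \<Longrightarrow> \<nu> (P @ replicate m c @ Q) = \<nu> (P @ [\<nu> (replicate m 1) * c] @ Q)"
    and perm: "mset xs = mset ys"
  shows "\<nu> xs = \<nu> ys"
proof -
  define \<mu> where "\<mu> n = \<nu> (replicate n 1)" for n
  have sup: "suppression \<nu>" by (rule sign_invariant_imp_suppression [OF \<nu> si])
  have am: "\<nu> us \<le> \<nu> vs" if "list_all2 (\<lambda>x y. \<bar>x\<bar> \<le> \<bar>y\<bar>) us vs" for us vs
    using abs_mono [OF \<nu> si that, of "[]" "[]"] by simp
  have \<mu>0: "\<mu> 0 = 0" by (simp add: \<mu>_def spreading_Nil [OF \<nu>])
  have \<mu>_mono: "\<mu> m \<le> \<mu> n" if "m \<le> n" for m n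
    using suppressionD [OF sup, of "replicate m 1" "[]" "replicate (n - m) 1"] that
    by (simp add: \<mu>_def flip: replicate_add)
  have \<mu>_Suc: "\<mu> (Suc n) \<le> \<mu> n + 1" for n
    using spreading_append [OF \<nu>, of "[1]" "replicate n 1"] one by (simp add: \<mu>_def)
  have \<mu>_nonneg: "0 \<le> \<mu> n" for n unfolding \<mu>_def by (rule spreading_nonneg [OF \<nu>])
  have \<mu>_list: "\<nu> (P @ map \<mu> ns) = \<nu> (P @ replicate (sum_list ns) 1)" for ns P
  proof (induction ns arbitrary: P)
    case (Cons n ns)
    have "\<nu> (P @ [\<mu> n] @ map \<mu> ns) = \<nu> (P @ replicate n 1 @ map \<mu> ns)"
    proof (cases "n = 0")
      case True
      then show ?thesis by (intro spreading_strip_eq [OF \<nu>]) (simp add: \<mu>0)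
    next
      case False
      then show ?thesis using repl [of n P 1 "map \<mu> ns"] by (simp add: \<mu>_def)
    qed
    also have "\<dots> = \<nu> ((P @ replicate n 1) @ replicate (sum_list ns) 1)"
      using Cons.IH [of "P @ replicate n 1"] by simp
    finally show ?case by (simp add: replicate_add)
  qed simp
  show ?thesis
  proof (cases "\<exists>b. \<forall>n. \<mu> n \<le> b")
    case True
    then obtain b where b: "\<And>n. \<mu> n \<le> b" by blast
    have mult: "\<mu> (k * m) = \<mu> k * \<mu> m" if "1 \<le> m" for k m
    proof -
      have "\<nu> (P @ replicate (k * m) 1) = \<nu> (P @ replicate k (\<mu> m))" for P
      proof (induction k arbitrary: P)
        case (Suc k)
        have "\<nu> (P @ replicate (Suc k * m) 1) = \<nu> (P @ replicate m 1 @ replicate (k * m) 1)"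
          by (simp add: replicate_add)
        also have "\<dots> = \<nu> ((P @ [\<mu> m]) @ replicate (k * m) 1)"
          using repl [OF that, of P 1] by (simp add: \<mu>_def)
        also have "\<dots> = \<nu> ((P @ [\<mu> m]) @ replicate k (\<mu> m))" by (rule Suc.IH)
        finally show ?case by simp
      qed simp
      from this [of "[]"] have "\<mu> (k * m) = \<nu> (map ((*) (\<mu> m)) (replicate k 1))" by (simp add: \<mu>_def)
      then show ?thesis using \<mu>_nonneg [of m] by (simp add: spreading_scale [OF \<nu>] \<mu>_def del: map_replicate)
    qed
    have le1: "\<mu> m \<le> 1" if m: "1 \<le> m" for m
    proof (rule ccontr)
      assume "\<not> \<mu> m \<le> 1"
      then obtain k where "b < \<mu> m ^ k" using real_arch_pow by (meson not_le)
      moreover have "\<mu> (m ^ k) = \<mu> m ^ k"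
      proof (induction k)
        case 0
        then show ?case using one by (simp add: \<mu>_def)
      next
        case (Suc k)
        then show ?case using mult [OF m, of "m ^ k"] by (simp add: mult.commute)
      qed
      ultimately show False using b [of "m ^ k"] by simp
    qed
    have "\<nu> zs = max_abs zs" for zs
    proof (rule antisym)
      have "\<nu> zs \<le> \<nu> (map ((*) (max_abs zs)) (replicate (length zs) 1))"
      proof (rule am)
        show "list_all2 (\<lambda>x y. \<bar>x\<bar> \<le> \<bar>y\<bar>) zs (map ((*) (max_abs zs)) (replicate (length zs) 1))"
          using abs_le_max_abs [of _ zs] max_abs_nonneg [of zs] by (auto simp: list_all2_conv_all_nth)
      qed
      also have "\<dots> = max_abs zs * \<mu> (length zs)"
        using max_abs_nonneg [of zs] by (simp only: spreading_scale [OF \<nu>] \<mu>_def)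
      also have "\<dots> \<le> max_abs zs * 1"
        using le1 [of "length zs"] \<mu>0 by (intro mult_left_mono max_abs_nonneg) (cases "length zs", auto)
      finally show "\<nu> zs \<le> max_abs zs" by simp
      show "max_abs zs \<le> \<nu> zs"
        using max_abs_cases [of zs]
      proof
        assume "max_abs zs = 0"
        then show ?thesis using spreading_nonneg [OF \<nu>] by simp
      next
        assume "\<exists>x\<in>set zs. max_abs zs = \<bar>x\<bar>"
        then obtain us c vs where c: "max_abs zs = \<bar>c\<bar>" "zs = us @ c # vs" by (meson split_list)
        have "\<nu> ([] @ [c]) \<le> \<nu> ([] @ us @ [c])" by (rule suppressionD [OF sup])
        also have "\<dots> \<le> \<nu> ((us @ [c]) @ vs @ [])"
          using suppressionD [OF sup, of "us @ [c]" "[]" vs] by simp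
        finally show ?thesis using spreading_single [OF \<nu>, of c] one c by simp
      qed
    qed
    moreover have "max_abs xs = max_abs ys"
    proof -
      have "set xs = set ys" using perm by (rule mset_eq_setD)
      moreover have "max_abs us \<le> max_abs vs" if "set us \<subseteq> set vs" for us vs
        using max_abs_cases [of us] that abs_le_max_abs [of _ vs] max_abs_nonneg [of vs] by auto
      ultimately show ?thesis by (intro antisym) auto
    qed
    ultimately show ?thesis by simp
  next
    case False
    then have ex: "\<exists>n. y < \<mu> n" for y by (meson not_le)
    define N where "N y = (LEAST n. y < \<mu> (Suc n))" for y
    have N: "\<mu> (N y) \<le> y" "y \<le> \<mu> (N y) + 1" if "0 \<le> y" for y
    proof -
      obtain n where "y < \<mu> n" using ex by blast
      then have "y < \<mu> (Suc n)" using \<mu>_mono [of n "Suc n"] by simp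
      then have l: "y < \<mu> (Suc (N y))" unfolding N_def by (rule LeastI)
      then show "y \<le> \<mu> (N y) + 1" using \<mu>_Suc [of "N y"] by simp
      show "\<mu> (N y) \<le> y"
      proof (cases "N y")
        case 0
        then show ?thesis using that by (simp add: \<mu>0)
      next
        case (Suc k)
        then have "\<not> y < \<mu> (Suc k)" using not_less_Least [of k "\<lambda>n. y < \<mu> (Suc n)"] by (simp add: N_def)
        then show ?thesis using Suc by simp
      qed
    qed
    have close: "\<bar>t * \<nu> zs - \<mu> (\<Sum>x\<leftarrow>zs. N (t * \<bar>x\<bar>))\<bar> \<le> real (length zs)" if t: "0 \<le> t" for t zs
    proof -
      let ?a = "map (\<lambda>x. t * \<bar>x\<bar>) zs" and ?b = "map \<mu> (map (\<lambda>x. N (t * \<bar>x\<bar>)) zs)"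
      have "\<nu> (map abs zs) = \<nu> zs"
        by (intro antisym am) (auto simp: list.rel_map intro!: list.rel_refl)
      then have "\<nu> ?a = t * \<nu> zs"
        using spreading_scale [OF \<nu>, of t "map abs zs"] t by (simp add: o_def)
      moreover have "\<nu> ?b = \<mu> (\<Sum>x\<leftarrow>zs. N (t * \<bar>x\<bar>))" using \<mu>_list [of "[]" "map (\<lambda>x. N (t * \<bar>x\<bar>)) zs"] by (simp only: append_Nil \<mu>_def [of "\<Sum>x\<leftarrow>zs. N (t * \<bar>x\<bar>)"])
      moreover have "\<bar>\<nu> ([] @ ?a @ []) - \<nu> ([] @ ?b @ [])\<bar> \<le> \<nu> (map2 (-) ?a ?b)"
        by (rule spreading_context [OF \<nu>]) simp
      moreover have "\<bar>t * \<bar>x\<bar> - \<mu> (N (t * \<bar>x\<bar>))\<bar> \<le> 1" for x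
        using N [of "t * \<bar>x\<bar>"] t by (simp add: abs_le_iff)
      then have "\<nu> (map2 (-) ?a ?b) \<le> \<nu> (replicate (length zs) 1)"
        by (intro am) (auto simp: list_all2_conv_all_nth)
      moreover have "\<nu> (replicate (length zs) 1) \<le> real (length zs)"
        using spreading_le_sum [OF \<nu>, of "replicate (length zs) 1"] one by (simp add: sum_list_replicate)
      ultimately show ?thesis by simp
    qed
    have "mset (map (\<lambda>x. N (t * \<bar>x\<bar>)) xs) = mset (map (\<lambda>x. N (t * \<bar>x\<bar>)) ys)" for t
      using perm by simp
    then have "\<Sum>\<^sub># (mset (map (\<lambda>x. N (t * \<bar>x\<bar>)) xs)) = \<Sum>\<^sub># (mset (map (\<lambda>x. N (t * \<bar>x\<bar>)) ys))" for t
      by (simp only:)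
    then have sums: "(\<Sum>x\<leftarrow>xs. N (t * \<bar>x\<bar>)) = (\<Sum>x\<leftarrow>ys. N (t * \<bar>x\<bar>))" for t
      by (simp only: sum_mset_sum_list)
    have len: "length xs = length ys" using perm by (rule mset_eq_length)
    show ?thesis
    proof (rule ccontr)
      assume "\<nu> xs \<noteq> \<nu> ys"
      then have d: "0 < \<bar>\<nu> xs - \<nu> ys\<bar>" by simp
      then obtain t :: nat where t: "2 * real (length xs) < real t * \<bar>\<nu> xs - \<nu> ys\<bar>"
        using reals_Archimedean3 by blast
      have "real t * \<bar>\<nu> xs - \<nu> ys\<bar> = \<bar>real t * \<nu> xs - real t * \<nu> ys\<bar>"
        by (simp add: abs_mult flip: right_diff_distrib)
      also have "\<dots> \<le> 2 * real (length xs)"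
        using close [of "real t" xs] close [of "real t" ys] sums [of "real t"] len by simp
      finally show False using t by simp
    qed
  qed
qed

theorem ex_symmetric_norm:
  fixes M :: "'a::real_normed_vector set"
  assumes M: "subspace M" and inf: "infinite_dimensional M"
  shows "\<exists>\<nu>. spreading \<nu> \<and> fin_rep M \<nu> \<and> \<nu> [1] = 1 \<and> (\<forall>xs ys. mset xs = mset ys \<longrightarrow> \<nu> xs = \<nu> ys) \<and>
    (\<forall>xs ys. list_all2 (\<lambda>x y. \<bar>x\<bar> \<le> \<bar>y\<bar>) xs ys \<longrightarrow> \<nu> xs \<le> \<nu> ys)"
proof -
  obtain \<nu> where \<nu>: "spreading \<nu>" and fr: "fin_rep M \<nu>" and si: "sign_invariant \<nu>" and one: "\<nu> [1] = 1"
    and repl: "\<forall>m\<ge>1. \<forall>c P Q. \<nu> (P @ replicate m c @ Q) = \<nu> (P @ [\<nu> (replicate m 1) * c] @ Q)"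
    using ex_exact_replacement [OF M inf] by blast
  have "\<nu> xs = \<nu> ys" if "mset xs = mset ys" for xs ys
    by (rule symmetric_if_replacement [OF \<nu> si one repl [rule_format] that])
  moreover have "\<nu> xs \<le> \<nu> ys" if "list_all2 (\<lambda>x y. \<bar>x\<bar> \<le> \<bar>y\<bar>) xs ys" for xs ys
    using abs_mono [OF \<nu> si that, of "[]" "[]"] by simp
  ultimately show ?thesis using \<nu> fr one by blast
qed

section \<open>Bijections of the integer lattice that approximate rotations\<close>

abbreviation lnorm :: "nat \<Rightarrow> (nat \<Rightarrow> int) \<Rightarrow> real" where
  "lnorm n z \<equiv> L2_set (\<lambda>k. real_of_int (z k)) {..<n}"

definition shear :: "nat \<Rightarrow> nat \<Rightarrow> real \<Rightarrow> (nat \<Rightarrow> int) \<Rightarrow> nat \<Rightarrow> int" where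
  "shear i j s z = z(i := z i + \<lfloor>s * real_of_int (z j)\<rfloor>)"

lemma bij_shear:
  assumes "i \<noteq> j" shows "bij (shear i j s)"
proof (rule o_bij)
  show "(\<lambda>z. z(i := z i - \<lfloor>s * real_of_int (z j)\<rfloor>)) \<circ> shear i j s = id"
    "shear i j s \<circ> (\<lambda>z. z(i := z i - \<lfloor>s * real_of_int (z j)\<rfloor>)) = id"
    using assms by (auto simp: shear_def fun_eq_iff)
qed

text \<open>
  A rotation by at most a right angle is a product of three shears with slopes in \<open>[-1, 1]\<close>.
  Rounding a shear to integers keeps it bijective and moves points by less than 1.
\<close>

lemma ex_lattice_rotation_acute:
  fixes \<alpha> \<beta> :: real and i j :: nat
  assumes ij: "i \<noteq> j" and unit: "\<alpha>\<^sup>2 + \<beta>\<^sup>2 = 1" and \<alpha>: "0 \<le> \<alpha>"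
  shows "\<exists>\<phi>. bij \<phi> \<and> (\<forall>z k. k \<noteq> i \<and> k \<noteq> j \<longrightarrow> \<phi> z k = z k) \<and>
    (\<forall>z. \<bar>real_of_int (\<phi> z i) - (\<alpha> * z i + \<beta> * z j)\<bar> \<le> 4 \<and>
         \<bar>real_of_int (\<phi> z j) - (\<alpha> * z j - \<beta> * z i)\<bar> \<le> 4)"
proof -
  define s where "s = \<beta> / (1 + \<alpha>)"
  have b1: "\<bar>\<beta>\<bar> \<le> 1"
  proof -
    have "\<beta>\<^sup>2 \<le> 1" using unit zero_le_power2 [of \<alpha>] by linarith
    then show ?thesis by (simp add: abs_square_le_1)
  qed
  have s1: "\<bar>s\<bar> \<le> 1" using b1 \<alpha> by (simp add: s_def)
  have sb: "s * \<beta> = 1 - \<alpha>"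
  proof -
    have "\<beta> * \<beta> = (1 - \<alpha>) * (1 + \<alpha>)" using unit by (simp add: power2_eq_square algebra_simps)
    then show ?thesis using \<alpha> by (simp add: s_def)
  qed
  have sa: "s * (1 + \<alpha>) = \<beta>" using \<alpha> by (simp add: s_def)
  define \<phi> where "\<phi> = shear i j s \<circ> shear j i (- \<beta>) \<circ> shear i j s"
  have "bij \<phi>" unfolding \<phi>_def using ij by (intro bij_comp bij_shear) auto
  moreover have "\<phi> z k = z k" if "k \<noteq> i" "k \<noteq> j" for z k using that by (simp add: \<phi>_def shear_def)
  moreover have "\<bar>real_of_int (\<phi> z i) - (\<alpha> * z i + \<beta> * z j)\<bar> \<le> 4 \<and>
      \<bar>real_of_int (\<phi> z j) - (\<alpha> * z j - \<beta> * z i)\<bar> \<le> 4" for z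
  proof -
    define x y where "x = real_of_int (z i)" and "y = real_of_int (z j)"
    define x1 where "x1 = x + of_int \<lfloor>s * y\<rfloor>"
    define y1 where "y1 = y + of_int \<lfloor>- \<beta> * x1\<rfloor>"
    define x2 where "x2 = x1 + of_int \<lfloor>s * y1\<rfloor>"
    have \<phi>: "real_of_int (\<phi> z i) = x2" "real_of_int (\<phi> z j) = y1"
      using ij by (auto simp: \<phi>_def shear_def x_def y_def x1_def y1_def x2_def)
    have fl: "\<bar>of_int \<lfloor>u\<rfloor> - u\<bar> \<le> 1" for u :: real by linarith
    have e1: "\<bar>x1 - (x + s * y)\<bar> \<le> 1" using fl [of "s * y"] by (simp add: x1_def)
    have "\<bar>y1 - (y - \<beta> * x1)\<bar> \<le> 1" using fl [of "- \<beta> * x1"] by (simp add: y1_def)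
    moreover have "\<bar>\<beta> * x1 - \<beta> * (x + s * y)\<bar> \<le> 1"
    proof -
      have "\<bar>\<beta>\<bar> * \<bar>x1 - (x + s * y)\<bar> \<le> 1 * 1" using b1 e1 by (intro mult_mono) auto
      then show ?thesis by (simp add: abs_mult flip: right_diff_distrib)
    qed
    moreover have "y - \<beta> * (x + s * y) = \<alpha> * y - \<beta> * x"
    proof -
      have "y - \<beta> * (x + s * y) = (1 - s * \<beta>) * y - \<beta> * x" by (simp add: algebra_simps)
      then show ?thesis by (simp add: sb)
    qed
    ultimately have e2: "\<bar>y1 - (\<alpha> * y - \<beta> * x)\<bar> \<le> 2" by linarith
    have "\<bar>x2 - (x1 + s * y1)\<bar> \<le> 1" using fl [of "s * y1"] by (simp add: x2_def)
    moreover have "\<bar>s * y1 - s * (\<alpha> * y - \<beta> * x)\<bar> \<le> 2"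
    proof -
      have "\<bar>s\<bar> * \<bar>y1 - (\<alpha> * y - \<beta> * x)\<bar> \<le> 1 * 2" using s1 e2 by (intro mult_mono) auto
      then show ?thesis by (simp add: abs_mult flip: right_diff_distrib)
    qed
    moreover have "(x + s * y) + s * (\<alpha> * y - \<beta> * x) = \<alpha> * x + \<beta> * y"
    proof -
      have "(x + s * y) + s * (\<alpha> * y - \<beta> * x) = (1 - s * \<beta>) * x + (s * (1 + \<alpha>)) * y"
        by (simp add: algebra_simps)
      then show ?thesis by (simp add: sa sb)
    qed
    ultimately have "\<bar>x2 - (\<alpha> * x + \<beta> * y)\<bar> \<le> 4" using e1 by linarith
    with e2 show ?thesis unfolding \<phi> by (simp add: x_def y_def)
  qed
  ultimately show ?thesis by blast
qed

lemma ex_lattice_rotation: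
  fixes \<alpha> \<beta> :: real and i j :: nat
  assumes ij: "i \<noteq> j" and unit: "\<alpha>\<^sup>2 + \<beta>\<^sup>2 = 1"
  shows "\<exists>\<phi>. bij \<phi> \<and> (\<forall>z k. k \<noteq> i \<and> k \<noteq> j \<longrightarrow> \<phi> z k = z k) \<and>
    (\<forall>z. \<bar>real_of_int (\<phi> z i) - (\<alpha> * z i + \<beta> * z j)\<bar> \<le> 4 \<and>
         \<bar>real_of_int (\<phi> z j) - (\<alpha> * z j - \<beta> * z i)\<bar> \<le> 4)"
proof (cases "0 \<le> \<alpha>")
  case True
  then show ?thesis by (rule ex_lattice_rotation_acute [OF ij unit])
next
  case False
  then obtain \<phi> where \<phi>: "bij \<phi>" "\<And>z k. k \<noteq> i \<and> k \<noteq> j \<Longrightarrow> \<phi> z k = z k"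
    "\<And>z. \<bar>real_of_int (\<phi> z i) - (- \<alpha> * z i + - \<beta> * z j)\<bar> \<le> 4 \<and>
         \<bar>real_of_int (\<phi> z j) - (- \<alpha> * z j - - \<beta> * z i)\<bar> \<le> 4"
    using ex_lattice_rotation_acute [OF ij, of "- \<alpha>" "- \<beta>"] unit by auto
  define neg where "neg z = z(i := - z i, j := - z j)" for z :: "nat \<Rightarrow> int"
  have "neg \<circ> neg = id" using ij by (auto simp: neg_def fun_eq_iff)
  then have "bij neg" by (intro o_bij)
  then have "bij (neg \<circ> \<phi>)" using \<phi>(1) by (intro bij_comp)
  moreover have "(neg \<circ> \<phi>) z k = z k" if "k \<noteq> i \<and> k \<noteq> j" for z k
    using that \<phi>(2) by (simp add: neg_def)
  moreover have "\<bar>real_of_int ((neg \<circ> \<phi>) z i) - (\<alpha> * z i + \<beta> * z j)\<bar> \<le> 4 \<and>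
         \<bar>real_of_int ((neg \<circ> \<phi>) z j) - (\<alpha> * z j - \<beta> * z i)\<bar> \<le> 4" for z
    using \<phi>(3) [of z] ij by (auto simp: neg_def abs_le_iff)
  ultimately show ?thesis by blast
qed

lemma L2_set_diff: "\<bar>L2_set f A - L2_set g A\<bar> \<le> L2_set (\<lambda>k. f k - g k) A"
proof -
  have "L2_set (\<lambda>k. (f k - g k) + g k) A \<le> L2_set (\<lambda>k. f k - g k) A + L2_set g A"
    by (rule L2_set_triangle_ineq)
  moreover have "L2_set (\<lambda>k. (g k - f k) + f k) A \<le> L2_set (\<lambda>k. g k - f k) A + L2_set f A"
    by (rule L2_set_triangle_ineq)
  moreover have "L2_set (\<lambda>k. g k - f k) A = L2_set (\<lambda>k. f k - g k) A"
    by (simp add: L2_set_def power2_commute)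
  ultimately show ?thesis by simp
qed

lemma L2_set_Suc_sq: "(L2_set f {..<Suc n})\<^sup>2 = (L2_set f {..<n})\<^sup>2 + (f n)\<^sup>2"
  by (simp add: L2_set_def sum_nonneg)

lemma L2_set_Suc: "L2_set f {..<Suc n} = sqrt ((L2_set f {..<n})\<^sup>2 + (f n)\<^sup>2)"
  by (simp add: L2_set_def sum_nonneg)

lemma sqrt_sum_sq_diff: "\<bar>sqrt (x\<^sup>2 + t\<^sup>2) - sqrt (y\<^sup>2 + t\<^sup>2)\<bar> \<le> \<bar>x - y\<bar>"
proof -
  have "Complex x t - Complex y t = complex_of_real (x - y)" by (simp add: complex_eq_iff)
  then have "cmod (Complex x t - Complex y t) = \<bar>x - y\<bar>" by (simp only: norm_of_real)
  then show ?thesis using norm_triangle_ineq3 [of "Complex x t" "Complex y t"] by (simp add: complex_norm)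
qed

text \<open>
  By induction on the dimension: once the form in the first \<open>n\<close> variables has become a multiple of \<open>z 0\<close>, a
  rotation in the plane of \<open>z 0\<close> and \<open>z n\<close> absorbs the variable \<open>z n\<close>.  Every rotation contributes a bounded error.
\<close>

lemma ex_lattice_isometry:
  assumes "1 \<le> n"
  shows "\<exists>\<phi>. bij \<phi> \<and> (\<forall>z k. n \<le> k \<longrightarrow> \<phi> z k = z k) \<and>
    (\<forall>z. \<bar>(\<Sum>k<n. a k * real_of_int (z k)) - L2_set a {..<n} * real_of_int (\<phi> z 0)\<bar>
           \<le> 8 * real n * L2_set a {..<n} \<and>
         \<bar>lnorm n (\<phi> z) - lnorm n z\<bar> \<le> 8 * real n)"
  using assms
proof (induction n rule: dec_induct)
  case base
  define \<phi> where "\<phi> z = (if 0 \<le> a 0 then z else z(0 := - z 0))" for z :: "nat \<Rightarrow> int"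
  have "\<phi> \<circ> \<phi> = id" by (auto simp: \<phi>_def fun_eq_iff)
  then have "bij \<phi>" by (intro o_bij)
  moreover have "\<phi> z k = z k" if "1 \<le> k" for z k using that by (simp add: \<phi>_def)
  moreover have "\<bar>(\<Sum>k<1. a k * real_of_int (z k)) - L2_set a {..<1} * real_of_int (\<phi> z 0)\<bar>
      \<le> 8 * real 1 * L2_set a {..<1} \<and> \<bar>lnorm 1 (\<phi> z) - lnorm 1 z\<bar> \<le> 8 * real 1" for z
    by (simp add: \<phi>_def L2_set_def)
  ultimately show ?case by blast
next
  case (step n)
  then obtain \<phi> where \<phi>: "bij \<phi>" "\<And>z k. n \<le> k \<Longrightarrow> \<phi> z k = z k"
    "\<And>z. \<bar>(\<Sum>k<n. a k * real_of_int (z k)) - L2_set a {..<n} * real_of_int (\<phi> z 0)\<bar>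
       \<le> 8 * real n * L2_set a {..<n}"
    "\<And>z. \<bar>lnorm n (\<phi> z) - lnorm n z\<bar> \<le> 8 * real n" by blast
  let ?A' = "L2_set a {..<n}" and ?A = "L2_set a {..<Suc n}"
  show ?case
  proof (cases "?A = 0")
    case True
    then have "\<forall>k<Suc n. a k = 0" by (simp add: L2_set_eq_0_iff del: L2_set_insert lessThan_Suc) 
    then have "(\<Sum>k<Suc n. a k * real_of_int (z k)) = 0" for z by (intro sum.neutral) auto
    with True show ?thesis by (intro exI [of _ id] conjI bij_id) simp_all
  next
    case False
    then have A: "0 < ?A" using L2_set_nonneg [of a "{..<Suc n}"] by linarith
    have "(?A' / ?A)\<^sup>2 + (a n / ?A)\<^sup>2 = (?A'\<^sup>2 + (a n)\<^sup>2) / ?A\<^sup>2"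
      by (simp add: power_divide add_divide_distrib)
    also have "\<dots> = 1" using A unfolding L2_set_Suc_sq [symmetric] by simp
    finally have unit: "(?A' / ?A)\<^sup>2 + (a n / ?A)\<^sup>2 = 1" .
    have n0: "0 \<noteq> n" using step.hyps by simp
    define \<alpha> \<beta> where "\<alpha> = ?A' / ?A" and "\<beta> = a n / ?A"
    obtain \<rho> where \<rho>: "bij \<rho>" "\<And>z k. k \<noteq> 0 \<and> k \<noteq> n \<Longrightarrow> \<rho> z k = z k"
      "\<And>z. \<bar>real_of_int (\<rho> z 0) - (\<alpha> * z 0 + \<beta> * z n)\<bar> \<le> 4"
      "\<And>z. \<bar>real_of_int (\<rho> z n) - (\<alpha> * z n - \<beta> * z 0)\<bar> \<le> 4"
      using ex_lattice_rotation [OF n0 unit] unfolding \<alpha>_def \<beta>_def by blast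
    have ab: "\<alpha>\<^sup>2 + \<beta>\<^sup>2 = 1" using unit by (simp add: \<alpha>_def \<beta>_def)
    have "bij (\<rho> \<circ> \<phi>)" using \<rho>(1) \<phi>(1) by (intro bij_comp)
    moreover have "(\<rho> \<circ> \<phi>) z k = z k" if "Suc n \<le> k" for z k
      using that \<rho>(2) \<phi>(2) by simp
    moreover have "\<bar>(\<Sum>k<Suc n. a k * real_of_int (z k)) - ?A * real_of_int ((\<rho> \<circ> \<phi>) z 0)\<bar>
        \<le> 8 * real (Suc n) * ?A" for z
    proof -
      let ?w = "\<phi> z"
      have "\<bar>?A * real_of_int (\<rho> ?w 0) - ?A * (\<alpha> * ?w 0 + \<beta> * ?w n)\<bar> \<le> ?A * 4"
        using mult_left_mono [OF \<rho>(3) [of ?w], of ?A] A by (simp add: abs_mult flip: right_diff_distrib)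
      moreover have "?A * (\<alpha> * ?w 0 + \<beta> * ?w n) = ?A' * ?w 0 + a n * ?w n"
        using A by (simp add: \<alpha>_def \<beta>_def distrib_left)
      moreover have "?w n = z n" using \<phi>(2) by simp
      moreover have "8 * real n * ?A' \<le> 8 * real n * ?A"
      proof -
        have "?A'\<^sup>2 \<le> ?A\<^sup>2" unfolding L2_set_Suc_sq by simp
        then have "?A' \<le> ?A" by (rule power2_le_imp_le) (rule L2_set_nonneg)
        then show ?thesis by (intro mult_left_mono) auto
      qed
      moreover have "(\<Sum>k<Suc n. a k * real_of_int (z k)) = (\<Sum>k<n. a k * real_of_int (z k)) + a n * real_of_int (z n)"
        by simp
      moreover have "8 * real (Suc n) * ?A = 8 * real n * ?A + 8 * ?A" by (simp add: algebra_simps)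
      ultimately show ?thesis using \<phi>(3) [of z] A unfolding o_def abs_le_iff by (smt (verit))
    qed
    moreover have "\<bar>lnorm (Suc n) ((\<rho> \<circ> \<phi>) z) - lnorm (Suc n) z\<bar> \<le> 8 * real (Suc n)" for z
    proof -
      let ?w = "\<phi> z"
      define v where "v k = (if k = 0 then \<alpha> * ?w 0 + \<beta> * ?w n else
        if k = n then \<alpha> * ?w n - \<beta> * ?w 0 else real_of_int (?w k))" for k
      obtain m where m: "n = Suc m" using n0 by (cases n) auto
      have eq: "(\<Sum>k<Suc n. f k) = f 0 + (\<Sum>k<m. f (Suc k)) + f n" for f :: "nat \<Rightarrow> real"
      proof -
        have "(\<Sum>k<Suc m. f k) = f 0 + (\<Sum>k<m. f (Suc k))" by (rule sum.lessThan_Suc_shift)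
        then show ?thesis by (simp add: m)
      qed
      have "L2_set v {..<Suc n} = lnorm (Suc n) ?w"
      proof -
        have "(\<Sum>k<m. (v (Suc k))\<^sup>2) = (\<Sum>k<m. (real_of_int (?w (Suc k)))\<^sup>2)"
          by (intro sum.cong) (auto simp: v_def m)
        moreover have "(v 0)\<^sup>2 + (v n)\<^sup>2 = (\<alpha>\<^sup>2 + \<beta>\<^sup>2) * ((real_of_int (?w 0))\<^sup>2 + (real_of_int (?w n))\<^sup>2)"
          using n0 by (simp add: v_def power2_eq_square algebra_simps)
        ultimately show ?thesis unfolding L2_set_def eq by (simp add: ab)
      qed
      moreover have "\<bar>lnorm (Suc n) (\<rho> ?w) - L2_set v {..<Suc n}\<bar> \<le> 8"
      proof -
        have "\<bar>lnorm (Suc n) (\<rho> ?w) - L2_set v {..<Suc n}\<bar>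
            \<le> L2_set (\<lambda>k. real_of_int (\<rho> ?w k) - v k) {..<Suc n}" by (rule L2_set_diff)
        also have "\<dots> \<le> (\<Sum>k<Suc n. \<bar>real_of_int (\<rho> ?w k) - v k\<bar>)" by (rule L2_set_le_sum_abs)
        also have "\<dots> = \<bar>real_of_int (\<rho> ?w 0) - v 0\<bar> + 0 + \<bar>real_of_int (\<rho> ?w n) - v n\<bar>"
          unfolding eq using \<rho>(2) by (simp add: v_def m)
        also have "\<dots> \<le> 8" using \<rho>(3,4) [of ?w] n0 by (simp add: v_def)
        finally show ?thesis .
      qed
      moreover have "\<bar>lnorm (Suc n) ?w - lnorm (Suc n) z\<bar> \<le> 8 * real n"
      proof -
        have "?w n = z n" using \<phi>(2) by simp
        then show ?thesis
          using sqrt_sum_sq_diff [of "lnorm n ?w" "real_of_int (z n)" "lnorm n z"] \<phi>(4) [of z]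
          by (simp add: L2_set_Suc del: lessThan_Suc)
      qed
      ultimately show ?thesis by simp
    qed
    ultimately show ?thesis by blast
  qed
qed

section \<open>Euclidean norms from a symmetric norm\<close>

text \<open>
  By Bernoulli, \<open>(1 + \<eta>)^(i (m + 1)) \<ge> (\<eta> i)^(m + 1)\<close>, which is of higher degree in \<open>i\<close> than the right-hand side.
\<close>

lemma not_exponential_le_polynomial:
  fixes \<eta> K :: real
  assumes \<eta>: "0 < \<eta>"
  shows "\<exists>j. K * (real j + 1) ^ m < (1 + \<eta>) ^ j"
proof (rule ccontr)
  assume "\<not> ?thesis"
  then have le: "(1 + \<eta>) ^ j \<le> K * (real j + 1) ^ m" for j by (meson not_le)
  have K: "0 < K" using le [of 0] by simp
  obtain i0 :: nat where i0: "K * (real m + 2) ^ m / \<eta> ^ Suc m < real i0" using reals_Archimedean2 by blast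
  define i where "i = Suc i0"
  have i: "0 < real i" "K * (real m + 2) ^ m / \<eta> ^ Suc m < real i" using i0 by (auto simp: i_def)
  have "(\<eta> * real i) ^ Suc m \<le> (1 + real i * \<eta>) ^ Suc m"
    using \<eta> by (intro power_mono) (auto simp: mult.commute)
  also have "\<dots> \<le> ((1 + \<eta>) ^ i) ^ Suc m"
    using \<eta> by (intro power_mono Bernoulli_inequality) auto
  also have "\<dots> = (1 + \<eta>) ^ (i * Suc m)" by (rule power_mult [symmetric])
  also have "\<dots> \<le> K * (real (i * Suc m) + 1) ^ m" by (rule le)
  also have "\<dots> \<le> K * ((real m + 2) * real i) ^ m"
    using K i(1) by (intro mult_left_mono power_mono) (auto simp: algebra_simps i_def)
  finally have "\<eta> ^ Suc m * real i * real i ^ m \<le> K * (real m + 2) ^ m * real i ^ m"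
    by (simp only: power_mult_distrib power_Suc2 mult.assoc mult.left_commute [of "real i"])
       (simp add: mult.assoc mult.commute mult.left_commute)
  then have "\<eta> ^ Suc m * real i \<le> K * (real m + 2) ^ m"
    using i(1) by (subst (asm) mult_le_cancel_right) simp
  with i(2) \<eta> show False by (simp add: field_simps)
qed

definition lball :: "nat \<Rightarrow> nat \<Rightarrow> (nat \<Rightarrow> int) set" where
  "lball n R = {z. (\<forall>k\<ge>n. z k = 0) \<and> lnorm n z \<le> real R}"

lemma abs_le_lnorm: "k < n \<Longrightarrow> \<bar>real_of_int (z k)\<bar> \<le> lnorm n z"
  using member_le_L2_set [of "{..<n}" k "\<lambda>k. real_of_int \<bar>z k\<bar>"] by (simp add: L2_set_def)

lemma lball_card: "finite (lball n R)" "card (lball n R) \<le> (2 * R + 1) ^ n"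
proof -
  have b: "z k \<in> {- int R..int R}" if "z \<in> lball n R" "k < n" for z k
    using abs_le_lnorm [OF that(2), of z] that(1) by (auto simp: lball_def)
  let ?f = "\<lambda>z. restrict z {..<n}" and ?B = "PiE {..<n} (\<lambda>_. {- int R..int R})"
  have inj: "inj_on ?f (lball n R)"
  proof (rule inj_onI)
    fix z w assume z: "z \<in> lball n R" "w \<in> lball n R" and eq: "restrict z {..<n} = restrict w {..<n}"
    show "z = w"
    proof
      fix k
      show "z k = w k"
      proof (cases "k < n")
        case True
        then show ?thesis using fun_cong [OF eq, of k] by simp
      next
        case False
        then show ?thesis using z by (simp add: lball_def)
      qed
    qed
  qed
  have sub: "?f ` lball n R \<subseteq> ?B" using b by (simp add: image_subset_iff restrict_PiE_iff)
  have fin: "finite ?B" by (intro finite_PiE) auto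
  show "finite (lball n R)" using finite_imageD [OF finite_subset [OF sub fin] inj] .
  have "card (lball n R) \<le> card ?B" by (rule card_inj_on_le [OF inj sub fin])
  also have "\<dots> = (2 * R + 1) ^ n" by (simp add: card_PiE nat_add_distrib nat_mult_distrib)
  finally show "card (lball n R) \<le> (2 * R + 1) ^ n" .
qed

text \<open>
  For a symmetric norm the coefficients may be indexed by any finite set; the enumeration is immaterial.
\<close>

definition set_norm :: "(real list \<Rightarrow> real) \<Rightarrow> 'b set \<Rightarrow> ('b \<Rightarrow> real) \<Rightarrow> real" where
  "set_norm \<nu> A f = \<nu> (map f (SOME xs. distinct xs \<and> set xs = A))"

context
  fixes \<nu> :: "real list \<Rightarrow> real"
  assumes \<nu>: "spreading \<nu>" and one: "\<nu> [1] = 1"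
    and perm: "\<And>xs ys. mset xs = mset ys \<Longrightarrow> \<nu> xs = \<nu> ys"
    and mono: "\<And>xs ys. list_all2 (\<lambda>x y. \<bar>x\<bar> \<le> \<bar>y\<bar>) xs ys \<Longrightarrow> \<nu> xs \<le> \<nu> ys"
begin

lemma set_norm_eq:
  assumes "distinct xs" "set xs = A"
  shows "set_norm \<nu> A f = \<nu> (map f xs)"
proof -
  let ?ys = "SOME xs. distinct xs \<and> set xs = A"
  have "distinct ?ys \<and> set ?ys = A" by (rule someI [of _ xs]) (use assms in simp)
  then have "mset ?ys = mset xs" using assms set_eq_iff_mset_eq_distinct [of ?ys xs] by simp
  then show ?thesis unfolding set_norm_def by (intro perm) simp
qed

lemma set_norm_add:
  assumes "finite A"
  shows "set_norm \<nu> A (\<lambda>z. f z + g z) \<le> set_norm \<nu> A f + set_norm \<nu> A g"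
proof -
  obtain xs where xs: "distinct xs" "set xs = A" using finite_distinct_list [OF assms] by blast
  have "map2 (+) (map f xs) (map g xs) = map (\<lambda>z. f z + g z) xs" by (rule map2_map)
  then show ?thesis
    using spreading_triangle [OF \<nu>, of "map f xs" "map g xs"] by (simp only: set_norm_eq [OF xs] length_map)
qed

lemma set_norm_scale:
  assumes "finite A"
  shows "set_norm \<nu> A (\<lambda>z. c * f z) = \<bar>c\<bar> * set_norm \<nu> A f"
proof -
  obtain xs where xs: "distinct xs" "set xs = A" using finite_distinct_list [OF assms] by blast
  show ?thesis
    using spreading_scale [OF \<nu>, of c "map f xs"] by (simp add: set_norm_eq [OF xs] o_def)
qed

lemma set_norm_mono:
  assumes "finite A" "\<And>z. z \<in> A \<Longrightarrow> \<bar>f z\<bar> \<le> \<bar>g z\<bar>"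
  shows "set_norm \<nu> A f \<le> set_norm \<nu> A g"
proof -
  obtain xs where xs: "distinct xs" "set xs = A" using finite_distinct_list [OF assms(1)] by blast
  have "\<bar>f (xs ! i)\<bar> \<le> \<bar>g (xs ! i)\<bar>" if "i < length xs" for i
    using assms(2) xs(2) nth_mem [OF that] by blast
  then have "list_all2 (\<lambda>x y. \<bar>x\<bar> \<le> \<bar>y\<bar>) (map f xs) (map g xs)"
    by (simp add: list_all2_conv_all_nth)
  then show ?thesis using mono by (simp add: set_norm_eq [OF xs])
qed

lemma set_norm_subset:
  assumes "A \<subseteq> B" "finite B"
  shows "set_norm \<nu> A f \<le> set_norm \<nu> B f"
proof -
  obtain xs where xs: "distinct xs" "set xs = A"
    using finite_distinct_list [OF finite_subset [OF assms]] by blast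
  obtain ys where ys: "distinct ys" "set ys = B - A" using finite_distinct_list [of "B - A"] assms by blast
  have B: "distinct (xs @ ys)" "set (xs @ ys) = B" using xs ys assms by auto
  have "\<nu> (map f xs) = \<nu> (map f xs @ replicate (length ys) 0)" by (rule spreading_strip_eq [OF \<nu>]) simp
  also have "\<dots> \<le> \<nu> (map f xs @ map f ys)"
    by (intro mono list_all2_appendI) (auto simp: list_all2_conv_all_nth)
  finally show ?thesis by (simp add: set_norm_eq [OF xs] set_norm_eq [OF B])
qed

lemma set_norm_image:
  assumes "inj_on \<phi> A" "finite A"
  shows "set_norm \<nu> (\<phi> ` A) f = set_norm \<nu> A (\<lambda>z. f (\<phi> z))"
proof -
  obtain xs where xs: "distinct xs" "set xs = A" using finite_distinct_list [OF assms(2)] by blast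
  have "distinct (map \<phi> xs)" "set (map \<phi> xs) = \<phi> ` A" using xs assms(1) by (auto simp: distinct_map)
  then show ?thesis using set_norm_eq [of "map \<phi> xs"] by (simp add: set_norm_eq [OF xs] o_def)
qed

lemma set_norm_le_card:
  assumes "finite A" "\<And>z. z \<in> A \<Longrightarrow> \<bar>f z\<bar> \<le> C"
  shows "set_norm \<nu> A f \<le> C * real (card A)"
proof -
  obtain xs where xs: "distinct xs" "set xs = A" using finite_distinct_list [OF assms(1)] by blast
  have "\<nu> (map f xs) \<le> (\<Sum>x\<leftarrow>map f xs. \<bar>x\<bar>)" using spreading_le_sum [OF \<nu>, of "map f xs"] one by simp
  also have "\<dots> = (\<Sum>x\<in>A. \<bar>f x\<bar>)" using xs by (simp add: o_def sum_list_distinct_conv_sum_set)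
  also have "\<dots> \<le> (\<Sum>x\<in>A. C)" using assms(2) by (intro sum_mono)
  finally show ?thesis by (simp add: set_norm_eq [OF xs] mult.commute)
qed

lemma set_norm_nonneg: "0 \<le> set_norm \<nu> A f"
  unfolding set_norm_def by (rule spreading_nonneg [OF \<nu>])

text \<open>
  The vectors \<open>\<Sum>z. (z k) e\<^sub>z\<close> for \<open>k < n\<close>, where \<open>z\<close> ranges over the lattice points of a large ball,
  span an almost Euclidean space: lattice isometries permute the basis and move the coefficients by a
  bounded amount, which is small compared with the radius.  Passing from the radius \<open>R\<close> to
  \<open>R + D\<close> costs only a factor \<open>1 + \<eta>\<close> for suitable \<open>R\<close>, as the norms grow polynomially in \<open>R\<close>.
\<close>

lemma ex_almost_euclidean:
  assumes n: "1 \<le> n" and \<eta>: "0 < \<eta>" "\<eta> \<le> 1"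
  shows "\<exists>R p. 0 < p \<and> (\<forall>a. \<bar>set_norm \<nu> (lball n R) (\<lambda>z. \<Sum>k<n. a k * real_of_int (z k)) / p
    - L2_set a {..<n}\<bar> \<le> 2 * \<eta> * L2_set a {..<n})"
proof -
  define p where "p R = set_norm \<nu> (lball n R) (\<lambda>z. real_of_int (z 0))" for R
  define u where "u R = set_norm \<nu> (lball n R) (\<lambda>_. 1)" for R
  note fin = lball_card(1) [of n]
  define C where "C = 8 * n"
  have lball_mono: "lball n R \<subseteq> lball n R'" if "R \<le> R'" for R R' using that by (auto simp: lball_def)
  have p_mono: "p R \<le> p R'" if "R \<le> R'" for R R'
    unfolding p_def using that by (intro set_norm_subset lball_mono fin)
  have u_nonneg: "0 \<le> u R" and p_nonneg: "0 \<le> p R" for R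
    by (auto simp: u_def p_def set_norm_nonneg)
  have p1: "1 \<le> p 1"
  proof -
    define e :: "nat \<Rightarrow> int" where "e = (\<lambda>k. if k = 0 then 1 else 0)"
    have "(\<Sum>k<n. (real_of_int (e k))\<^sup>2) = (\<Sum>k<n. if k = 0 then 1 else 0)"
      by (intro sum.cong) (auto simp: e_def)
    then have "lnorm n e = 1" using n by (simp add: L2_set_def)
    then have "e \<in> lball n 1" using n by (simp add: lball_def) (simp add: e_def)
    then have "set_norm \<nu> {e} (\<lambda>z. real_of_int (z 0)) \<le> p 1"
      unfolding p_def by (intro set_norm_subset fin) auto
    moreover have "set_norm \<nu> {e} (\<lambda>z. real_of_int (z 0)) = 1"
      using set_norm_eq [of "[e]"] one by (simp add: e_def)
    ultimately show ?thesis by simp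
  qed
  \<comment> \<open>\<open>h\<close> times the constant \<open>1\<close> is the difference of the coordinate \<open>z 0\<close> and its translate by \<open>h\<close>, so \<open>u\<close> is small compared with \<open>p\<close>.\<close>
  have shift: "real h * u R \<le> p (R + h) + p R" for h R
  proof -
    define \<tau> where "\<tau> z = z(0 := z 0 + int h)" for z :: "nat \<Rightarrow> int"
    have inj: "inj_on \<tau> (lball n R)"
    proof (rule inj_onI)
      fix z w assume eq: "\<tau> z = \<tau> w"
      have "z k = w k" for k using fun_cong [OF eq, of k] by (simp add: \<tau>_def split: if_splits)
      then show "z = w" by blast
    qed
    have img: "\<tau> ` lball n R \<subseteq> lball n (R + h)"
    proof
      fix w assume "w \<in> \<tau> ` lball n R"
      then obtain z where z: "z \<in> lball n R" "w = \<tau> z" by blast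
      have "lnorm n (\<tau> z) \<le> lnorm n z + L2_set (\<lambda>k. real_of_int (\<tau> z k) - real_of_int (z k)) {..<n}"
        using L2_set_diff [of "\<lambda>k. real_of_int (\<tau> z k)" "{..<n}" "\<lambda>k. real_of_int (z k)"] by linarith
      also have "L2_set (\<lambda>k. real_of_int (\<tau> z k) - real_of_int (z k)) {..<n}
          \<le> (\<Sum>k<n. \<bar>real_of_int (\<tau> z k) - real_of_int (z k)\<bar>)" by (rule L2_set_le_sum_abs)
      also have "\<dots> = (\<Sum>k<n. if k = 0 then real h else 0)" by (intro sum.cong) (auto simp: \<tau>_def)
      also have "\<dots> = real h" using n by simp
      finally show "w \<in> lball n (R + h)" using z n by (auto simp: lball_def \<tau>_def)
    qed
    have "real h * u R = set_norm \<nu> (lball n R) (\<lambda>z. real h * 1)"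
      unfolding u_def by (subst set_norm_scale [OF fin]) simp
    also have "\<dots> = set_norm \<nu> (lball n R) (\<lambda>z. real_of_int (\<tau> z 0) + (-1) * real_of_int (z 0))"
      by (simp add: \<tau>_def)
    also have "\<dots> \<le> set_norm \<nu> (lball n R) (\<lambda>z. real_of_int (\<tau> z 0))
        + set_norm \<nu> (lball n R) (\<lambda>z. (-1) * real_of_int (z 0))" by (rule set_norm_add [OF fin])
    also have "set_norm \<nu> (lball n R) (\<lambda>z. (-1) * real_of_int (z 0)) = p R"
      unfolding p_def by (subst set_norm_scale [OF fin]) simp
    also have "set_norm \<nu> (lball n R) (\<lambda>z. real_of_int (\<tau> z 0)) = set_norm \<nu> (\<tau> ` lball n R) (\<lambda>z. real_of_int (z 0))"
      by (rule set_norm_image [OF inj fin, symmetric])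
    also have "\<dots> \<le> p (R + h)" unfolding p_def by (rule set_norm_subset [OF img fin])
    finally show ?thesis by simp
  qed
  obtain h0 :: nat where h0: "8 * real C / \<eta> < real h0" using reals_Archimedean2 by blast
  define h where "h = Suc h0"
  have h: "8 * real C / \<eta> \<le> real h" "0 < real h" using h0 by (auto simp: h_def)
  define D where "D = 2 * C + h"
  \<comment> \<open>Otherwise \<open>p\<close> would grow exponentially.\<close>
  have "\<exists>R\<ge>1. p (R + D) \<le> (1 + \<eta>) * p R"
  proof (rule ccontr)
    assume "\<not> ?thesis"
    then have g: "(1 + \<eta>) * p R < p (R + D)" if "1 \<le> R" for R using that by (meson not_le)
    have low: "(1 + \<eta>) ^ j \<le> p (1 + j * D)" for j
    proof (induction j)
      case 0
      then show ?case using p1 by simp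
    next
      case (Suc j)
      have "(1 + \<eta>) * (1 + \<eta>) ^ j \<le> (1 + \<eta>) * p (1 + j * D)" using Suc \<eta> by (intro mult_left_mono) auto
      also have "\<dots> \<le> p ((1 + j * D) + D)" using g [of "1 + j * D"] by simp
      finally show ?case by (simp add: algebra_simps)
    qed
    have up: "p R \<le> real (2 * R + 1) ^ Suc n" for R
    proof -
      have "\<bar>real_of_int (z 0)\<bar> \<le> real R" if "z \<in> lball n R" for z
        using abs_le_lnorm [of 0 n z] n that by (simp add: lball_def)
      then have "p R \<le> real R * real (card (lball n R))" unfolding p_def by (intro set_norm_le_card fin)
      also have "\<dots> \<le> real (2 * R + 1) * real ((2 * R + 1) ^ n)"
        using lball_card(2) [of n R] by (intro mult_mono of_nat_mono) auto
      finally show ?thesis by simp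
    qed
    obtain j where j: "(2 * real D + 3) ^ Suc n * (real j + 1) ^ Suc n < (1 + \<eta>) ^ j"
      using not_exponential_le_polynomial [OF \<eta>(1)] by blast
    have "real (2 * (1 + j * D) + 1) \<le> (2 * real D + 3) * (real j + 1)" by (simp add: algebra_simps)
    then have "real (2 * (1 + j * D) + 1) ^ Suc n \<le> ((2 * real D + 3) * (real j + 1)) ^ Suc n"
      by (intro power_mono) auto
    then show False using low [of j] up [of "1 + j * D"] j by (simp only: power_mult_distrib)
  qed
  then obtain R where R: "1 \<le> R" "p (R + D) \<le> (1 + \<eta>) * p R" by blast
  have pR: "0 < p R" using p1 p_mono [OF R(1)] by linarith
  have Cu: "real C * u (R + C) \<le> \<eta> * p R"
  proof -
    have "real h * u (R + C) \<le> p (R + C + h) + p (R + C)" by (rule shift)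
    also have "\<dots> \<le> p (R + D) + p (R + D)" by (rule add_mono; rule p_mono) (simp_all add: D_def)
    also have "\<dots> \<le> 4 * p R"
    proof -
      have "(1 + \<eta>) * p R \<le> 2 * p R" using \<eta> pR by (intro mult_right_mono) auto
      with R(2) show ?thesis by simp
    qed
    finally have 1: "real h * u (R + C) \<le> 4 * p R" .
    have "8 * real C * u (R + C) \<le> \<eta> * real h * u (R + C)"
      using h(1) \<eta>(1) u_nonneg by (intro mult_right_mono) (auto simp: field_simps)
    also have "\<dots> \<le> \<eta> * (4 * p R)" using 1 \<eta>(1) by (simp add: mult.assoc)
    finally have "2 * (real C * u (R + C)) \<le> \<eta> * p R" by simp
    moreover have "0 \<le> real C * u (R + C)" using u_nonneg by simp
    ultimately show ?thesis by linarith
  qed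
  let ?F = "\<lambda>a. set_norm \<nu> (lball n (R + C)) (\<lambda>z. \<Sum>k<n. a k * real_of_int (z k))"
  \<comment> \<open>The image of the ball of radius \<open>R + C\<close> under a lattice isometry lies between the balls of radius \<open>R\<close> and \<open>R + 2 C\<close>.\<close>
  have main: "(1 - \<eta>) * p R \<le> ?F a \<and> ?F a \<le> (1 + 2 * \<eta>) * p R" if a: "L2_set a {..<n} = 1" for a
  proof -
    obtain \<phi> where \<phi>: "bij \<phi>" "\<And>z k. n \<le> k \<Longrightarrow> \<phi> z k = z k"
      "\<And>z. \<bar>(\<Sum>k<n. a k * real_of_int (z k)) - real_of_int (\<phi> z 0)\<bar> \<le> real C"
      "\<And>z. \<bar>lnorm n (\<phi> z) - lnorm n z\<bar> \<le> real C"
      using ex_lattice_isometry [OF n, of a] a by (auto simp: C_def)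
    have inj: "inj_on \<phi> S" for S using \<phi>(1) by (meson bij_is_inj inj_on_subset subset_UNIV)
    have img: "\<phi> ` lball n (R + C) \<subseteq> lball n (R + 2 * C)"
    proof
      fix w assume "w \<in> \<phi> ` lball n (R + C)"
      then obtain z where z: "z \<in> lball n (R + C)" "w = \<phi> z" by blast
      then have "lnorm n z \<le> real R + real C" by (simp add: lball_def)
      then have "lnorm n (\<phi> z) \<le> real R + 2 * real C" using \<phi>(4) [of z] by linarith
      then show "w \<in> lball n (R + 2 * C)" using z \<phi>(2) by (simp add: lball_def)
    qed
    have img': "lball n R \<subseteq> \<phi> ` lball n (R + C)"
    proof
      fix w assume w: "w \<in> lball n R"
      obtain z where z: "w = \<phi> z" using \<phi>(1) by (meson bij_pointE)
      have "z k = 0" if "n \<le> k" for k using \<phi>(2) [OF that, of z] w that by (simp add: lball_def z)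
      moreover have "lnorm n (\<phi> z) \<le> real R" using w by (simp add: lball_def z)
      then have "lnorm n z \<le> real R + real C" using \<phi>(4) [of z] by linarith
      ultimately have "z \<in> lball n (R + C)" by (simp add: lball_def)
      then show "w \<in> \<phi> ` lball n (R + C)" using z by blast
    qed
    let ?G = "set_norm \<nu> (lball n (R + C)) (\<lambda>z. real_of_int (\<phi> z 0))"
    have G: "?G = set_norm \<nu> (\<phi> ` lball n (R + C)) (\<lambda>z. real_of_int (z 0))"
      by (rule set_norm_image [OF inj fin, symmetric])
    have G1: "?G \<le> p (R + 2 * C)" unfolding G p_def by (rule set_norm_subset [OF img fin])
    have G2: "p R \<le> ?G" unfolding G p_def by (rule set_norm_subset [OF img']) (simp add: fin)
    have err: "set_norm \<nu> (lball n (R + C)) (\<lambda>z. g z) \<le> real C * u (R + C)" if "\<And>z. \<bar>g z\<bar> \<le> real C" for g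
    proof -
      have "set_norm \<nu> (lball n (R + C)) g \<le> set_norm \<nu> (lball n (R + C)) (\<lambda>z. real C * 1)"
        using that by (intro set_norm_mono fin) auto
      also have "\<dots> = real C * u (R + C)" unfolding u_def by (subst set_norm_scale [OF fin]) simp
      finally show ?thesis .
    qed
    have "?F a \<le> ?G + set_norm \<nu> (lball n (R + C)) (\<lambda>z. (\<Sum>k<n. a k * real_of_int (z k)) - real_of_int (\<phi> z 0))"
      using set_norm_add [OF fin, of "R + C" "\<lambda>z. real_of_int (\<phi> z 0)"
          "\<lambda>z. (\<Sum>k<n. a k * real_of_int (z k)) - real_of_int (\<phi> z 0)"] by simp
    also have "\<dots> \<le> p (R + 2 * C) + \<eta> * p R" 
      using G1 err [of "\<lambda>z. (\<Sum>k<n. a k * real_of_int (z k)) - real_of_int (\<phi> z 0)", OF \<phi>(3)] Cu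
      by linarith
    also have "p (R + 2 * C) \<le> p (R + D)" by (intro p_mono) (simp add: D_def)
    then have "p (R + 2 * C) + \<eta> * p R \<le> (1 + 2 * \<eta>) * p R" using R(2) by (simp add: algebra_simps)
    finally have up: "?F a \<le> (1 + 2 * \<eta>) * p R" .
    have "?G \<le> ?F a + set_norm \<nu> (lball n (R + C)) (\<lambda>z. real_of_int (\<phi> z 0) - (\<Sum>k<n. a k * real_of_int (z k)))"
      using set_norm_add [OF fin, of "R + C" "\<lambda>z. \<Sum>k<n. a k * real_of_int (z k)"
          "\<lambda>z. real_of_int (\<phi> z 0) - (\<Sum>k<n. a k * real_of_int (z k))"] by simp
    also have "\<dots> \<le> ?F a + \<eta> * p R"
    proof -
      have "\<bar>real_of_int (\<phi> z 0) - (\<Sum>k<n. a k * real_of_int (z k))\<bar> \<le> real C" for z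
        using \<phi>(3) [of z] by (simp only: abs_minus_commute)
      from err [of "\<lambda>z. real_of_int (\<phi> z 0) - (\<Sum>k<n. a k * real_of_int (z k))", OF this] Cu
      show ?thesis by linarith
    qed
    finally have "(1 - \<eta>) * p R \<le> ?F a" using G2 by (simp add: algebra_simps)
    with up show ?thesis by simp
  qed
  have "\<bar>?F a / p R - L2_set a {..<n}\<bar> \<le> 2 * \<eta> * L2_set a {..<n}" for a
  proof (cases "L2_set a {..<n} = 0")
    case True
    then have "\<forall>k<n. a k = 0" by (simp add: L2_set_eq_0_iff)
    then have "(\<Sum>k<n. a k * real_of_int (z k)) = 0 * 1" for z by (simp add: sum.neutral)
    then have "?F a = set_norm \<nu> (lball n (R + C)) (\<lambda>z. 0 * 1)" by (simp only:)
    also have "\<dots> = 0" by (subst set_norm_scale [OF fin]) simp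
    finally show ?thesis using True by simp
  next
    case False
    let ?A = "L2_set a {..<n}"
    have A: "0 < ?A" using False L2_set_nonneg [of a "{..<n}"] by linarith
    have "L2_set (\<lambda>k. (1 / ?A) * a k) {..<n} = (1 / ?A) * ?A"
      using A by (intro L2_set_right_distrib [symmetric]) simp
    then have "L2_set (\<lambda>k. (1 / ?A) * a k) {..<n} = 1" using A by simp
    note m = main [OF this]
    have "?F a = set_norm \<nu> (lball n (R + C)) (\<lambda>z. ?A * (\<Sum>k<n. (1 / ?A) * a k * real_of_int (z k)))"
      using A by (simp add: sum_distrib_left mult.assoc)
    also have "\<dots> = ?A * ?F (\<lambda>k. (1 / ?A) * a k)" using A by (subst set_norm_scale [OF fin]) simp
    finally have F: "?F a = ?A * ?F (\<lambda>k. (1 / ?A) * a k)" .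
    define y where "y = ?F (\<lambda>k. (1 / ?A) * a k) / p R"
    have "1 - \<eta> \<le> y" "y \<le> 1 + 2 * \<eta>" using m pR by (auto simp: y_def field_simps)
    then have "\<bar>y - 1\<bar> \<le> 2 * \<eta>" using \<eta>(1) by linarith
    then have "?A * \<bar>y - 1\<bar> \<le> ?A * (2 * \<eta>)" using A by (intro mult_left_mono) auto
    moreover have "?F a / p R - ?A = ?A * (y - 1)" unfolding F y_def by (simp add: algebra_simps)
    ultimately show ?thesis using A by (simp add: abs_mult mult.commute)
  qed
  then show ?thesis using pR by blast
qed

text \<open>
  Each finite set of lists fits into a common dimension \<open>n\<close>, and the almost Euclidean space found there
  is spanned by combinations of finitely many basis vectors of a norm that is finitely representable in \<open>M\<close>.
\<close>

lemma fin_rep_euclidean: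
  fixes M :: "'a::real_normed_vector set"
  assumes M: "subspace M" and fr: "fin_rep M \<nu>"
  shows "fin_rep M (\<lambda>cs. L2_set (\<lambda>k. cs ! k) {..<length cs})"
  unfolding fin_rep_def
proof (intro allI impI)
  fix P :: "real list set" and \<epsilon> :: real assume P: "finite P \<and> \<epsilon> > 0"
  let ?l2 = "\<lambda>cs :: real list. L2_set (\<lambda>k. cs ! k) {..<length cs}"
  have "finite (length ` P)" using P by simp
  then obtain n0 where n0: "\<forall>l\<in>length ` P. l \<le> n0" using finite_nat_set_iff_bounded_le by blast
  define n where "n = Suc n0"
  have n: "1 \<le> n" "\<And>cs. cs \<in> P \<Longrightarrow> length cs \<le> n" using n0 by (auto simp: n_def intro: le_SucI)
  define S where "S = 1 + (\<Sum>cs\<in>P. ?l2 cs)"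
  have S: "?l2 cs \<le> S" if "cs \<in> P" for cs
  proof -
    have "?l2 cs \<le> (\<Sum>cs\<in>P. ?l2 cs)" using P that by (intro member_le_sum) (auto simp: L2_set_nonneg)
    then show ?thesis by (simp add: S_def)
  qed
  have S1: "1 \<le> S" using P by (simp add: S_def sum_nonneg L2_set_nonneg)
  define \<eta> where "\<eta> = min 1 (\<epsilon> / (4 * S))"
  have \<eta>: "0 < \<eta>" "\<eta> \<le> 1" "2 * \<eta> * S \<le> \<epsilon> / 2" using P S1 by (auto simp: \<eta>_def min_def field_simps)
  obtain R p where p: "0 < p" and Rp: "\<And>a. \<bar>set_norm \<nu> (lball n R) (\<lambda>z. \<Sum>k<n. a k * real_of_int (z k)) / p
    - L2_set a {..<n}\<bar> \<le> 2 * \<eta> * L2_set a {..<n}" using ex_almost_euclidean [OF n(1) \<eta>(1,2)] by blast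
  obtain zs where zs: "distinct zs" "set zs = lball n R" using finite_distinct_list [OF lball_card(1)] by blast
  define v where "v cs = (\<lambda>k. if k < length cs then cs ! k else 0 :: real)" for cs
  define L where "L cs = map (\<lambda>z. \<Sum>k<n. v cs k * real_of_int (z k)) zs" for cs
  have "finite (L ` P)" "0 < p * (\<epsilon> / 2)" using P p by auto
  from fin_repD [OF fr this] obtain x where xM: "\<forall>i. x i \<in> M"
    and xP: "\<forall>ds\<in>L ` P. \<bar>norm (lincomb ds x) - \<nu> ds\<bar> \<le> p * (\<epsilon> / 2)" by (elim exE conjE)
  have x: "x i \<in> M" "cs \<in> P \<Longrightarrow> \<bar>norm (lincomb (L cs) x) - \<nu> (L cs)\<bar> \<le> p * (\<epsilon> / 2)" for i cs
    using xM xP by simp_all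
  define y where "y k = (1 / p) *\<^sub>R (\<Sum>l<length zs. real_of_int ((zs ! l) k) *\<^sub>R x l)" for k
  have "y k \<in> M" for k
    unfolding y_def using x(1) by (intro subspace_scale [OF M] subspace_sum [OF M]) auto
  moreover have "\<bar>norm (lincomb cs y) - ?l2 cs\<bar> \<le> \<epsilon>" if cs: "cs \<in> P" for cs
  proof -
    have vn: "(\<Sum>k<n. f k (v cs k)) = (\<Sum>k<length cs. f k (cs ! k))" if "\<And>k. f k 0 = 0"
      for f :: "nat \<Rightarrow> real \<Rightarrow> 'c::comm_monoid_add"
      using n(2) [OF cs] that by (intro sum.mono_neutral_cong_right) (auto simp: v_def)
    have l2: "L2_set (v cs) {..<n} = ?l2 cs"
      unfolding L2_set_def using vn [of "\<lambda>_ t. t\<^sup>2"] by simp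
    have "lincomb (L cs) x = (\<Sum>l<length zs. (\<Sum>k<n. v cs k * real_of_int ((zs ! l) k)) *\<^sub>R x l)"
      by (simp add: lincomb_sum L_def)
    also have "\<dots> = (\<Sum>k<n. \<Sum>l<length zs. (v cs k * real_of_int ((zs ! l) k)) *\<^sub>R x l)"
      by (simp only: scaleR_sum_left) (rule sum.swap)
    also have "\<dots> = p *\<^sub>R (\<Sum>k<n. v cs k *\<^sub>R y k)"
      using p by (simp add: y_def scaleR_sum_right)
    also have "(\<Sum>k<n. v cs k *\<^sub>R y k) = lincomb cs y"
      using vn [of "\<lambda>k t. t *\<^sub>R y k"] by (simp add: lincomb_sum)
    finally have lc: "norm (lincomb (L cs) x) = p * norm (lincomb cs y)" using p by simp
    have "\<nu> (L cs) = set_norm \<nu> (lball n R) (\<lambda>z. \<Sum>k<n. v cs k * real_of_int (z k))"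
      by (simp add: L_def set_norm_eq [OF zs])
    then have "\<bar>\<nu> (L cs) / p - ?l2 cs\<bar> \<le> 2 * \<eta> * ?l2 cs" using Rp [of "v cs"] by (simp add: l2)
    also have "\<dots> \<le> 2 * \<eta> * S" using S [OF cs] \<eta>(1) by (intro mult_left_mono) auto
    finally have 1: "\<bar>\<nu> (L cs) / p - ?l2 cs\<bar> \<le> \<epsilon> / 2" using \<eta>(3) by linarith
    have "p * \<bar>norm (lincomb cs y) - \<nu> (L cs) / p\<bar> = \<bar>p * norm (lincomb cs y) - \<nu> (L cs)\<bar>"
      using p by (simp add: abs_mult_pos' right_diff_distrib)
    also have "\<dots> \<le> p * (\<epsilon> / 2)" using x(2) [OF cs] by (simp add: lc)
    finally have "\<bar>norm (lincomb cs y) - \<nu> (L cs) / p\<bar> \<le> \<epsilon> / 2" using p by simp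
    with 1 show ?thesis by linarith
  qed
  ultimately show "\<exists>x. (\<forall>i. x i \<in> M) \<and> (\<forall>cs\<in>P. \<bar>norm (lincomb cs x) - ?l2 cs\<bar> \<le> \<epsilon>)" by blast
qed

end

theorem dvoretzky:
  fixes M :: "'a::real_normed_vector set"
  assumes M: "subspace M" and inf: "infinite_dimensional M"
  shows "fin_rep M (\<lambda>cs. L2_set (\<lambda>k. cs ! k) {..<length cs})"
proof -
  obtain \<nu> where \<nu>: "spreading \<nu>" and fr: "fin_rep M \<nu>" and one: "\<nu> [1] = 1"
    and perm: "\<forall>xs ys. mset xs = mset ys \<longrightarrow> \<nu> xs = \<nu> ys"
    and mono: "\<forall>xs ys. list_all2 (\<lambda>x y. \<bar>x\<bar> \<le> \<bar>y\<bar>) xs ys \<longrightarrow> \<nu> xs \<le> \<nu> ys"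
    using ex_symmetric_norm [OF M inf] by blast
  show ?thesis by (rule fin_rep_euclidean [OF \<nu> one perm [rule_format] mono [rule_format] M fr])
qed

section \<open>Values of formulas\<close>

lemma zero_in_unit_ball: "subspace N \<Longrightarrow> 0 \<in> unit_ball N"
  by (simp add: unit_ball_def subspace_0)

lemma unit_ball_nonempty: "subspace N \<Longrightarrow> unit_ball N \<noteq> {}"
  using zero_in_unit_ball by blast

lemma tval_cong: "(\<And>i. i \<in> tvars t \<Longrightarrow> e i = e' i) \<Longrightarrow> tval t e = tval t e'"
  by (induction t) auto

lemma fval_cong: "(\<And>i. i \<in> fvars \<phi> \<Longrightarrow> e i = e' i) \<Longrightarrow> fval N \<phi> e = fval N \<phi> e'"
proof (induction \<phi> arbitrary: e e')
  case (FNorm t)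
  then show ?case using tval_cong [of t e e'] by simp
next
  case (FNot \<phi>)
  then have "fval N \<phi> e = fval N \<phi> e'" by (intro FNot.IH) simp
  then show ?case by simp
next
  case (FHalf \<phi>)
  then have "fval N \<phi> e = fval N \<phi> e'" by (intro FHalf.IH) simp
  then show ?case by simp
next
  case (FMinus \<phi> \<psi>)
  have "fval N \<phi> e = fval N \<phi> e'" by (rule FMinus.IH(1)) (simp add: FMinus.prems)
  moreover have "fval N \<psi> e = fval N \<psi> e'" by (rule FMinus.IH(2)) (simp add: FMinus.prems)
  ultimately show ?case by simp
next
  case (FSup i \<phi>)
  then have "fval N \<phi> (e(i := x)) = fval N \<phi> (e'(i := x))" for x by (intro FSup.IH) auto
  then show ?case by simp
next
  case (FInf i \<phi>)
  then have "fval N \<phi> (e(i := x)) = fval N \<phi> (e'(i := x))" for x by (intro FInf.IH) auto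
  then show ?case by simp
qed

lemma tuples_upd: "e \<in> tuples N UNIV \<Longrightarrow> x \<in> unit_ball N \<Longrightarrow> e(i := x) \<in> tuples N UNIV"
  by (simp add: tuples_def)

lemma tval_in_unit_ball:
  assumes "subspace N" "e \<in> tuples N UNIV"
  shows "tval t e \<in> unit_ball N"
proof (induction t)
  case (TMid t u)
  have "norm (tval t e + tval u e) \<le> 2"
    using TMid norm_triangle_ineq [of "tval t e" "tval u e"] by (simp add: unit_ball_def)
  then show ?case using TMid assms by (simp add: unit_ball_def subspace_add subspace_scale)
qed (use assms in \<open>auto simp: unit_ball_def tuples_def subspace_0 subspace_neg\<close>)

lemma fval_bounds:
  assumes N: "subspace N"
  shows "e \<in> tuples N UNIV \<Longrightarrow> 0 \<le> fval N \<phi> e \<and> fval N \<phi> e \<le> 1"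
proof (induction \<phi> arbitrary: e)
  case (FNorm t)
  then show ?case using tval_in_unit_ball [OF N, of e t] by (simp add: unit_ball_def)
next
  case (FMinus \<phi> \<psi>)
  then have "fval N \<phi> e \<le> 1" "0 \<le> fval N \<psi> e" by blast+
  then show ?case by simp
next
  case (FSup i \<phi>)
  have IH: "0 \<le> fval N \<phi> (e(i := x)) \<and> fval N \<phi> (e(i := x)) \<le> 1" if "x \<in> unit_ball N" for x
    by (intro FSup.IH tuples_upd FSup.prems that)
  have "bdd_above ((\<lambda>x. fval N \<phi> (e(i := x))) ` unit_ball N)"
    using IH by (intro bdd_aboveI [of _ 1]) auto
  then have "fval N \<phi> (e(i := 0)) \<le> fval N (FSup i \<phi>) e"
    using zero_in_unit_ball [OF N] by (auto intro: cSUP_upper)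
  moreover have "fval N (FSup i \<phi>) e \<le> 1"
    using IH unit_ball_nonempty [OF N] by (auto intro!: cSUP_least)
  ultimately show ?case using IH [OF zero_in_unit_ball [OF N]] by linarith
next
  case (FInf i \<phi>)
  have IH: "0 \<le> fval N \<phi> (e(i := x)) \<and> fval N \<phi> (e(i := x)) \<le> 1" if "x \<in> unit_ball N" for x
    by (intro FInf.IH tuples_upd FInf.prems that)
  have "bdd_below ((\<lambda>x. fval N \<phi> (e(i := x))) ` unit_ball N)"
    using IH by (intro bdd_belowI [of _ 0]) auto
  then have "fval N (FInf i \<phi>) e \<le> fval N \<phi> (e(i := 0))"
    using zero_in_unit_ball [OF N] by (auto intro: cINF_lower)
  moreover have "0 \<le> fval N (FInf i \<phi>) e"
    using IH unit_ball_nonempty [OF N] by (auto intro!: cINF_greatest)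
  ultimately show ?case using IH [OF zero_in_unit_ball [OF N]] by linarith
next
  case (FHalf \<phi>)
  then have "0 \<le> fval N \<phi> e" "fval N \<phi> e \<le> 1" by blast+
  then show ?case by simp
qed simp

lemma fval_FSup_upper:
  assumes N: "subspace N" and e: "e \<in> tuples N UNIV" and x: "x \<in> unit_ball N"
  shows "fval N \<phi> (e(i := x)) \<le> fval N (FSup i \<phi>) e"
proof -
  have "bdd_above ((\<lambda>x. fval N \<phi> (e(i := x))) ` unit_ball N)"
    using fval_bounds [OF N tuples_upd [OF e]] by (intro bdd_aboveI [of _ 1]) auto
  then show ?thesis using x by (auto intro: cSUP_upper)
qed

lemma fval_FSup_least:
  assumes "subspace N" and "\<And>x. x \<in> unit_ball N \<Longrightarrow> fval N \<phi> (e(i := x)) \<le> c"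
  shows "fval N (FSup i \<phi>) e \<le> c"
  using assms unit_ball_nonempty by (auto intro!: cSUP_least)

text \<open>
  This reduces infima to suprema and negations, so that only suprema need their own argument in the
  inductions over formulas where the quantifier step is hard.
\<close>

lemma fval_FInf_conv_FSup:
  assumes N: "subspace N" and e: "e \<in> tuples N UNIV"
  shows "fval N (FInf i \<phi>) e = fval N (FNot (FSup i (FNot \<phi>))) e"
proof (rule antisym)
  have bdd: "bdd_below ((\<lambda>x. fval N \<phi> (e(i := x))) ` unit_ball N)"
    using fval_bounds [OF N tuples_upd [OF e]] by (intro bdd_belowI [of _ 0]) auto
  have "fval N (FSup i (FNot \<phi>)) e \<le> 1 - fval N (FInf i \<phi>) e"
    using N by (rule fval_FSup_least) (auto intro: cINF_lower [OF bdd])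
  then show "fval N (FInf i \<phi>) e \<le> fval N (FNot (FSup i (FNot \<phi>))) e" by simp
  have "fval N (FNot (FSup i (FNot \<phi>))) e \<le> fval N \<phi> (e(i := x))" if "x \<in> unit_ball N" for x
    using fval_FSup_upper [OF N e that, of "FNot \<phi>" i] by simp
  then show "fval N (FNot (FSup i (FNot \<phi>))) e \<le> fval N (FInf i \<phi>) e"
    using unit_ball_nonempty [OF N] by (simp only: fval.simps(6)) (rule cINF_greatest, auto)
qed

text \<open>
  A modulus of uniform continuity.  It lets suprema over a unit ball be computed on a dense subset.
\<close>

primrec fm_lipschitz :: "fm \<Rightarrow> real" where
  "fm_lipschitz (FNorm t) = 1"
| "fm_lipschitz (FNot \<phi>) = fm_lipschitz \<phi>"
| "fm_lipschitz (FHalf \<phi>) = fm_lipschitz \<phi>"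
| "fm_lipschitz (FMinus \<phi> \<psi>) = fm_lipschitz \<phi> + fm_lipschitz \<psi>"
| "fm_lipschitz (FSup i \<phi>) = fm_lipschitz \<phi>"
| "fm_lipschitz (FInf i \<phi>) = fm_lipschitz \<phi>"

lemma fm_lipschitz_nonneg: "0 \<le> fm_lipschitz \<phi>"
  by (induction \<phi>) auto

lemma tval_lipschitz:
  assumes "0 \<le> d" "\<And>i. norm (e i - e' i) \<le> d"
  shows "norm (tval t e - tval t e') \<le> d"
proof (induction t)
  case (TNeg t)
  then show ?case by (simp add: norm_minus_commute)
next
  case (TMid t u)
  have "norm ((tval t e - tval t e') + (tval u e - tval u e')) \<le> d + d"
    using TMid by (intro norm_triangle_le add_mono)
  moreover have "tval (TMid t u) e - tval (TMid t u) e'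
    = (1/2) *\<^sub>R ((tval t e - tval t e') + (tval u e - tval u e'))"
    by (simp add: algebra_simps)
  ultimately show ?case by simp
qed (use assms in auto)

lemma fval_lipschitz:
  assumes N: "subspace N" and d: "0 \<le> d"
  shows "e \<in> tuples N UNIV \<Longrightarrow> e' \<in> tuples N UNIV \<Longrightarrow> (\<And>i. norm (e i - e' i) \<le> d) \<Longrightarrow>
    \<bar>fval N \<phi> e - fval N \<phi> e'\<bar> \<le> fm_lipschitz \<phi> * d"
proof (induction \<phi> arbitrary: e e')
  case (FNorm t)
  have "norm (tval t e - tval t e') \<le> d" using d FNorm.prems(3) by (rule tval_lipschitz)
  then show ?case using norm_triangle_ineq3 [of "tval t e" "tval t e'"] by simp
next
  case (FNot \<phi>)
  have "\<bar>fval N \<phi> e - fval N \<phi> e'\<bar> \<le> fm_lipschitz \<phi> * d" by (intro FNot.IH FNot.prems)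
  then show ?case by (simp add: abs_minus_commute)
next
  case (FHalf \<phi>)
  have "\<bar>fval N \<phi> e - fval N \<phi> e'\<bar> \<le> fm_lipschitz \<phi> * d" by (intro FHalf.IH FHalf.prems)
  then show ?case by simp
next
  case (FMinus \<phi> \<psi>)
  have "\<bar>fval N \<phi> e - fval N \<phi> e'\<bar> \<le> fm_lipschitz \<phi> * d"
       "\<bar>fval N \<psi> e - fval N \<psi> e'\<bar> \<le> fm_lipschitz \<psi> * d"
    using FMinus.IH FMinus.prems by blast+
  then show ?case by (simp add: algebra_simps)
next
  case (FSup i \<phi>)
  have half: "fval N (FSup i \<phi>) u \<le> fval N (FSup i \<phi>) v + fm_lipschitz \<phi> * d"
    if u: "u \<in> tuples N UNIV" and v: "v \<in> tuples N UNIV" and uv: "\<And>k. norm (u k - v k) \<le> d" for u v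
  proof (rule fval_FSup_least [OF N])
    fix x assume x: "x \<in> unit_ball N"
    have "\<bar>fval N \<phi> (u(i := x)) - fval N \<phi> (v(i := x))\<bar> \<le> fm_lipschitz \<phi> * d"
      using uv d by (intro FSup.IH tuples_upd u v x) auto
    then show "fval N \<phi> (u(i := x)) \<le> fval N (FSup i \<phi>) v + fm_lipschitz \<phi> * d"
      using fval_FSup_upper [OF N v x, of \<phi> i] by linarith
  qed
  have "fval N (FSup i \<phi>) e \<le> fval N (FSup i \<phi>) e' + fm_lipschitz \<phi> * d"
    by (rule half [OF FSup.prems])
  moreover have "fval N (FSup i \<phi>) e' \<le> fval N (FSup i \<phi>) e + fm_lipschitz \<phi> * d"
    using FSup.prems by (intro half) (auto simp: norm_minus_commute)
  ultimately show ?case by (simp only: fm_lipschitz.simps)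
next
  case (FInf i \<phi>)
  have half: "fval N (FSup i (FNot \<phi>)) u \<le> fval N (FSup i (FNot \<phi>)) v + fm_lipschitz \<phi> * d"
    if u: "u \<in> tuples N UNIV" and v: "v \<in> tuples N UNIV" and uv: "\<And>k. norm (u k - v k) \<le> d" for u v
  proof (rule fval_FSup_least [OF N])
    fix x assume x: "x \<in> unit_ball N"
    have "\<bar>fval N \<phi> (u(i := x)) - fval N \<phi> (v(i := x))\<bar> \<le> fm_lipschitz \<phi> * d"
      using uv d by (intro FInf.IH tuples_upd u v x) auto
    then show "fval N (FNot \<phi>) (u(i := x)) \<le> fval N (FSup i (FNot \<phi>)) v + fm_lipschitz \<phi> * d"
      using fval_FSup_upper [OF N v x, of "FNot \<phi>" i] by simp
  qed
  have "fval N (FSup i (FNot \<phi>)) e \<le> fval N (FSup i (FNot \<phi>)) e' + fm_lipschitz \<phi> * d"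
    by (rule half [OF FInf.prems])
  moreover have "fval N (FSup i (FNot \<phi>)) e' \<le> fval N (FSup i (FNot \<phi>)) e + fm_lipschitz \<phi> * d"
    using FInf.prems by (intro half) (auto simp: norm_minus_commute)
  ultimately show ?case
    unfolding fval_FInf_conv_FSup [OF N FInf.prems(1)] fval_FInf_conv_FSup [OF N FInf.prems(2)]
    by (simp only: fm_lipschitz.simps fval.simps(2))
qed

definition linear_isometry_on ::
    "'a::real_normed_vector set \<Rightarrow> ('a \<Rightarrow> 'b::real_normed_vector) \<Rightarrow> bool" where
  "linear_isometry_on N h \<longleftrightarrow>
     (\<forall>x\<in>N. \<forall>y\<in>N. h (x + y) = h x + h y) \<and> (\<forall>c. \<forall>x\<in>N. h (c *\<^sub>R x) = c *\<^sub>R h x) \<and>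
     (\<forall>x\<in>N. norm (h x) = norm x)"

lemma linear_isometry_on_zero: "subspace N \<Longrightarrow> linear_isometry_on N h \<Longrightarrow> h 0 = 0"
  using subspace_0 [of N] unfolding linear_isometry_on_def by (metis norm_eq_zero)

lemma unit_ball_isometric_image:
  "linear_isometry_on N h \<Longrightarrow> unit_ball (h ` N) = h ` unit_ball N"
  by (auto simp: unit_ball_def linear_isometry_on_def)

lemma tval_isometric_image:
  assumes N: "subspace N" and h: "linear_isometry_on N h" and e: "e \<in> tuples N UNIV"
  shows "tval t (h \<circ> e) = h (tval t e)"
proof (induction t)
  case TZero
  then show ?case using linear_isometry_on_zero [OF N h] by simp
next
  case (TNeg t)
  have "tval t e \<in> N" using tval_in_unit_ball [OF N e, of t] by (simp add: unit_ball_def)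
  then have "h ((-1) *\<^sub>R tval t e) = (-1) *\<^sub>R h (tval t e)"
    using h unfolding linear_isometry_on_def by blast
  with TNeg show ?case by simp
next
  case (TMid t u)
  have "tval t e \<in> N" "tval u e \<in> N"
    using tval_in_unit_ball [OF N e] by (auto simp: unit_ball_def)
  with TMid h N show ?case by (simp add: linear_isometry_on_def subspace_add)
qed simp

lemma fval_isometric_image:
  assumes N: "subspace N" and h: "linear_isometry_on N h"
  shows "e \<in> tuples N UNIV \<Longrightarrow> fval (h ` N) \<phi> (h \<circ> e) = fval N \<phi> e"
proof (induction \<phi> arbitrary: e)
  case (FNorm t)
  have "tval t e \<in> N" using tval_in_unit_ball [OF N FNorm, of t] by (simp add: unit_ball_def)
  then have "norm (h (tval t e)) = norm (tval t e)" using h by (simp add: linear_isometry_on_def)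
  then show ?case by (simp only: fval.simps(1) tval_isometric_image [OF N h FNorm])
next
  case (FSup i \<phi>)
  have "fval (h ` N) \<phi> ((h \<circ> e)(i := h x)) = fval N \<phi> (e(i := x))" if "x \<in> unit_ball N" for x
    using FSup.IH [OF tuples_upd [OF FSup.prems that]] by (simp only: fun_upd_comp)
  then show ?case
    by (simp only: fval.simps unit_ball_isometric_image [OF h] image_image cong: image_cong)
next
  case (FInf i \<phi>)
  have "fval (h ` N) \<phi> ((h \<circ> e)(i := h x)) = fval N \<phi> (e(i := x))" if "x \<in> unit_ball N" for x
    using FInf.IH [OF tuples_upd [OF FInf.prems that]] by (simp only: fun_upd_comp)
  then show ?case
    by (simp only: fval.simps unit_ball_isometric_image [OF h] image_image cong: image_cong)
qed simp_all

section \<open>Ultralimits as bounded real sequences\<close>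

definition norming :: "'a::real_normed_vector \<Rightarrow> 'a \<Rightarrow> real" where
  "norming x = (SOME f. linear f \<and> (\<forall>y. \<bar>f y\<bar> \<le> norm y) \<and> f x = norm x)"

lemma linear_norming: "linear (norming x)"
  and norming_le: "\<bar>norming x y\<bar> \<le> norm y"
  and norming_self: "norming x x = norm x"
  using someI_ex [OF ex_norming_functional [of x], folded norming_def] by auto

text \<open>
  The \<open>n\<close>-th coordinate of the sequence \<open>s\<close> is the value at \<open>s\<close> of the ultraproduct of functionals norming the
  terms of \<open>S n\<close>.  In this way a separable part of an ultrapower is represented by real sequences.
\<close>

definition ultra_embed :: "(nat \<Rightarrow> nat \<Rightarrow> 'a::real_normed_vector) \<Rightarrow> (nat \<Rightarrow> 'a) \<Rightarrow> linf" where
  "ultra_embed S s = Bcontfun (\<lambda>n. ulim (\<lambda>j. norming (S n j) (s j)))"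

lemma ulim_norm_tendsto:
  fixes s :: "nat \<Rightarrow> 'a::real_normed_vector"
  assumes "\<And>j. norm (s j) \<le> B"
  shows "((\<lambda>j. norm (s j)) \<longlongrightarrow> ulim (\<lambda>j. norm (s j))) free_ultrafilter"
  using assms by (intro tendsto_ulim [of _ B]) auto

lemma ulim_norming_tendsto:
  fixes s :: "nat \<Rightarrow> 'a::real_normed_vector"
  assumes "\<And>j. norm (s j) \<le> B"
  shows "((\<lambda>j. norming (S n j) (s j)) \<longlongrightarrow> ulim (\<lambda>j. norming (S n j) (s j))) free_ultrafilter"
  using order_trans [OF norming_le assms] by (intro tendsto_ulim [of _ B])

lemma ulim_norming_le:
  fixes s :: "nat \<Rightarrow> 'a::real_normed_vector"
  assumes "\<And>j. norm (s j) \<le> B"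
  shows "\<bar>ulim (\<lambda>j. norming (S n j) (s j))\<bar> \<le> ulim (\<lambda>j. norm (s j))"
  by (rule tendsto_le [OF free_ultrafilter_nontrivial ulim_norm_tendsto
        tendsto_rabs [OF ulim_norming_tendsto]])
     (use assms in \<open>auto simp: norming_le\<close>)

lemma apply_ultra_embed:
  assumes "\<And>j. norm (s j) \<le> B"
  shows "apply_bcontfun (ultra_embed S s) n = ulim (\<lambda>j. norming (S n j) (s j))"
proof -
  have "(\<lambda>n. ulim (\<lambda>j. norming (S n j) (s j))) \<in> bcontfun"
    by (rule bcontfun_normI) (use ulim_norming_le [OF assms] in auto)
  then show ?thesis unfolding ultra_embed_def by (simp add: Bcontfun_inverse)
qed

lemma ultra_embed_add:
  assumes s: "\<And>j. norm (s j) \<le> B" and t: "\<And>j. norm (t j) \<le> C"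
  shows "ultra_embed S (\<lambda>j. s j + t j) = ultra_embed S s + ultra_embed S t"
proof (rule bcontfun_eqI)
  fix n
  have st: "\<And>j. norm (s j + t j) \<le> B + C" using s t by (meson add_mono norm_triangle_le)
  have "ulim (\<lambda>j. norming (S n j) (s j + t j))
      = ulim (\<lambda>j. norming (S n j) (s j)) + ulim (\<lambda>j. norming (S n j) (t j))"
    using tendsto_add [OF ulim_norming_tendsto [OF s] ulim_norming_tendsto [OF t]]
    by (intro ulim_eqI) (simp add: linear_add [OF linear_norming])
  then show "apply_bcontfun (ultra_embed S (\<lambda>j. s j + t j)) n
      = apply_bcontfun (ultra_embed S s + ultra_embed S t) n"
    by (simp add: apply_ultra_embed [OF s] apply_ultra_embed [OF t] apply_ultra_embed [OF st])
qed

lemma ultra_embed_scaleR: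
  assumes s: "\<And>j. norm (s j) \<le> B"
  shows "ultra_embed S (\<lambda>j. c *\<^sub>R s j) = c *\<^sub>R ultra_embed S s"
proof (rule bcontfun_eqI)
  fix n
  have cs: "\<And>j. norm (c *\<^sub>R s j) \<le> \<bar>c\<bar> * B" using s by (simp add: mult_left_mono)
  have "ulim (\<lambda>j. norming (S n j) (c *\<^sub>R s j)) = c * ulim (\<lambda>j. norming (S n j) (s j))"
    using tendsto_mult_left [OF ulim_norming_tendsto [OF s]]
    by (intro ulim_eqI) (simp add: linear_cmul [OF linear_norming])
  then show "apply_bcontfun (ultra_embed S (\<lambda>j. c *\<^sub>R s j)) n
      = apply_bcontfun (c *\<^sub>R ultra_embed S s) n"
    by (simp add: apply_ultra_embed [OF s] apply_ultra_embed [OF cs])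
qed

lemma norm_ultra_embed_le:
  assumes s: "\<And>j. norm (s j) \<le> B"
  shows "norm (ultra_embed S s) \<le> ulim (\<lambda>j. norm (s j))"
  using ulim_norming_le [OF s] by (intro norm_bound) (simp add: apply_ultra_embed [OF s])

lemma ultra_embed_diff:
  assumes s: "\<And>j. norm (s j) \<le> B" and t: "\<And>j. norm (t j) \<le> C"
  shows "ultra_embed S (\<lambda>j. s j - t j) = ultra_embed S s - ultra_embed S t"
  using ultra_embed_add [of s B "\<lambda>j. (-1) *\<^sub>R t j" C S] ultra_embed_scaleR [of t C S "-1"] s t by simp

text \<open>A functional that norms \<open>S n j\<close> almost norms every vector close to \<open>S n j\<close>.\<close>

lemma norm_ultra_embed:
  assumes s: "\<And>j. norm (s j) \<le> B" and appr: "\<And>\<eta>. \<eta> > 0 \<Longrightarrow> \<exists>n. \<forall>j. norm (S n j - s j) \<le> \<eta>"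
  shows "norm (ultra_embed S s) = ulim (\<lambda>j. norm (s j))"
proof (rule antisym)
  show "norm (ultra_embed S s) \<le> ulim (\<lambda>j. norm (s j))" by (rule norm_ultra_embed_le [OF s])
  have *: "ulim (\<lambda>j. norm (s j)) \<le> norm (ultra_embed S s) + 2 * \<eta>" if "\<eta> > 0" for \<eta>
  proof -
    have "\<exists>n. \<forall>j. norm (S n j - s j) \<le> \<eta>" using that by (rule appr)
    then obtain n where n: "\<And>j. norm (S n j - s j) \<le> \<eta>" by blast
    have "norm (s j) - 2 * \<eta> \<le> norming (S n j) (s j)" for j
    proof -
      have "norming (S n j) (s j) = norm (S n j) - norming (S n j) (S n j - s j)"
        by (simp add: linear_diff [OF linear_norming] norming_self)
      also have "\<dots> \<ge> norm (S n j) - norm (S n j - s j)"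
        using norming_le [of "S n j" "S n j - s j"] by linarith
      finally show ?thesis
        using n [of j] norm_triangle_ineq3 [of "S n j" "s j"] by linarith
    qed
    then have "ulim (\<lambda>j. norm (s j)) - 2 * \<eta> \<le> ulim (\<lambda>j. norming (S n j) (s j))"
      by (intro tendsto_le [OF free_ultrafilter_nontrivial ulim_norming_tendsto [OF s]
            tendsto_diff [OF ulim_norm_tendsto [OF s] tendsto_const]]) auto
    also have "\<dots> \<le> norm (ultra_embed S s)"
      using norm_bounded [of "ultra_embed S s" n] by (simp add: apply_ultra_embed [OF s])
    finally show ?thesis by simp
  qed
  show "ulim (\<lambda>j. norm (s j)) \<le> norm (ultra_embed S s)"
  proof (rule field_le_epsilon)
    fix e :: real assume "0 < e"
    with *[of "e/2"] show "ulim (\<lambda>j. norm (s j)) \<le> norm (ultra_embed S s) + e" by simp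
  qed
qed

text \<open>
  For constant sequences the ultralimits are trivial and \<open>ultra_embed\<close> is the classical embedding by
  functionals that norm the points of a countable dense set.
\<close>

lemma ex_isometric_copy_in_linf:
  fixes M :: "'a::real_normed_vector set"
  assumes M: "banach_subspace M" and sep: "separable_set M"
  shows "\<exists>h::'a \<Rightarrow> linf. linear_isometry_on M h \<and> banach_subspace (h ` M) \<and> separable_set (h ` M)"
proof -
  have sub: "subspace M" and cpl: "complete M" using M by (auto simp: banach_subspace_def)
  obtain D where D: "countable D" "D \<subseteq> M" "M \<subseteq> closure D"
    using sep by (auto simp: separable_set_def)
  have "D \<noteq> {}" using D(3) subspace_0 [OF sub] by auto
  define S where "S n (j::nat) = from_nat_into D n" for n j
  define h where "h x = ultra_embed S (\<lambda>_. x)" for x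
  have nrm: "norm (h x) = norm x" if "x \<in> M" for x
  proof -
    have "\<exists>n. \<forall>j. norm (S n j - x) \<le> \<eta>" if "\<eta> > 0" for \<eta>
    proof -
      have "x \<in> closure D" using D(3) \<open>x \<in> M\<close> by blast
      then obtain d where "d \<in> D" "dist d x < \<eta>" using \<open>\<eta> > 0\<close> by (auto simp: closure_approachable)
      moreover obtain n where "from_nat_into D n = d"
        using from_nat_into_surj [OF D(1) \<open>d \<in> D\<close>] by blast
      ultimately have "\<forall>j. norm (S n j - x) \<le> \<eta>" by (simp add: S_def dist_norm)
      then show ?thesis ..
    qed
    then show ?thesis unfolding h_def using norm_ultra_embed [of "\<lambda>_. x" "norm x" S] by simp
  qed
  have add: "h (x + y) = h x + h y" for x y
    unfolding h_def using ultra_embed_add [of "\<lambda>_. x" "norm x" "\<lambda>_. y" "norm y" S] by simp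
  have scl: "h (c *\<^sub>R x) = c *\<^sub>R h x" for c x
    unfolding h_def using ultra_embed_scaleR [of "\<lambda>_. x" "norm x" S c] by simp
  have iso: "linear_isometry_on M h" using nrm add scl by (simp add: linear_isometry_on_def)
  have lin: "linear h" using add scl by (intro linearI) auto
  have dst: "dist (h x) (h y) = dist x y" if "x \<in> M" "y \<in> M" for x y
    using nrm [of "x - y"] that sub by (simp add: dist_norm linear_diff [OF lin] subspace_diff)
  have "complete (h ` M)"
  proof (rule completeI)
    fix f :: "nat \<Rightarrow> linf" assume f: "\<forall>n. f n \<in> h ` M" "Cauchy f"
    then obtain g where g: "\<And>n. g n \<in> M" "\<And>n. f n = h (g n)" by (simp add: image_iff) metis
    have "Cauchy g" using f(2) g dst by (simp add: Cauchy_def)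
    then obtain l where l: "l \<in> M" "g \<longlonglongrightarrow> l" using cpl g(1) by (auto simp: complete_def)
    have "f \<longlonglongrightarrow> h l"
      using l(2) unfolding tendsto_dist_iff [of f] tendsto_dist_iff [of g] by (simp add: g dst l(1))
    with l(1) show "\<exists>l\<in>h ` M. f \<longlonglongrightarrow> l" by blast
  qed
  moreover have "subspace (h ` M)" using lin sub by (rule linear_subspace_image)
  moreover have "separable_set (h ` M)"
    unfolding separable_set_def
  proof (intro exI conjI)
    show "countable (h ` D)" "h ` D \<subseteq> h ` M" using D by auto
    show "h ` M \<subseteq> closure (h ` D)"
    proof
      fix y assume "y \<in> h ` M"
      then obtain x where x: "x \<in> M" "y = h x" by blast
      show "y \<in> closure (h ` D)"
        unfolding closure_approachable
      proof (intro allI impI)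
        fix r :: real assume "0 < r"
        then obtain d where d: "d \<in> D" "dist d x < r"
          using x(1) D(3) by (meson closure_approachable subsetD)
        moreover have "d \<in> M" using d(1) D(2) by blast
        ultimately have "dist (h d) y < r" using dst x by simp
        with d(1) show "\<exists>z\<in>h ` D. dist z y < r" by blast
      qed
    qed
  qed
  ultimately show ?thesis using iso by (auto simp: banach_subspace_def)
qed

section \<open>Compactness\<close>

instance bterm :: countable by countable_datatype
instance fm :: countable by countable_datatype

text \<open>
  Names for the sequences in the hull.  Being terms of a datatype, they are countable.  \<open>SBase\<close> stands for
  the given sequences, \<open>SAdd\<close> and \<open>SScale\<close> make the closure a subspace, \<open>SNorm\<close> retracts a sequence
  to the unit ball, and \<open>SWit\<close> chooses values at which a formula almost attains its supremum.
\<close>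

datatype sterm =
    SBase nat
  | SAdd sterm sterm
  | SScale rat sterm
  | SNorm sterm
  | SWit fm nat "sterm list"

instance sterm :: countable by countable_datatype

definition clip :: "'a::real_normed_vector \<Rightarrow> 'a" where
  "clip x = (1 / max 1 (norm x)) *\<^sub>R x"

lemma norm_clip: "norm (clip x) \<le> 1"
  by (simp add: clip_def field_simps)

lemma clip_id: "norm x \<le> 1 \<Longrightarrow> clip x = x"
  by (simp add: clip_def max_def)

lemma norm_clip_diff: "norm (clip x - x) = max 0 (norm x - 1)"
proof (cases "norm x \<le> 1")
  case True
  then show ?thesis by (simp add: clip_id)
next
  case False
  then have "clip x - x = (1 / norm x - 1) *\<^sub>R x" by (simp add: clip_def max_def algebra_simps)
  then have "norm (clip x - x) = \<bar>1 / norm x - 1\<bar> * norm x" by simp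
  also have "1 / norm x \<le> 1" using False by (simp add: divide_le_eq_1)
  then have "\<bar>1 / norm x - 1\<bar> = 1 - 1 / norm x" by linarith
  also have "(1 - 1 / norm x) * norm x = norm x - 1" using False by (auto simp: left_diff_distrib)
  finally show ?thesis using False by simp
qed

lemma clip_in_unit_ball: "subspace M \<Longrightarrow> x \<in> M \<Longrightarrow> clip x \<in> unit_ball M"
  using norm_clip [of x] by (simp add: unit_ball_def) (simp add: clip_def subspace_scale)

definition list_env :: "'a::zero list \<Rightarrow> nat \<Rightarrow> 'a" where
  "list_env xs k = (if k < length xs then xs ! k else 0)"

text \<open>The \<open>j\<close>-th witness is allowed an error of \<open>1/(j + 1)\<close>, which vanishes in the limit.\<close>

definition sup_witness ::
    "'a::real_normed_vector set \<Rightarrow> fm \<Rightarrow> nat \<Rightarrow> (nat \<Rightarrow> 'a) \<Rightarrow> nat \<Rightarrow> 'a" where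
  "sup_witness M \<phi> i e j =
     (SOME w. w \<in> unit_ball M \<and> fval M (FSup i \<phi>) e - 1 / (real j + 1) \<le> fval M \<phi> (e(i := w)))"

lemma sup_witness:
  assumes M: "subspace M"
  shows "sup_witness M \<phi> i e j \<in> unit_ball M"
    and "fval M (FSup i \<phi>) e - 1 / (real j + 1) \<le> fval M \<phi> (e(i := sup_witness M \<phi> i e j))"
proof -
  have "\<exists>w. w \<in> unit_ball M \<and> fval M (FSup i \<phi>) e - 1 / (real j + 1) \<le> fval M \<phi> (e(i := w))"
  proof (rule ccontr)
    assume "\<nexists>w. w \<in> unit_ball M \<and> fval M (FSup i \<phi>) e - 1 / (real j + 1) \<le> fval M \<phi> (e(i := w))"
    then have "fval M \<phi> (e(i := w)) \<le> fval M (FSup i \<phi>) e - 1 / (real j + 1)" if "w \<in> unit_ball M" for w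
      using that by (meson linear)
    then have "fval M (FSup i \<phi>) e \<le> fval M (FSup i \<phi>) e - 1 / (real j + 1)"
      by (intro fval_FSup_least [OF M])
    then show False by (simp add: field_simps)
  qed
  from someI_ex [OF this, folded sup_witness_def]
  show "sup_witness M \<phi> i e j \<in> unit_ball M"
    and "fval M (FSup i \<phi>) e - 1 / (real j + 1) \<le> fval M \<phi> (e(i := sup_witness M \<phi> i e j))"
    by blast+
qed

primrec seval :: "'a::real_normed_vector set \<Rightarrow> (nat \<Rightarrow> nat \<Rightarrow> 'a) \<Rightarrow> sterm \<Rightarrow> nat \<Rightarrow> 'a" where
  "seval M b (SBase i) = b i"
| "seval M b (SAdd s t) = (\<lambda>j. seval M b s j + seval M b t j)"
| "seval M b (SScale q s) = (\<lambda>j. real_of_rat q *\<^sub>R seval M b s j)"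
| "seval M b (SNorm s) = (\<lambda>j. clip (seval M b s j))"
| "seval M b (SWit \<phi> i ts) =
     (\<lambda>j. sup_witness M \<phi> i (list_env (map (\<lambda>s. s j) (map (seval M b) ts))) j)"

lemma ex_rat_close:
  fixes c :: real assumes "\<eta> > 0" shows "\<exists>q. \<bar>real_of_rat q - c\<bar> < \<eta>"
proof -
  obtain q where "c - \<eta> < real_of_rat q" "real_of_rat q < c + \<eta>"
    using of_rat_dense [of "c - \<eta>" "c + \<eta>"] assms by auto
  then have "\<bar>real_of_rat q - c\<bar> < \<eta>" by (simp add: abs_less_iff)
  then show ?thesis ..
qed

locale hull =
  fixes M :: "'a::real_normed_vector set" and b :: "nat \<Rightarrow> nat \<Rightarrow> 'a"
  assumes M: "subspace M" and b: "\<And>i j. b i j \<in> unit_ball M"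
begin

lemma seval_in: "seval M b t j \<in> M"
proof (induction t)
  case (SBase i)
  then show ?case using b by (simp add: unit_ball_def)
next
  case (SNorm t)
  then show ?case by (simp add: clip_def M subspace_scale)
next
  case (SWit \<phi> i ts)
  then show ?case using sup_witness(1) [OF M] by (simp add: unit_ball_def)
qed (simp_all add: M subspace_add subspace_scale)

lemma seval_bounded: "\<exists>B. \<forall>j. norm (seval M b t j) \<le> B"
proof (induction t)
  case (SBase i)
  have "\<forall>j. norm (seval M b (SBase i) j) \<le> 1" using b by (simp add: unit_ball_def)
  then show ?case ..
next
  case (SAdd s t)
  then obtain B C where "\<And>j. norm (seval M b s j) \<le> B" "\<And>j. norm (seval M b t j) \<le> C" by auto
  then have "norm (seval M b (SAdd s t) j) \<le> B + C" for j
    by (simp add: norm_triangle_le add_mono)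
  then show ?case by blast
next
  case (SScale q t)
  then obtain B where "\<And>j. norm (seval M b t j) \<le> B" by auto
  then have "norm (seval M b (SScale q t) j) \<le> \<bar>real_of_rat q\<bar> * B" for j
    by (simp add: mult_left_mono)
  then show ?case by blast
next
  case (SNorm t)
  then show ?case using norm_clip by auto
next
  case (SWit \<phi> i ts)
  have "\<forall>j. norm (seval M b (SWit \<phi> i ts) j) \<le> 1"
    using sup_witness(1) [OF M] by (simp add: unit_ball_def)
  then show ?case ..
qed

definition hull_embed :: "(nat \<Rightarrow> 'a) \<Rightarrow> linf" where
  "hull_embed = ultra_embed (\<lambda>n. seval M b (from_nat n))"

definition hull_space :: "linf set" where
  "hull_space = closure (range (\<lambda>t. hull_embed (seval M b t)))"

lemma norm_hull_embed: "norm (hull_embed (seval M b t)) = ulim (\<lambda>j. norm (seval M b t j))"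
proof -
  obtain B where B: "\<And>j. norm (seval M b t j) \<le> B" using seval_bounded by blast
  show ?thesis unfolding hull_embed_def
  proof (rule norm_ultra_embed [OF B])
    fix \<eta> :: real assume "\<eta> > 0"
    then have "\<forall>j. norm (seval M b (from_nat (to_nat t)) j - seval M b t j) \<le> \<eta>" by simp
    then show "\<exists>n. \<forall>j. norm (seval M b (from_nat n) j - seval M b t j) \<le> \<eta>" ..
  qed
qed

lemma hull_embed_SAdd:
  "hull_embed (seval M b (SAdd s t)) = hull_embed (seval M b s) + hull_embed (seval M b t)"
proof -
  obtain B where "\<And>j. norm (seval M b s j) \<le> B" using seval_bounded by blast
  moreover obtain C where "\<And>j. norm (seval M b t j) \<le> C" using seval_bounded by blast
  ultimately show ?thesis unfolding hull_embed_def seval.simps by (rule ultra_embed_add)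
qed

lemma hull_embed_SScale:
  "hull_embed (seval M b (SScale q t)) = real_of_rat q *\<^sub>R hull_embed (seval M b t)"
proof -
  obtain B where "\<And>j. norm (seval M b t j) \<le> B" using seval_bounded by blast
  then show ?thesis unfolding hull_embed_def seval.simps by (rule ultra_embed_scaleR)
qed

lemma hull_embed_in: "hull_embed (seval M b t) \<in> hull_space"
  unfolding hull_space_def by (rule subsetD [OF closure_subset]) (rule rangeI)

lemma hull_approx:
  assumes "y \<in> hull_space" "\<eta> > 0"
  shows "\<exists>t. norm (hull_embed (seval M b t) - y) < \<eta>"
  using assms unfolding hull_space_def closure_approachable by (simp add: dist_norm)

lemma subspace_hull_space: "subspace hull_space"
  unfolding subspace_def
proof (intro conjI ballI allI)
  show "0 \<in> hull_space"
    using hull_embed_in [of "SScale 0 (SBase 0)"] by (simp only: hull_embed_SScale) simp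
  show "x + y \<in> hull_space" if xy: "x \<in> hull_space" "y \<in> hull_space" for x y
    unfolding hull_space_def closure_approachable
  proof (intro allI impI)
    fix e :: real assume "0 < e"
    then have e: "e / 2 > 0" by simp
    obtain s where s: "norm (hull_embed (seval M b s) - x) < e/2" using hull_approx [OF xy(1) e] by blast
    obtain t where t: "norm (hull_embed (seval M b t) - y) < e/2" using hull_approx [OF xy(2) e] by blast
    have "norm ((hull_embed (seval M b s) - x) + (hull_embed (seval M b t) - y)) < e/2 + e/2"
      using s t by (rule norm_add_less)
    then have "dist (hull_embed (seval M b (SAdd s t))) (x + y) < e"
      by (simp only: hull_embed_SAdd dist_norm) (simp add: algebra_simps)
    then show "\<exists>z\<in>range (\<lambda>t. hull_embed (seval M b t)). dist z (x + y) < e" by blast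
  qed
  show "c *\<^sub>R x \<in> hull_space" if x: "x \<in> hull_space" for c x
    unfolding hull_space_def closure_approachable
  proof (intro allI impI)
    fix e :: real assume e: "0 < e"
    obtain q where q: "\<bar>real_of_rat q - c\<bar> < e / 2 / (norm x + 1)"
      using ex_rat_close [of "e / 2 / (norm x + 1)" c] e by (auto simp: add_nonneg_pos)
    have e': "e / 2 / (\<bar>real_of_rat q\<bar> + 1) > 0" using e by (simp add: add_nonneg_pos)
    obtain t where t: "norm (hull_embed (seval M b t) - x) < e / 2 / (\<bar>real_of_rat q\<bar> + 1)"
      using hull_approx [OF x e'] by blast
    have "\<bar>real_of_rat q - c\<bar> * norm x \<le> \<bar>real_of_rat q - c\<bar> * (norm x + 1)"
      by (intro mult_left_mono) auto
    also have "\<dots> < e/2 / (norm x + 1) * (norm x + 1)"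
      using q by (intro mult_strict_right_mono) (auto simp: add_nonneg_pos)
    also have "\<dots> = e/2"
    proof (rule nonzero_divide_eq_eq [THEN iffD1, OF _ refl, symmetric])
      show "norm x + 1 \<noteq> 0" using norm_ge_zero [of x] by linarith
    qed
    finally have 1: "norm ((real_of_rat q - c) *\<^sub>R x) < e / 2" by simp
    have "\<bar>real_of_rat q\<bar> * norm (hull_embed (seval M b t) - x)
        \<le> (\<bar>real_of_rat q\<bar> + 1) * norm (hull_embed (seval M b t) - x)"
      by (intro mult_right_mono) auto
    also have "\<dots> < e/2"
    proof -
      have "0 < \<bar>real_of_rat q\<bar> + 1" by linarith
      with t show ?thesis by (simp only: pos_less_divide_eq mult.commute)
    qed
    finally have 2: "norm (real_of_rat q *\<^sub>R (hull_embed (seval M b t) - x)) < e / 2" by simp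
    have "norm (real_of_rat q *\<^sub>R (hull_embed (seval M b t) - x) + (real_of_rat q - c) *\<^sub>R x) < e/2 + e/2"
      using 2 1 by (rule norm_add_less)
    then have "dist (hull_embed (seval M b (SScale q t))) (c *\<^sub>R x) < e"
      by (simp only: hull_embed_SScale dist_norm) (simp add: algebra_simps)
    then show "\<exists>z\<in>range (\<lambda>t. hull_embed (seval M b t)). dist z (c *\<^sub>R x) < e" by blast
  qed
qed

lemma complete_linf:
  fixes N :: "linf set"
  assumes "closed N"
  shows "complete N"
proof (rule completeI)
  fix f :: "nat \<Rightarrow> linf" assume f: "\<forall>n. f n \<in> N" "Cauchy f"
  then obtain g where "uniform_limit UNIV f g sequentially"
    using uniformly_convergent_eq_cauchy [of "\<lambda>_. True" f]
    unfolding Cauchy_def uniform_limit_sequentially_iff by (metis dist_fun_lt_imp_dist_val_lt)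
  from uniform_limit_bcontfunE [OF this sequentially_bot]
  obtain l where "f \<longlonglongrightarrow> l" by metis
  then show "\<exists>l\<in>N. f \<longlonglongrightarrow> l" using f(1) assms closed_sequentially by blast
qed

lemma banach_hull_space: "banach_subspace hull_space"
proof -
  have "closed hull_space" by (simp add: hull_space_def)
  then show ?thesis using subspace_hull_space by (simp add: banach_subspace_def complete_linf)
qed

lemma separable_hull_space: "separable_set hull_space"
  unfolding separable_set_def hull_space_def
  by (intro exI [of _ "range (\<lambda>t. hull_embed (seval M b t))"]) (simp add: closure_subset)

text \<open>
  If a term approximates \<open>y\<close>, its values have norm at most \<open>1 + \<eta>\<close> in the ultralimit, and retracting each of them to
  the unit ball moves the limit by at most \<open>\<eta>\<close>.
\<close>

lemma hull_ball_approx: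
  assumes y: "y \<in> unit_ball hull_space" and \<eta>: "\<eta> > 0"
  obtains t where "\<And>j. norm (seval M b t j) \<le> 1" "norm (hull_embed (seval M b t) - y) \<le> \<eta>"
proof -
  have "\<eta> / 2 > 0" "y \<in> hull_space" using y \<eta> by (auto simp: unit_ball_def)
  then obtain t where t: "norm (hull_embed (seval M b t) - y) < \<eta> / 2" using hull_approx by blast
  obtain B where B: "\<And>j. norm (seval M b t j) \<le> B" using seval_bounded by blast
  have B': "\<And>j. norm (seval M b (SNorm t) j - seval M b t j) \<le> max 0 (B - 1)"
    using B by (simp add: norm_clip_diff) (meson diff_right_mono max.coboundedI2)
  have "((\<lambda>j. norm (seval M b (SNorm t) j - seval M b t j)) \<longlongrightarrow>
      max 0 (ulim (\<lambda>j. norm (seval M b t j)) - 1)) free_ultrafilter"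
    unfolding seval.simps norm_clip_diff
    by (intro tendsto_max tendsto_diff tendsto_const ulim_norm_tendsto [OF B])
  then have lim: "ulim (\<lambda>j. norm (seval M b (SNorm t) j - seval M b t j))
      = max 0 (norm (hull_embed (seval M b t)) - 1)"
    unfolding norm_hull_embed by (rule ulim_eqI)
  have "norm (hull_embed (seval M b (SNorm t)) - hull_embed (seval M b t))
      = norm (hull_embed (\<lambda>j. seval M b (SNorm t) j - seval M b t j))"
    unfolding hull_embed_def using norm_clip by (subst ultra_embed_diff [OF _ B]) auto
  also have "\<dots> \<le> max 0 (norm (hull_embed (seval M b t)) - 1)"
    unfolding lim [symmetric] unfolding hull_embed_def by (rule norm_ultra_embed_le [OF B'])
  also have "norm (hull_embed (seval M b t)) \<le> norm y + \<eta> / 2"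
    using t norm_triangle_ineq2 [of "hull_embed (seval M b t)" y] by linarith
  then have "max 0 (norm (hull_embed (seval M b t)) - 1) \<le> \<eta> / 2"
    using y \<eta> by (intro max.boundedI) (auto simp: unit_ball_def)
  finally have "norm (hull_embed (seval M b (SNorm t)) - hull_embed (seval M b t)) \<le> \<eta> / 2" .
  with t have "norm ((hull_embed (seval M b (SNorm t)) - hull_embed (seval M b t))
      + (hull_embed (seval M b t) - y)) \<le> \<eta>"
    by (intro norm_triangle_le) simp
  then show thesis using norm_clip by (intro that [of "SNorm t"]) auto
qed

lemma seval_ball_env: "(\<And>i. norm (seval M b (e i) j) \<le> 1) \<Longrightarrow> (\<lambda>i. seval M b (e i) j) \<in> tuples M UNIV"
  by (simp add: tuples_def unit_ball_def seval_in)

lemma hull_embed_ball_env: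
  assumes "\<And>i j. norm (seval M b (e i) j) \<le> 1"
  shows "(\<lambda>i. hull_embed (seval M b (e i))) \<in> tuples hull_space UNIV"
proof -
  have "ulim (\<lambda>j. norm (seval M b (e i) j)) \<le> 1" for i
    by (rule tendsto_le [OF free_ultrafilter_nontrivial tendsto_const ulim_norm_tendsto]) (use assms in auto)
  then show ?thesis by (simp add: tuples_def unit_ball_def hull_embed_in norm_hull_embed)
qed

lemma fval_ulim_tendsto:
  assumes "\<And>i j. norm (seval M b (e i) j) \<le> 1"
  shows "((\<lambda>j. fval M \<phi> (\<lambda>i. seval M b (e i) j)) \<longlongrightarrow> ulim (\<lambda>j. fval M \<phi> (\<lambda>i. seval M b (e i) j)))
    free_ultrafilter"
proof (rule tendsto_ulim)
  show "\<bar>fval M \<phi> (\<lambda>i. seval M b (e i) j)\<bar> \<le> 1" for j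
    using fval_bounds [OF M seval_ball_env, of e j \<phi>] assms by auto
qed

lemma tval_hull:
  assumes "\<And>i j. norm (seval M b (e i) j) \<le> 1"
  shows "\<exists>s. (\<forall>j. seval M b s j = tval t (\<lambda>i. seval M b (e i) j)) \<and>
    hull_embed (seval M b s) = tval t (\<lambda>i. hull_embed (seval M b (e i)))"
proof (induction t)
  case (TVar i)
  show ?case by (intro exI [of _ "e i"]) simp
next
  case TZero
  show ?case
    by (intro exI [of _ "SScale 0 (SBase 0)"]) (simp only: hull_embed_SScale, simp)
next
  case (TNeg t)
  then obtain s where "\<forall>j. seval M b s j = tval t (\<lambda>i. seval M b (e i) j)"
    "hull_embed (seval M b s) = tval t (\<lambda>i. hull_embed (seval M b (e i)))" by blast
  then show ?case
    by (intro exI [of _ "SScale (-1) s"]) (simp only: hull_embed_SScale, simp add: of_rat_minus)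
next
  case (TMid t u)
  then obtain s r where "\<forall>j. seval M b s j = tval t (\<lambda>i. seval M b (e i) j)"
    "hull_embed (seval M b s) = tval t (\<lambda>i. hull_embed (seval M b (e i)))"
    "\<forall>j. seval M b r j = tval u (\<lambda>i. seval M b (e i) j)"
    "hull_embed (seval M b r) = tval u (\<lambda>i. hull_embed (seval M b (e i)))" by blast
  then show ?case
    by (intro exI [of _ "SScale (1/2) (SAdd s r)"])
       (simp only: hull_embed_SScale hull_embed_SAdd, simp add: of_rat_divide)
qed

text \<open>
  The witnesses in the hull give one inequality.  The other one holds because the unit ball of the hull is
  approximated by terms which lie in the unit ball at every index.
\<close>

lemma los_FSup:
  assumes IH: "\<And>e. (\<And>i j. norm (seval M b (e i) j) \<le> 1) \<Longrightarrow>
      fval hull_space \<phi> (\<lambda>i. hull_embed (seval M b (e i))) = ulim (\<lambda>j. fval M \<phi> (\<lambda>i. seval M b (e i) j))"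
    and e: "\<And>i j. norm (seval M b (e i) j) \<le> 1"
  shows "fval hull_space (FSup k \<phi>) (\<lambda>i. hull_embed (seval M b (e i)))
    = ulim (\<lambda>j. fval M (FSup k \<phi>) (\<lambda>i. seval M b (e i) j))"
proof (rule antisym)
  let ?E = "\<lambda>i. hull_embed (seval M b (e i))"
  have upd: "(\<lambda>i. hull_embed (seval M b ((e(k := t)) i))) = ?E(k := hull_embed (seval M b t))"
    "(\<lambda>i. seval M b ((e(k := t)) i) j) = (\<lambda>i. seval M b (e i) j)(k := seval M b t j)" for t j
    by auto
  show "fval hull_space (FSup k \<phi>) ?E \<le> ulim (\<lambda>j. fval M (FSup k \<phi>) (\<lambda>i. seval M b (e i) j))"
  proof (rule fval_FSup_least [OF subspace_hull_space], rule field_le_epsilon)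
    fix y and \<epsilon> :: real assume y: "y \<in> unit_ball hull_space" and "\<epsilon> > 0"
    define \<eta> where "\<eta> = \<epsilon> / (fm_lipschitz \<phi> + 1)"
    have \<eta>: "\<eta> > 0" "fm_lipschitz \<phi> * \<eta> \<le> \<epsilon>"
      using \<open>\<epsilon> > 0\<close> fm_lipschitz_nonneg [of \<phi>] by (auto simp: \<eta>_def field_simps add_nonneg_pos)
    obtain t where t: "\<And>j. norm (seval M b t j) \<le> 1" "norm (hull_embed (seval M b t) - y) \<le> \<eta>"
      using hull_ball_approx [OF y \<eta>(1)] by blast
    have et: "norm (seval M b ((e(k := t)) i) j) \<le> 1" for i j using e t(1) by simp
    have tb: "hull_embed (seval M b t) \<in> unit_ball hull_space"
      using hull_embed_ball_env [of "\<lambda>_. t"] t(1) by (simp add: tuples_def)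
    have "\<bar>fval hull_space \<phi> (?E(k := hull_embed (seval M b t))) - fval hull_space \<phi> (?E(k := y))\<bar>
        \<le> fm_lipschitz \<phi> * \<eta>"
      using \<eta>(1) t(2)
      by (intro fval_lipschitz [OF subspace_hull_space] tuples_upd hull_embed_ball_env e tb y) auto
    then have "fval hull_space \<phi> (?E(k := y)) \<le> fval hull_space \<phi> (?E(k := hull_embed (seval M b t))) + \<epsilon>"
      using \<eta>(2) by linarith
    also have "fval hull_space \<phi> (?E(k := hull_embed (seval M b t)))
        = ulim (\<lambda>j. fval M \<phi> (\<lambda>i. seval M b ((e(k := t)) i) j))"
      using IH [of "e(k := t)", OF et] by (simp only: upd)
    also have "\<dots> \<le> ulim (\<lambda>j. fval M (FSup k \<phi>) (\<lambda>i. seval M b (e i) j))"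
    proof (rule tendsto_le [OF free_ultrafilter_nontrivial fval_ulim_tendsto [of e, OF e]
          fval_ulim_tendsto [of "e(k := t)", OF et]], rule always_eventually, rule allI)
      fix j
      have "seval M b t j \<in> unit_ball M" by (simp add: unit_ball_def seval_in t(1))
      then show "fval M \<phi> (\<lambda>i. seval M b ((e(k := t)) i) j) \<le> fval M (FSup k \<phi>) (\<lambda>i. seval M b (e i) j)"
        unfolding upd by (intro fval_FSup_upper [OF M] seval_ball_env e)
    qed
    finally show "fval hull_space \<phi> (?E(k := y)) \<le> ulim (\<lambda>j. fval M (FSup k \<phi>) (\<lambda>i. seval M b (e i) j)) + \<epsilon>"
      by (simp only: add_right_mono)
  qed
next
  let ?E = "\<lambda>i. hull_embed (seval M b (e i))"
  have upd: "(\<lambda>i. hull_embed (seval M b ((e(k := t)) i))) = ?E(k := hull_embed (seval M b t))"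
    "(\<lambda>i. seval M b ((e(k := t)) i) j) = (\<lambda>i. seval M b (e i) j)(k := seval M b t j)" for t j
    by auto
  have "finite (fvars \<phi>)"
  proof (induction \<phi>)
    case (FNorm t) then show ?case by (induction t) auto
  qed auto
  then obtain K where K: "\<And>i. i \<in> fvars \<phi> \<Longrightarrow> i < K"
    by (auto simp: finite_nat_set_iff_bounded)
  define t where "t = SWit \<phi> k (map e [0..<K])"
  have env: "list_env (map (\<lambda>s. s j) (map (seval M b) (map e [0..<K]))) i = seval M b (e i) j"
    if "i < K" for i j using that by (simp add: list_env_def)
  have tb: "seval M b t j \<in> unit_ball M" for j
    unfolding t_def seval.simps by (rule sup_witness(1) [OF M])
  then have et: "norm (seval M b ((e(k := t)) i) j) \<le> 1" for i j using e by (simp add: unit_ball_def)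
  have wit: "fval M (FSup k \<phi>) (\<lambda>i. seval M b (e i) j) - 1 / (real j + 1)
      \<le> fval M \<phi> (\<lambda>i. seval M b ((e(k := t)) i) j)" for j
  proof -
    let ?l = "list_env (map (\<lambda>s. s j) (map (seval M b) (map e [0..<K])))"
    have "fval M (FSup k \<phi>) (\<lambda>i. seval M b (e i) j) = fval M (FSup k \<phi>) ?l"
      using K by (intro fval_cong) (simp add: env del: map_map)
    also have "\<dots> - 1 / (real j + 1) \<le> fval M \<phi> (?l(k := seval M b t j))"
      unfolding t_def seval.simps by (rule sup_witness(2) [OF M])
    also have "\<dots> = fval M \<phi> (\<lambda>i. seval M b ((e(k := t)) i) j)"
      unfolding upd using K by (intro fval_cong) (simp add: env del: map_map)
    finally show ?thesis by simp
  qed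
  have "((\<lambda>j. fval M (FSup k \<phi>) (\<lambda>i. seval M b (e i) j) - 1 / (real j + 1)) \<longlongrightarrow>
      ulim (\<lambda>j. fval M (FSup k \<phi>) (\<lambda>i. seval M b (e i) j)) - 0) free_ultrafilter"
    by (intro tendsto_diff fval_ulim_tendsto e tendsto_ultra)
       (use LIMSEQ_inverse_real_of_nat in \<open>simp add: inverse_eq_divide add.commute\<close>)
  then have "ulim (\<lambda>j. fval M (FSup k \<phi>) (\<lambda>i. seval M b (e i) j)) - 0
      \<le> ulim (\<lambda>j. fval M \<phi> (\<lambda>i. seval M b ((e(k := t)) i) j))"
    by (rule tendsto_le [OF free_ultrafilter_nontrivial fval_ulim_tendsto [of "e(k := t)", OF et]]) (simp only: wit eventually_True)
  also have "\<dots> = fval hull_space \<phi> (?E(k := hull_embed (seval M b t)))"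
    using IH [of "e(k := t)", OF et] by (simp only: upd)
  also have "\<dots> \<le> fval hull_space (FSup k \<phi>) ?E"
  proof (intro fval_FSup_upper [OF subspace_hull_space] hull_embed_ball_env e)
    show "hull_embed (seval M b t) \<in> unit_ball hull_space"
      using hull_embed_ball_env [of "\<lambda>_. t"] tb by (simp add: tuples_def unit_ball_def)
  qed
  finally show "ulim (\<lambda>j. fval M (FSup k \<phi>) (\<lambda>i. seval M b (e i) j)) \<le> fval hull_space (FSup k \<phi>) ?E"
    by simp
qed

lemma los_FNot:
  assumes IH: "\<And>e. (\<And>i j. norm (seval M b (e i) j) \<le> 1) \<Longrightarrow>
      fval hull_space \<phi> (\<lambda>i. hull_embed (seval M b (e i))) = ulim (\<lambda>j. fval M \<phi> (\<lambda>i. seval M b (e i) j))"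
    and e: "\<And>i j. norm (seval M b (e i) j) \<le> 1"
  shows "fval hull_space (FNot \<phi>) (\<lambda>i. hull_embed (seval M b (e i)))
    = ulim (\<lambda>j. fval M (FNot \<phi>) (\<lambda>i. seval M b (e i) j))"
  using tendsto_diff [OF tendsto_const fval_ulim_tendsto [of e, OF e], of 1 \<phi>]
  by (simp add: IH [of e, OF e] ulim_eqI)

theorem los:
  "(\<And>i j. norm (seval M b (e i) j) \<le> 1) \<Longrightarrow>
    fval hull_space \<phi> (\<lambda>i. hull_embed (seval M b (e i))) = ulim (\<lambda>j. fval M \<phi> (\<lambda>i. seval M b (e i) j))"
proof (induction \<phi> arbitrary: e)
  case (FNorm t)
  obtain s where "\<And>j. seval M b s j = tval t (\<lambda>i. seval M b (e i) j)"
    "hull_embed (seval M b s) = tval t (\<lambda>i. hull_embed (seval M b (e i)))"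
    using tval_hull [of e, OF FNorm, of t] by blast
  then show ?case using norm_hull_embed [of s] by simp
next
  case (FNot \<phi>)
  show ?case by (rule los_FNot [OF FNot.IH FNot.prems])
next
  case (FHalf \<phi>)
  then show ?case
    using tendsto_divide [OF fval_ulim_tendsto [of e, OF FHalf.prems, of \<phi>] tendsto_const, of 2]
    by (simp add: ulim_eqI)
next
  case (FMinus \<phi> \<psi>)
  have "ulim (\<lambda>j. fval M (FMinus \<phi> \<psi>) (\<lambda>i. seval M b (e i) j)) =
      max 0 (ulim (\<lambda>j. fval M \<phi> (\<lambda>i. seval M b (e i) j)) - ulim (\<lambda>j. fval M \<psi> (\<lambda>i. seval M b (e i) j)))"
    unfolding fval.simps
    by (intro ulim_eqI tendsto_max tendsto_diff tendsto_const fval_ulim_tendsto FMinus.prems)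
  then show ?case using FMinus.IH(1) [of e, OF FMinus.prems] FMinus.IH(2) [of e, OF FMinus.prems] by simp
next
  case (FSup k \<phi>)
  show ?case by (rule los_FSup [OF FSup.IH FSup.prems])
next
  case (FInf k \<phi>)
  have "fval hull_space (FNot (FSup k (FNot \<phi>))) (\<lambda>i. hull_embed (seval M b (e i)))
      = ulim (\<lambda>j. fval M (FNot (FSup k (FNot \<phi>))) (\<lambda>i. seval M b (e i) j))"
    by (intro los_FNot los_FSup FInf.IH FInf.prems)
  then show ?case
    by (simp only: fval_FInf_conv_FSup [OF subspace_hull_space hull_embed_ball_env [of e, OF FInf.prems]]
        fval_FInf_conv_FSup [OF M seval_ball_env [of e, OF FInf.prems]])
qed

lemma sep_model_hull_space: "sep_model (theory_of M) hull_space"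
proof -
  have "fval hull_space \<phi> (\<lambda>_. 0) = 0" if "\<phi> \<in> theory_of M" for \<phi>
  proof -
    have z: "seval M b (SScale 0 (SBase 0)) j = 0" for j by simp
    have z': "hull_embed (seval M b (SScale 0 (SBase 0))) = 0"
      by (simp only: hull_embed_SScale) simp
    have "fval hull_space \<phi> (\<lambda>i. hull_embed (seval M b (SScale 0 (SBase 0))))
        = ulim (\<lambda>j. fval M \<phi> (\<lambda>i. seval M b (SScale 0 (SBase 0)) j))"
      by (rule los) (simp only: z, simp)
    then show ?thesis using that by (simp only: z z') (simp add: theory_of_def)
  qed
  then show ?thesis
    using banach_hull_space separable_hull_space by (simp add: sep_model_def is_model_def)
qed

text \<open>
  The hull contains only rational combinations of the given sequences.  Real combinations are uniformly
  close to rational ones, which is enough for the embedding to be isometric at them.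
\<close>

lemma norm_hull_lincomb:
  "norm (\<Sum>i<n. r i *\<^sub>R hull_embed (b i)) = ulim (\<lambda>j. norm (\<Sum>i<n. r i *\<^sub>R b i j))"
proof -
  have b1: "norm (b i j) \<le> 1" for i j using b [of i j] by (simp add: unit_ball_def)
  have rb: "norm (r i *\<^sub>R b i j) \<le> \<bar>r i\<bar>" for i j and r :: "nat \<Rightarrow> real"
    using mult_left_mono [OF b1, of "\<bar>r i\<bar>"] by simp
  have bnd: "norm (\<Sum>i<n. r i *\<^sub>R b i j) \<le> (\<Sum>i<n. \<bar>r i\<bar>)" for n j and r :: "nat \<Rightarrow> real"
    using rb by (intro order_trans [OF norm_sum] sum_mono)
  have lin: "hull_embed (\<lambda>j. \<Sum>i<n. r i *\<^sub>R b i j) = (\<Sum>i<n. r i *\<^sub>R hull_embed (b i))" for n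
  proof (induction n)
    case 0
    show ?case using hull_embed_SScale [of 0 "SBase 0"] by simp
  next
    case (Suc n)
    have "hull_embed (\<lambda>j. r n *\<^sub>R b n j) = r n *\<^sub>R hull_embed (b n)"
      unfolding hull_embed_def by (rule ultra_embed_scaleR [OF b1])
    moreover have "hull_embed (\<lambda>j. (\<Sum>i<n. r i *\<^sub>R b i j) + r n *\<^sub>R b n j)
        = hull_embed (\<lambda>j. \<Sum>i<n. r i *\<^sub>R b i j) + hull_embed (\<lambda>j. r n *\<^sub>R b n j)"
      unfolding hull_embed_def by (rule ultra_embed_add [OF bnd rb])
    ultimately show ?case by (simp add: Suc)
  qed
  have rat: "\<exists>t. \<forall>j. norm (seval M b t j - (\<Sum>i<n. r i *\<^sub>R b i j)) \<le> \<eta>" if "\<eta> > 0" for \<eta> n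
    using that
  proof (induction n arbitrary: \<eta>)
    case 0
    then have "\<forall>j. norm (seval M b (SScale 0 (SBase 0)) j - (\<Sum>i<0. r i *\<^sub>R b i j)) \<le> \<eta>" by simp
    then show ?case ..
  next
    case (Suc n)
    from Suc.IH [of "\<eta>/2"] Suc.prems obtain t
      where t: "\<And>j. norm (seval M b t j - (\<Sum>i<n. r i *\<^sub>R b i j)) \<le> \<eta>/2" by auto
    obtain q where q: "\<bar>real_of_rat q - r n\<bar> < \<eta>/2" using ex_rat_close [of "\<eta>/2" "r n"] Suc.prems by auto
    have "norm (seval M b (SAdd t (SScale q (SBase n))) j - (\<Sum>i<Suc n. r i *\<^sub>R b i j)) \<le> \<eta>" for j
    proof -
      have "norm ((real_of_rat q - r n) *\<^sub>R b n j) \<le> \<bar>real_of_rat q - r n\<bar>" 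
        using rb [of "\<lambda>_. real_of_rat q - r n" n j] by simp
      then have "norm ((seval M b t j - (\<Sum>i<n. r i *\<^sub>R b i j)) + (real_of_rat q - r n) *\<^sub>R b n j) \<le> \<eta>"
        using t [of j] q by (intro norm_triangle_le) linarith
      then show ?thesis by (simp add: algebra_simps)
    qed
    then show ?case by blast
  qed
  have "norm (hull_embed (\<lambda>j. \<Sum>i<n. r i *\<^sub>R b i j)) = ulim (\<lambda>j. norm (\<Sum>i<n. r i *\<^sub>R b i j))"
    unfolding hull_embed_def
  proof (rule norm_ultra_embed [OF bnd])
    fix \<eta> :: real assume "\<eta> > 0"
    then obtain t where "\<forall>j. norm (seval M b t j - (\<Sum>i<n. r i *\<^sub>R b i j)) \<le> \<eta>" using rat by blast
    then have "\<forall>j. norm (seval M b (from_nat (to_nat t)) j - (\<Sum>i<n. r i *\<^sub>R b i j)) \<le> \<eta>" by simp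
    then show "\<exists>m. \<forall>j. norm (seval M b (from_nat m) j - (\<Sum>i<n. r i *\<^sub>R b i j)) \<le> \<eta>" ..
  qed
  then show ?thesis by (simp only: lin)
qed

end

text \<open>
  If the \<open>j\<close>-th members of the sequences \<open>b i\<close> satisfy more and more norm conditions, the classes of the
  sequences satisfy all of them in a separable model of the same theory.
\<close>

theorem compactness_sequences:
  fixes M :: "'a::real_normed_vector set"
  assumes "subspace M" and "\<And>i j. b i j \<in> unit_ball M"
  shows "\<exists>N e. sep_model (theory_of M) N \<and> e \<in> tuples N UNIV \<and>
    (\<forall>n r. norm (\<Sum>i<n. r i *\<^sub>R e i) = ulim (\<lambda>j. norm (\<Sum>i<n. r i *\<^sub>R b i j)))"
proof -
  interpret hull M b using assms by unfold_locales
  have "(\<lambda>i. hull_embed (seval M b (SBase i))) \<in> tuples hull_space UNIV"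
    using b by (intro hull_embed_ball_env) (simp add: unit_ball_def)
  then show ?thesis
    using sep_model_hull_space norm_hull_lincomb
    by (intro exI [of _ hull_space] exI [of _ "\<lambda>i. hull_embed (b i)"]) simp
qed

section \<open>A separable model containing an orthonormal sequence\<close>

lemma norm_lincomb_diff_le:
  fixes x :: "nat \<Rightarrow> 'a::real_normed_vector"
  assumes "\<And>i. i < n \<Longrightarrow> norm (x i) \<le> 1"
  shows "\<bar>norm (\<Sum>i<n. r i *\<^sub>R x i) - norm (\<Sum>i<n. q i *\<^sub>R x i)\<bar> \<le> (\<Sum>i<n. \<bar>r i - q i\<bar>)"
proof -
  have "\<bar>norm (\<Sum>i<n. r i *\<^sub>R x i) - norm (\<Sum>i<n. q i *\<^sub>R x i)\<bar>
      \<le> norm (\<Sum>i<n. (r i - q i) *\<^sub>R x i)"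
    using norm_triangle_ineq3 [of "\<Sum>i<n. r i *\<^sub>R x i" "\<Sum>i<n. q i *\<^sub>R x i"]
    by (simp add: sum_subtractf scaleR_diff_left)
  also have "\<dots> \<le> (\<Sum>i<n. norm ((r i - q i) *\<^sub>R x i))" by (rule norm_sum)
  also have "\<dots> \<le> (\<Sum>i<n. \<bar>r i - q i\<bar>)"
    using assms by (intro sum_mono) (simp add: mult_left_le)
  finally show ?thesis .
qed

lemma L2_set_cong_length: "L2_set (\<lambda>k. map f [0..<n] ! k) {..<n} = L2_set f {..<n}"
  by (intro L2_set_cong) auto

text \<open>
  The \<open>j\<close>-th approximation treats the first \<open>j\<close> rational lists up to an error of \<open>1 / (j + 1)\<close>.  Rational
  coefficients suffice, as both sides of the equation are Lipschitz in the coefficients.  The approximating vectors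
  may be slightly longer than \<open>1\<close> and are clipped to the unit ball, which does not change the limits.
\<close>

lemma ex_model_orthonormal_sequence:
  fixes M :: "'a::real_normed_vector set"
  assumes M: "subspace M" and inf: "infinite_dimensional M"
  shows "\<exists>N e. sep_model (theory_of M) N \<and> e \<in> tuples N UNIV \<and>
    (\<forall>n r. norm (\<Sum>i<n. r i *\<^sub>R e i) = L2_set r {..<n})"
proof -
  let ?l2 = "\<lambda>cs :: real list. L2_set (\<lambda>k. cs ! k) {..<length cs}"
  define rl where "rl k = map real_of_rat (from_nat k)" for k :: nat
  have "\<forall>j. \<exists>x::nat \<Rightarrow> 'a. (\<forall>i. x i \<in> M) \<and>
      (\<forall>cs\<in>rl ` {..j}. \<bar>norm (lincomb cs x) - ?l2 cs\<bar> \<le> 1 / (real j + 1))"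
    by (intro allI fin_repD [OF dvoretzky [OF M inf]]) auto
  then obtain x :: "nat \<Rightarrow> nat \<Rightarrow> 'a" where x: "\<And>j i. x j i \<in> M"
    "\<And>j cs. cs \<in> rl ` {..j} \<Longrightarrow> \<bar>norm (lincomb cs (x j)) - ?l2 cs\<bar> \<le> 1 / (real j + 1)"
    by metis
  have zero: "((\<lambda>j. 1 / (real j + 1)) \<longlongrightarrow> 0) free_ultrafilter"
    using LIMSEQ_inverse_real_of_nat by (intro tendsto_ultra) (simp add: inverse_eq_divide add.commute)
  have lim: "((\<lambda>j. norm (\<Sum>i<n. real_of_rat (q i) *\<^sub>R x j i)) \<longlongrightarrow> L2_set (\<lambda>i. real_of_rat (q i)) {..<n})
      free_ultrafilter" for n and q :: "nat \<Rightarrow> rat"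
  proof -
    define cs where "cs = map (\<lambda>i. real_of_rat (q i)) [0..<n]"
    have cs: "cs = rl (to_nat (map q [0..<n]))" by (simp add: cs_def rl_def o_def)
    have "((\<lambda>j. norm (lincomb cs (x j)) - ?l2 cs) \<longlongrightarrow> 0) free_ultrafilter"
    proof (rule Lim_null_comparison [OF _ zero])
      have "\<forall>\<^sub>F j in free_ultrafilter. to_nat (map q [0..<n]) \<le> j"
        by (rule sequentially_imp_ultra) (rule eventually_ge_at_top)
      then show "\<forall>\<^sub>F j in free_ultrafilter. norm (norm (lincomb cs (x j)) - ?l2 cs) \<le> 1 / (real j + 1)"
      proof (rule eventually_mono)
        fix j assume "to_nat (map q [0..<n]) \<le> j"
        then have "cs \<in> rl ` {..j}" unfolding cs by blast
        then show "norm (norm (lincomb cs (x j)) - ?l2 cs) \<le> 1 / (real j + 1)"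
          using x(2) unfolding real_norm_def by blast
      qed
    qed
    then have "((\<lambda>j. norm (lincomb cs (x j))) \<longlongrightarrow> ?l2 cs) free_ultrafilter" by (simp only: LIM_zero_iff)
    moreover have "lincomb cs (x j) = (\<Sum>i<n. real_of_rat (q i) *\<^sub>R x j i)" for j
      by (simp add: lincomb_sum cs_def)
    moreover have "?l2 cs = L2_set (\<lambda>i. real_of_rat (q i)) {..<n}"
      unfolding cs_def by (simp only: length_map length_upt diff_zero L2_set_cong_length)
    ultimately show ?thesis by simp
  qed
  have unit: "((\<lambda>j. norm (x j i)) \<longlongrightarrow> 1) free_ultrafilter" for i
  proof -
    define q :: "nat \<Rightarrow> rat" where "q = (\<lambda>k. if k = i then 1 else 0)"
    have "(\<Sum>k<Suc i. real_of_rat (q k) *\<^sub>R x j k) = x j i" for j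
      by (simp add: q_def if_distrib [of real_of_rat] if_distrib [of "\<lambda>c. c *\<^sub>R _"] cong: if_cong)
    moreover have "L2_set (\<lambda>k. real_of_rat (q k)) {..<Suc i} = 1"
      by (simp add: q_def L2_set_def if_distrib [of real_of_rat] if_distrib [of "\<lambda>c. c\<^sup>2"] cong: if_cong)
    ultimately show ?thesis using lim [where n = "Suc i" and q = q] by simp
  qed
  define b where "b i j = clip (x j i)" for i j
  have b: "b i j \<in> unit_ball M" for i j unfolding b_def by (rule clip_in_unit_ball [OF M x(1)])
  have clip: "((\<lambda>j. norm (b i j - x j i)) \<longlongrightarrow> 0) free_ultrafilter" for i
    unfolding b_def norm_clip_diff using tendsto_max [OF tendsto_const tendsto_diff [OF unit tendsto_const], of 0 _ 1]
    by simp
  obtain N e where N: "sep_model (theory_of M) N" "e \<in> tuples N UNIV"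
    and e: "\<And>n r. norm (\<Sum>i<n. r i *\<^sub>R e i) = ulim (\<lambda>j. norm (\<Sum>i<n. r i *\<^sub>R b i j))"
    using compactness_sequences [of M b, OF M b] by blast
  have rat: "norm (\<Sum>i<n. real_of_rat (q i) *\<^sub>R e i) = L2_set (\<lambda>i. real_of_rat (q i)) {..<n}" for n q
  proof -
    have "((\<lambda>j. norm (\<Sum>i<n. real_of_rat (q i) *\<^sub>R b i j) - norm (\<Sum>i<n. real_of_rat (q i) *\<^sub>R x j i)) \<longlongrightarrow> 0)
      free_ultrafilter"
    proof (rule Lim_null_comparison)
      show "\<forall>\<^sub>F j in free_ultrafilter.
          norm (norm (\<Sum>i<n. real_of_rat (q i) *\<^sub>R b i j) - norm (\<Sum>i<n. real_of_rat (q i) *\<^sub>R x j i))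
          \<le> (\<Sum>i<n. \<bar>real_of_rat (q i)\<bar> * norm (b i j - x j i))"
      proof (intro always_eventually allI)
        fix j
        have "norm (norm (\<Sum>i<n. real_of_rat (q i) *\<^sub>R b i j) - norm (\<Sum>i<n. real_of_rat (q i) *\<^sub>R x j i))
            \<le> norm (\<Sum>i<n. real_of_rat (q i) *\<^sub>R (b i j - x j i))"
          unfolding real_norm_def scaleR_diff_right sum_subtractf by (rule norm_triangle_ineq3)
        also have "\<dots> \<le> (\<Sum>i<n. norm (real_of_rat (q i) *\<^sub>R (b i j - x j i)))" by (rule norm_sum)
        finally show "norm (norm (\<Sum>i<n. real_of_rat (q i) *\<^sub>R b i j) - norm (\<Sum>i<n. real_of_rat (q i) *\<^sub>R x j i))
          \<le> (\<Sum>i<n. \<bar>real_of_rat (q i)\<bar> * norm (b i j - x j i))" by (simp only: norm_scaleR)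
      qed
      show "((\<lambda>j. \<Sum>i<n. \<bar>real_of_rat (q i)\<bar> * norm (b i j - x j i)) \<longlongrightarrow> 0) free_ultrafilter"
        by (intro tendsto_null_sum tendsto_mult_right_zero clip)
    qed
    from tendsto_add [OF this lim [where n = n and q = q]] show ?thesis
      unfolding e by (intro ulim_eqI) simp
  qed
  have e1: "norm (e i) \<le> 1" for i using N(2) by (simp add: tuples_def unit_ball_def)
  have "norm (\<Sum>i<n. r i *\<^sub>R e i) = L2_set r {..<n}" for n r
  proof -
    have close: "\<bar>norm (\<Sum>i<n. r i *\<^sub>R e i) - L2_set r {..<n}\<bar> \<le> \<epsilon>" if "0 < \<epsilon>" for \<epsilon>
    proof -
      have "\<exists>q. \<bar>real_of_rat q - r i\<bar> < \<epsilon> / (2 * (real n + 1))" for i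
        using that by (intro ex_rat_close) (simp add: add_nonneg_pos)
      then obtain q where q: "\<And>i. \<bar>real_of_rat (q i) - r i\<bar> < \<epsilon> / (2 * (real n + 1))" by metis
      have "(\<Sum>i<n. \<bar>r i - real_of_rat (q i)\<bar>) \<le> (\<Sum>i<n. \<epsilon> / (2 * (real n + 1)))"
        using q by (intro sum_mono) (simp add: abs_minus_commute less_imp_le)
      also have "\<dots> \<le> \<epsilon> / 2" using that by (simp add: field_simps add_nonneg_pos)
      finally have sm: "(\<Sum>i<n. \<bar>r i - real_of_rat (q i)\<bar>) \<le> \<epsilon> / 2" .
      have "\<bar>norm (\<Sum>i<n. r i *\<^sub>R e i) - norm (\<Sum>i<n. real_of_rat (q i) *\<^sub>R e i)\<bar> \<le> \<epsilon> / 2"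
        using norm_lincomb_diff_le [of n e r "\<lambda>i. real_of_rat (q i)"] e1 sm by simp
      moreover have "\<bar>L2_set r {..<n} - L2_set (\<lambda>i. real_of_rat (q i)) {..<n}\<bar> \<le> \<epsilon> / 2"
        using L2_set_diff [of r "{..<n}" "\<lambda>i. real_of_rat (q i)"]
          L2_set_le_sum_abs [of "\<lambda>i. r i - real_of_rat (q i)" "{..<n}"] sm by linarith
      ultimately show ?thesis unfolding rat by linarith
    qed
    show ?thesis
    proof (rule ccontr)
      assume "\<not> ?thesis"
      then show False using close [of "\<bar>norm (\<Sum>i<n. r i *\<^sub>R e i) - L2_set r {..<n}\<bar> / 2"] by simp
    qed
  qed
  with N show ?thesis by blast
qed

lemma lp_coeff_2: "lp_coeff 2 n r = L2_set r {..<Suc n}"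
  by (simp add: lp_coeff_def L2_set_def powr_half_sqrt sum_nonneg lessThan_Suc_atMost del: sum.atMost_Suc)

lemma orthonormal_satisfies_seq_type:
  assumes "\<And>n r. norm (\<Sum>i<n. r i *\<^sub>R e i) = L2_set r {..<n}"
  shows "satisfies_seq_type (lp_coeff 2) 0 e" and "norm (e 0) = 1"
proof -
  show "norm (e 0) = 1" using assms [where n = 1 and r = "\<lambda>_. 1"] by (simp add: L2_set_def)
  then show "satisfies_seq_type (lp_coeff 2) 0 e"
    by (simp add: satisfies_seq_type_def lp_coeff_2 assms L2_set_nonneg flip: lessThan_Suc_atMost
        del: sum.lessThan_Suc)
qed

section \<open>Transfer along perturbation maps\<close>

lemma sep_model_isometric_copy:
  assumes M: "banach_subspace M" and h: "linear_isometry_on M h"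
    and hM: "banach_subspace (h ` M)" "separable_set (h ` M)"
  shows "sep_model (theory_of M) (h ` M)"
proof -
  have sub: "subspace M" using M by (simp add: banach_subspace_def)
  have z: "(\<lambda>_. 0) \<in> tuples M UNIV" using zero_in_unit_ball [OF sub] by (simp add: tuples_def)
  have "h \<circ> (\<lambda>_::nat. 0) = (\<lambda>_. 0)" using linear_isometry_on_zero [OF sub h] by (simp add: fun_eq_iff)
  then have "fval (h ` M) \<phi> (\<lambda>_. 0) = fval M \<phi> (\<lambda>_. 0)" for \<phi>
    using fval_isometric_image [OF sub h z, of \<phi>] by (simp only:)
  then show ?thesis using hM by (simp add: sep_model_def is_model_def theory_of_def)
qed

lemma tp_isometric_copy:
  assumes "subspace M" "linear_isometry_on M h" "x \<in> tuples M UNIV"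
  shows "tp (h ` M) I (h \<circ> x) = tp M I x"
  using fval_isometric_image [OF assms] by (simp add: tp_def fun_eq_iff)

text \<open>
  Both embedding theorems start from this situation.  The copy \<open>h ` M\<close> is needed because categoricity
  speaks about models inside the space of bounded real sequences.
\<close>

lemma ex_perturbed_orthonormal_sequence:
  fixes M :: "'a::real_normed_vector set"
  assumes M: "banach_subspace M" "separable_set M" "infinite_dimensional M"
    and cat: "aleph0_categorical \<pp> (theory_of M)" and \<epsilon>: "0 < \<epsilon>"
  shows "\<exists>(h :: 'a \<Rightarrow> linf) N e f x. linear_isometry_on M h \<and> sep_model (theory_of M) (h ` M) \<and>
    sep_model (theory_of M) N \<and> e \<in> tuples N UNIV \<and> (\<forall>n r. norm (\<Sum>i<n. r i *\<^sub>R e i) = L2_set r {..<n}) \<and>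
    perturbation_map (\<pp> \<epsilon>) N (h ` M) f \<and> x \<in> tuples M UNIV \<and> h \<circ> x = f \<circ> e"
proof -
  have sub: "subspace M" using M(1) by (simp add: banach_subspace_def)
  obtain h :: "'a \<Rightarrow> linf" where h: "linear_isometry_on M h" "banach_subspace (h ` M)" "separable_set (h ` M)"
    using ex_isometric_copy_in_linf [OF M(1,2)] by blast
  have hM: "sep_model (theory_of M) (h ` M)" by (rule sep_model_isometric_copy [OF M(1) h])
  obtain N e where N: "sep_model (theory_of M) N" and e: "e \<in> tuples N UNIV"
    and on: "\<forall>n r. norm (\<Sum>i<n. r i *\<^sub>R e i) = L2_set r {..<n}"
    using ex_model_orthonormal_sequence [OF sub M(3)] by blast
  obtain f where f: "perturbation_map (\<pp> \<epsilon>) N (h ` M) f"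
    using cat N hM \<epsilon> unfolding aleph0_categorical_def p_isomorphic_def by blast
  have "f (e i) \<in> h ` unit_ball M" for i
    using f e unit_ball_isometric_image [OF h(1)]
    by (auto simp: perturbation_map_def tuples_def dest: bij_betwE)
  then have "\<forall>i. \<exists>z. z \<in> unit_ball M \<and> h z = f (e i)" by (metis imageE)
  then obtain x where x: "\<And>i. x i \<in> unit_ball M" "\<And>i. h (x i) = f (e i)" by metis
  have "x \<in> tuples M UNIV" "h \<circ> x = f \<circ> e" using x by (auto simp: tuples_def)
  with h(1) hM N e on f show ?thesis by blast
qed

theorem embeds_l2_approximately:
  fixes M :: "'a::real_normed_vector set"
  assumes M: "banach_subspace M" "separable_set M" "infinite_dimensional M"
    and cat: "aleph0_categorical \<pp> (theory_of M)"
  shows "embeds_approximately \<pp> (lp_coeff 2) M"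
  unfolding embeds_approximately_def Let_def
proof (intro allI impI)
  fix \<epsilon> :: real assume \<epsilon>: "0 < \<epsilon>"
  let ?T = "theory_of M"
  let ?s = "seq_type ?T (lp_coeff 2) 0 \<inter> normalised_types ?T"
  have sub: "subspace M" using M(1) by (simp add: banach_subspace_def)
  obtain h :: "'a \<Rightarrow> linf" and N e f x where h: "linear_isometry_on M h" and hM: "sep_model ?T (h ` M)"
    and N: "sep_model ?T N" and e: "e \<in> tuples N UNIV"
    and on': "\<forall>n r. norm (\<Sum>i<n. r i *\<^sub>R e i) = L2_set r {..<n}"
    and f: "perturbation_map (\<pp> \<epsilon>) N (h ` M) f" and x: "x \<in> tuples M UNIV" and hx: "h \<circ> x = f \<circ> e"
    using ex_perturbed_orthonormal_sequence [OF M cat \<epsilon>] by (elim exE conjE) blast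
  have on: "norm (\<Sum>i<n. r i *\<^sub>R e i) = L2_set r {..<n}" for n r using on' by blast
  have fe: "f \<circ> e \<in> tuples (h ` M) UNIV"
    using x unit_ball_isometric_image [OF h] by (simp add: tuples_def flip: hx)
  have "tp N UNIV e \<in> seq_type ?T (lp_coeff 2) 0"
    unfolding seq_type_def using N e orthonormal_satisfies_seq_type(1) [OF on] by blast
  moreover have "tp N UNIV e \<in> normalised_types ?T"
    unfolding normalised_types_def type_space_def
    using N e orthonormal_satisfies_seq_type(2) [OF on] by (auto simp: tp_def)
  moreover have "(tp N UNIV e, tp (h ` M) UNIV (f \<circ> e)) \<in> perturbed_countable ?T (\<pp> \<epsilon>)"
  proof -
    have "(tp N {..<n} (e \<circ> \<sigma>), tp (h ` M) {..<n} ((f \<circ> e) \<circ> \<sigma>)) \<in> \<pp> \<epsilon> n" for n \<sigma>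
    proof -
      have "e \<circ> \<sigma> \<in> tuples N {..<n}" using e by (simp add: tuples_def)
      then have "(tp N {..<n} (e \<circ> \<sigma>), tp (h ` M) {..<n} (f \<circ> (e \<circ> \<sigma>))) \<in> \<pp> \<epsilon> n"
        using f unfolding perturbation_map_def by blast
      then show ?thesis by (simp only: comp_assoc)
    qed
    then show ?thesis unfolding perturbed_countable_def using N hM e fe by blast
  qed
  ultimately have "tp (h ` M) UNIV (f \<circ> e) \<in> p_neighbourhood ?T (\<pp> \<epsilon>) ?s"
    unfolding p_neighbourhood_def by blast
  then have "tp (h ` M) UNIV (f \<circ> e) \<in> thickening ?T (p_neighbourhood ?T (\<pp> \<epsilon>) ?s) \<epsilon>"
    unfolding thickening_def using hM fe \<epsilon> by (auto intro!: exI [of _ "h ` M"] exI [of _ "f \<circ> e"] bexI [of _ "f \<circ> e"])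
  then have "tp M UNIV x \<in> thickening ?T (p_neighbourhood ?T (\<pp> \<epsilon>) ?s) \<epsilon>"
    using tp_isometric_copy [OF sub h x, of UNIV] by (simp only: hx)
  then show "realised_in M (thickening ?T (p_neighbourhood ?T (\<pp> \<epsilon>) ?s) \<epsilon>)"
    unfolding realised_in_def using x by blast
qed

section \<open>Types determine the norms of linear combinations\<close>

text \<open>\<open>dyadic_mult m k i\<close> denotes \<open>(k / 2^m) x\<^sub>i\<close> provided that \<open>\<bar>k\<bar> \<le> 2^m\<close>.\<close>

primrec dyadic_mult :: "nat \<Rightarrow> int \<Rightarrow> nat \<Rightarrow> bterm" where
  "dyadic_mult 0 k i = (if k = 0 then TZero else if k = 1 then TVar i else TNeg (TVar i))"
| "dyadic_mult (Suc m) k i = TMid (dyadic_mult m (k div 2) i) (dyadic_mult m (k - k div 2) i)"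

primrec dyadic_sum :: "nat \<Rightarrow> (nat \<Rightarrow> int) \<Rightarrow> nat \<Rightarrow> bterm" where
  "dyadic_sum m k 0 = TZero"
| "dyadic_sum m k (Suc n) = TMid (dyadic_sum m k n) (dyadic_mult m (k n) n)"

lemma tvars_dyadic_mult: "tvars (dyadic_mult m k i) \<subseteq> {i}"
  by (induction m arbitrary: k) auto

lemma tvars_dyadic_sum: "tvars (dyadic_sum m k n) \<subseteq> {..<n}"
  using tvars_dyadic_mult by (induction n) fastforce+

lemma tval_dyadic_mult: "\<bar>k\<bar> \<le> 2 ^ m \<Longrightarrow> tval (dyadic_mult m k i) e = (real_of_int k / 2 ^ m) *\<^sub>R e i"
proof (induction m arbitrary: k)
  case 0
  then have "k = 0 \<or> k = 1 \<or> k = -1" by auto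
  then show ?case by auto
next
  case (Suc m)
  define p :: int where "p = 2 ^ m"
  have "\<bar>k\<bar> \<le> 2 * p" using Suc.prems by (simp add: p_def)
  then have "\<bar>k div 2\<bar> \<le> p \<and> \<bar>k - k div 2\<bar> \<le> p" by presburger
  then have "tval (dyadic_mult (Suc m) k i) e
      = (1/2) *\<^sub>R ((real_of_int (k div 2) / 2 ^ m) *\<^sub>R e i + (real_of_int (k - k div 2) / 2 ^ m) *\<^sub>R e i)"
    by (simp add: Suc.IH p_def)
  also have "\<dots> = ((1/2) * (real_of_int (k div 2) / 2 ^ m + real_of_int (k - k div 2) / 2 ^ m)) *\<^sub>R e i"
    by (simp only: scaleR_add_left [symmetric] scaleR_scaleR)
  also have "(1/2) * (real_of_int (k div 2) / 2 ^ m + real_of_int (k - k div 2) / 2 ^ m) = real_of_int k / 2 ^ Suc m"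
    by (simp add: field_simps)
  finally show ?case .
qed

lemma tval_dyadic_sum:
  assumes "\<And>i. i < n \<Longrightarrow> \<bar>k i\<bar> \<le> 2 ^ m"
  shows "2 ^ n *\<^sub>R tval (dyadic_sum m k n) e = (\<Sum>i<n. (2 ^ i * (real_of_int (k i) / 2 ^ m)) *\<^sub>R e i)"
  using assms
proof (induction n)
  case (Suc n)
  have "2 ^ Suc n *\<^sub>R tval (dyadic_sum m k (Suc n)) e
      = 2 ^ n *\<^sub>R tval (dyadic_sum m k n) e + 2 ^ n *\<^sub>R tval (dyadic_mult m (k n) n) e"
    by (simp add: scaleR_add_right)
  then show ?case using Suc by (simp add: tval_dyadic_mult)
qed simp

text \<open>
  The iterated midpoints in \<open>dyadic_sum\<close> give the variable \<open>i\<close> the weight \<open>2^i / 2^n\<close>, which the division by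
  \<open>2^i\<close> inside the floor compensates.
\<close>

lemma dyadic_sum_approx:
  fixes a :: "nat \<Rightarrow> 'a::real_normed_vector"
  assumes r: "\<And>i. i < n \<Longrightarrow> \<bar>r i\<bar> \<le> 1" and a: "\<And>i. i < n \<Longrightarrow> norm (a i) \<le> 1"
  shows "\<bar>2 ^ n * norm (tval (dyadic_sum m (\<lambda>i. \<lfloor>2 ^ m * (r i / 2 ^ i)\<rfloor>) n) a) - norm (\<Sum>i<n. r i *\<^sub>R a i)\<bar>
    \<le> (\<Sum>i<n. 2 ^ i) / 2 ^ m"
proof -
  define k where "k i = \<lfloor>2 ^ m * (r i / 2 ^ i)\<rfloor>" for i
  have k: "\<bar>k i\<bar> \<le> 2 ^ m" if "i < n" for i
  proof -
    have "\<bar>r i\<bar> \<le> 2 ^ i" using r [OF that] one_le_power [of "2::real" i] by linarith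
    then have "\<bar>r i / 2 ^ i\<bar> \<le> 1" by (simp add: divide_le_eq_1)
    then have "\<bar>2 ^ m * (r i / 2 ^ i)\<bar> \<le> 2 ^ m * 1" unfolding abs_mult by (intro mult_mono) auto
    then have "- (2 ^ m) \<le> 2 ^ m * (r i / 2 ^ i)" "2 ^ m * (r i / 2 ^ i) \<le> 2 ^ m" by linarith+
    then have "real_of_int (- (2 ^ m)) \<le> 2 ^ m * (r i / 2 ^ i)" "2 ^ m * (r i / 2 ^ i) \<le> real_of_int (2 ^ m)"
      by simp_all
    then have "- (2 ^ m) \<le> \<lfloor>2 ^ m * (r i / 2 ^ i)\<rfloor>" "\<lfloor>2 ^ m * (r i / 2 ^ i)\<rfloor> \<le> \<lfloor>real_of_int (2 ^ m)\<rfloor>"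
      by (simp only: le_floor_iff, intro floor_mono)
    then show ?thesis unfolding k_def abs_le_iff floor_of_int by linarith
  qed
  have "2 ^ n * norm (tval (dyadic_sum m k n) a) = norm (2 ^ n *\<^sub>R tval (dyadic_sum m k n) a)" by simp
  also have "\<dots> = norm (\<Sum>i<n. (2 ^ i * (real_of_int (k i) / 2 ^ m)) *\<^sub>R a i)"
    by (simp only: tval_dyadic_sum [OF k])
  finally have "\<bar>2 ^ n * norm (tval (dyadic_sum m k n) a) - norm (\<Sum>i<n. r i *\<^sub>R a i)\<bar>
      \<le> (\<Sum>i<n. \<bar>2 ^ i * (real_of_int (k i) / 2 ^ m) - r i\<bar>)"
    using norm_lincomb_diff_le [of n a "\<lambda>i. 2 ^ i * (real_of_int (k i) / 2 ^ m)" r] a by simp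
  also have "\<dots> \<le> (\<Sum>i<n. 2 ^ i / 2 ^ m)"
  proof (rule sum_mono)
    fix i
    have "\<bar>real_of_int (k i) - 2 ^ m * (r i / 2 ^ i)\<bar> \<le> 1" unfolding k_def by linarith
    then have "(2 ^ i / 2 ^ m) * \<bar>real_of_int (k i) - 2 ^ m * (r i / 2 ^ i)\<bar> \<le> (2 ^ i / 2 ^ m) * 1"
      by (intro mult_left_mono) auto
    moreover have "2 ^ i * (real_of_int (k i) / 2 ^ m) - r i
        = (2 ^ i / 2 ^ m) * (real_of_int (k i) - 2 ^ m * (r i / 2 ^ i))" by (simp add: right_diff_distrib)
    ultimately show "\<bar>2 ^ i * (real_of_int (k i) / 2 ^ m) - r i\<bar> \<le> 2 ^ i / 2 ^ m" by (simp add: abs_mult)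
  qed
  also have "\<dots> = (\<Sum>i<n. 2 ^ i) / 2 ^ m" by (simp only: sum_divide_distrib)
  finally show ?thesis by (simp only: k_def [abs_def])
qed

lemma norm_lincomb_divide:
  fixes c :: "nat \<Rightarrow> 'a::real_normed_vector"
  assumes "0 < K"
  shows "K * norm (\<Sum>i<n. (r i / K) *\<^sub>R c i) = norm (\<Sum>i<n. r i *\<^sub>R c i)"
proof -
  have "norm (K *\<^sub>R (\<Sum>i<n. (r i / K) *\<^sub>R c i)) = norm (\<Sum>i<n. r i *\<^sub>R c i)"
    using assms by (simp add: scaleR_sum_right)
  then show ?thesis using assms by simp
qed

text \<open>
  The terms of the language express only combinations with dyadic coefficients of small size.  Up to the factor
  \<open>2^n\<close> they approximate all combinations with coefficients in \<open>[-1, 1]\<close>, and the remaining ones are multiples of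
  these.
\<close>

lemma tp_eq_imp_norm_lincomb_eq:
  fixes a :: "nat \<Rightarrow> 'a::real_normed_vector" and b :: "nat \<Rightarrow> 'b::real_normed_vector"
  assumes a: "a \<in> tuples N {..<n}" and b: "b \<in> tuples N' {..<n}" and tp: "tp N {..<n} a = tp N' {..<n} b"
  shows "norm (\<Sum>i<n. r i *\<^sub>R a i) = norm (\<Sum>i<n. r i *\<^sub>R b i)"
proof -
  have a1: "norm (a i) \<le> 1" and b1: "norm (b i) \<le> 1" if "i < n" for i
    using that a b by (auto simp: tuples_def unit_ball_def)
  have tm: "norm (tval t a) = norm (tval t b)" if "tvars t \<subseteq> {..<n}" for t
    using fun_cong [OF tp, of "FNorm t"] that by (simp add: tp_def)
  have small: "norm (\<Sum>i<n. s i *\<^sub>R a i) = norm (\<Sum>i<n. s i *\<^sub>R b i)" if s: "\<And>i. i < n \<Longrightarrow> \<bar>s i\<bar> \<le> 1" for s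
  proof -
    have le: "\<bar>norm (\<Sum>i<n. s i *\<^sub>R a i) - norm (\<Sum>i<n. s i *\<^sub>R b i)\<bar> \<le> 2 * (\<Sum>i<n. 2 ^ i) * (1/2) ^ m" for m
    proof -
      define t where "t = dyadic_sum m (\<lambda>i. \<lfloor>2 ^ m * (s i / 2 ^ i)\<rfloor>) n"
      have "norm (tval t a) = norm (tval t b)" unfolding t_def by (intro tm tvars_dyadic_sum)
      moreover have "\<bar>2 ^ n * norm (tval t a) - norm (\<Sum>i<n. s i *\<^sub>R a i)\<bar> \<le> (\<Sum>i<n. 2 ^ i) / 2 ^ m"
        unfolding t_def by (intro dyadic_sum_approx s a1)
      moreover have "\<bar>2 ^ n * norm (tval t b) - norm (\<Sum>i<n. s i *\<^sub>R b i)\<bar> \<le> (\<Sum>i<n. 2 ^ i) / 2 ^ m"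
        unfolding t_def by (intro dyadic_sum_approx s b1)
      moreover have "2 * (\<Sum>i<n. 2 ^ i) * (1/2) ^ m = (\<Sum>i<n. 2 ^ i) / 2 ^ m + (\<Sum>i<n. (2::real) ^ i) / 2 ^ m"
        by (simp add: power_divide)
      ultimately show ?thesis by simp
    qed
    have "(\<lambda>m. 2 * (\<Sum>i<n. 2 ^ i) * (1/2::real) ^ m) \<longlonglongrightarrow> 2 * (\<Sum>i<n. 2 ^ i) * 0"
      by (intro tendsto_mult_left LIMSEQ_power_zero) simp
    then have "\<bar>norm (\<Sum>i<n. s i *\<^sub>R a i) - norm (\<Sum>i<n. s i *\<^sub>R b i)\<bar> \<le> 2 * (\<Sum>i<n. 2 ^ i) * 0"
      by (rule LIMSEQ_le_const) (use le in blast)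
    then show ?thesis by simp
  qed
  define K where "K = 1 + (\<Sum>i<n. \<bar>r i\<bar>)"
  have K: "0 < K" unfolding K_def by (intro add_pos_nonneg sum_nonneg) auto
  have "\<bar>r i / K\<bar> \<le> 1" if "i < n" for i
  proof -
    have "\<bar>r i\<bar> \<le> (\<Sum>i<n. \<bar>r i\<bar>)" using that by (intro member_le_sum) auto
    then show ?thesis using K by (simp add: K_def)
  qed
  then have "K * norm (\<Sum>i<n. (r i / K) *\<^sub>R a i) = K * norm (\<Sum>i<n. (r i / K) *\<^sub>R b i)"
    by (simp only: small)
  then show ?thesis by (simp only: norm_lincomb_divide [OF K])
qed

lemma linear_bijection_lincomb:
  fixes n :: nat
  assumes U: "subspace U" and g: "linear_bijection U U' g" and a: "\<And>i. i < n \<Longrightarrow> a i \<in> U"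
  shows "g (\<Sum>i<n. r i *\<^sub>R a i) = (\<Sum>i<n. r i *\<^sub>R g (a i))"
  using a
proof (induction n)
  case 0
  have "g (0 *\<^sub>R 0) = 0 *\<^sub>R g 0" using g subspace_0 [OF U] unfolding linear_bijection_def by blast
  then show ?case by simp
next
  case (Suc n)
  have "(\<Sum>i<n. r i *\<^sub>R a i) \<in> U" using Suc.prems by (intro subspace_sum [OF U] subspace_scale [OF U]) auto
  moreover have "r n *\<^sub>R a n \<in> U" using Suc.prems by (intro subspace_scale [OF U]) auto
  ultimately show ?case using Suc g by (simp add: linear_bijection_def)
qed

text \<open>
  Nothing is known about \<open>f\<close> on linear combinations of the \<open>e i\<close>.  The bounds are obtained in \<open>U\<close>, where tuples of the
  types of \<open>e\<close> and \<open>f \<circ> e\<close> correspond under a linear map.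
\<close>

lemma BM_perturbation_norm_bounds:
  fixes U :: "'u::real_normed_vector set"
  assumes U: "subspace U" and \<epsilon>: "0 < \<epsilon>"
    and f: "perturbation_map (BM_system T U \<epsilon>) N N' f" and e: "e \<in> tuples N UNIV"
  shows "norm (\<Sum>i<n. r i *\<^sub>R f (e i)) \<le> exp \<epsilon> * norm (\<Sum>i<n. r i *\<^sub>R e i)"
    and "norm (\<Sum>i<n. r i *\<^sub>R e i) \<le> exp \<epsilon> * norm (\<Sum>i<n. r i *\<^sub>R f (e i))"
proof -
  have en: "e \<in> tuples N {..<n}" using e by (simp add: tuples_def)
  have fen: "f \<circ> e \<in> tuples N' {..<n}"
    using f e by (auto simp: perturbation_map_def tuples_def dest: bij_betwE)
  have "BM_dist U n (tp N {..<n} e) (tp N' {..<n} (f \<circ> e)) < ereal \<epsilon>"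
    using f en unfolding perturbation_map_def BM_system_def by blast
  then obtain \<delta> g a b where \<delta>: "0 \<le> \<delta>" "ln (1 + \<delta>) < \<epsilon>" and a: "a \<in> tuples U {..<n}" and b: "b \<in> tuples U {..<n}"
    and tp: "tp U {..<n} a = tp N {..<n} e" "tp U {..<n} b = tp N' {..<n} (f \<circ> e)"
    and g: "almost_isomorphism \<delta> U U g" and gab: "\<And>i. i < n \<Longrightarrow> g (a i) = b i"
    unfolding BM_dist_def Inf_less_iff by auto
  have "1 + \<delta> = exp (ln (1 + \<delta>))" using \<delta>(1) by simp
  also have "\<dots> \<le> exp \<epsilon>" using \<delta>(2) by simp
  finally have \<delta>e: "1 + \<delta> \<le> exp \<epsilon>" .
  let ?a = "\<Sum>i<n. r i *\<^sub>R a i" and ?b = "\<Sum>i<n. r i *\<^sub>R b i"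
  have aU: "a i \<in> U" if "i < n" for i using a that by (simp add: tuples_def unit_ball_def)
  have "?a \<in> U" using aU by (intro subspace_sum [OF U] subspace_scale [OF U]) auto
  moreover have "g ?a = ?b"
    using linear_bijection_lincomb [OF U, of U g n a r] g aU gab by (simp add: almost_isomorphism_def)
  ultimately have ab: "norm ?b \<le> (1 + \<delta>) * norm ?a" "norm ?a \<le> (1 + \<delta>) * norm ?b"
    using g unfolding almost_isomorphism_def by metis+
  have na: "norm ?a = norm (\<Sum>i<n. r i *\<^sub>R e i)" by (rule tp_eq_imp_norm_lincomb_eq [OF a en tp(1)])
  have nb: "norm ?b = norm (\<Sum>i<n. r i *\<^sub>R f (e i))"
    using tp_eq_imp_norm_lincomb_eq [OF b fen tp(2)] by simp
  show "norm (\<Sum>i<n. r i *\<^sub>R f (e i)) \<le> exp \<epsilon> * norm (\<Sum>i<n. r i *\<^sub>R e i)"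
    using ab(1) mult_right_mono [OF \<delta>e norm_ge_zero [of ?a]] unfolding na nb by linarith
  show "norm (\<Sum>i<n. r i *\<^sub>R e i) \<le> exp \<epsilon> * norm (\<Sum>i<n. r i *\<^sub>R f (e i))"
    using ab(2) mult_right_mono [OF \<delta>e norm_ge_zero [of ?b]] unfolding na nb by linarith
qed

section \<open>The closed span of an almost orthonormal sequence\<close>

lemma lp_space_2: "lp_space 2 = {x. summable (\<lambda>n. (x n)\<^sup>2)}"
  by (simp add: lp_space_def)

lemma lp_norm_2: "s \<in> lp_space 2 \<Longrightarrow> lp_norm 2 s = sqrt (\<Sum>n. (s n)\<^sup>2)"
  by (simp add: lp_norm_def lp_space_2 powr_half_sqrt suminf_nonneg)

lemma lp_space_2_add:
  assumes "s \<in> lp_space 2" "t \<in> lp_space 2"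
  shows "(\<lambda>n. s n + t n) \<in> lp_space 2"
proof -
  have "summable (\<lambda>n. 2 * (s n)\<^sup>2 + 2 * (t n)\<^sup>2)"
    using assms by (intro summable_add summable_mult) (auto simp: lp_space_2)
  moreover have "norm ((s n + t n)\<^sup>2) \<le> 2 * (s n)\<^sup>2 + 2 * (t n)\<^sup>2" for n
  proof -
    have "0 \<le> (s n - t n)\<^sup>2" by simp
    then have "(s n + t n)\<^sup>2 \<le> 2 * (s n)\<^sup>2 + 2 * (t n)\<^sup>2" by (simp add: power2_eq_square algebra_simps)
    then show ?thesis by simp
  qed
  ultimately show ?thesis unfolding lp_space_2 by (auto intro: summable_comparison_test')
qed

lemma lp_space_2_scale: "s \<in> lp_space 2 \<Longrightarrow> (\<lambda>n. c * s n) \<in> lp_space 2"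
  by (simp add: lp_space_2 power_mult_distrib summable_mult)

text \<open>
  Square summable combinations of the \<open>x i\<close> converge, and their sums form a copy of \<open>\<ell>\<^sub>2\<close> with the same bounds.
\<close>

lemma embeds_l2_if_almost_orthonormal:
  fixes x :: "nat \<Rightarrow> 'a::real_normed_vector"
  assumes M: "subspace M" "complete M" and x: "\<And>i. x i \<in> M" and c: "0 < c"
    and up: "\<And>n r. norm (\<Sum>i<n. r i *\<^sub>R x i) \<le> c * L2_set r {..<n}"
    and low: "\<And>n r. L2_set r {..<n} \<le> c * norm (\<Sum>i<n. r i *\<^sub>R x i)"
  shows "\<exists>L S. subspace L \<and> L \<subseteq> M \<and> bij_betw S L (lp_space 2) \<and>
        (\<forall>x\<in>L. \<forall>y\<in>L. \<forall>n. S (x + y) n = S x n + S y n) \<and>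
        (\<forall>t. \<forall>x\<in>L. \<forall>n. S (t *\<^sub>R x) n = t * S x n) \<and>
        (\<forall>x\<in>L. inverse c * norm x \<le> lp_norm 2 (S x) \<and> lp_norm 2 (S x) \<le> c * norm x)"
proof -
  have conv: "\<exists>l\<in>M. (\<lambda>n. \<Sum>i<n. s i *\<^sub>R x i) \<longlonglongrightarrow> l" if s: "s \<in> lp_space 2" for s
  proof -
    let ?S = "\<lambda>n. \<Sum>i<n. s i *\<^sub>R x i" and ?P = "\<lambda>n. \<Sum>i<n. (s i)\<^sup>2"
    have diff: "norm (?S m - ?S n) \<le> c * sqrt \<bar>?P m - ?P n\<bar>" if "n \<le> m" for m n
    proof -
      let ?r = "\<lambda>i. if i < n then 0 else s i"
      have sp: "(\<Sum>i<m. f i) - (\<Sum>i<n. f i) = (\<Sum>i<m. if i < n then 0 else f i)" for f :: "nat \<Rightarrow> 'b::ab_group_add"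
      proof -
        have "(\<Sum>i<n. f i) = (\<Sum>i<m. if i < n then f i else 0)"
          using that by (intro sum.mono_neutral_cong_left) auto
        then have "(\<Sum>i<m. f i) - (\<Sum>i<n. f i) = (\<Sum>i<m. f i - (if i < n then f i else 0))"
          by (simp only: sum_subtractf)
        also have "\<dots> = (\<Sum>i<m. if i < n then 0 else f i)" by (intro sum.cong) auto
        finally show ?thesis .
      qed
      have "?S m - ?S n = (\<Sum>i<m. ?r i *\<^sub>R x i)" unfolding sp by (intro sum.cong) auto
      then have "norm (?S m - ?S n) \<le> c * L2_set ?r {..<m}" using up by simp
      also have "L2_set ?r {..<m} = sqrt (?P m - ?P n)"
        unfolding sp L2_set_def by (intro arg_cong [of _ _ sqrt] sum.cong) auto
      also have "\<dots> \<le> sqrt \<bar>?P m - ?P n\<bar>" by simp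
      finally show ?thesis using c by (simp add: mult_left_mono)
    qed
    have "Cauchy ?S"
    proof (rule metric_CauchyI)
      fix \<epsilon> :: real assume \<epsilon>: "0 < \<epsilon>"
      have "Cauchy ?P" using s unfolding lp_space_2 summable_iff_convergent by (auto intro: convergent_Cauchy)
      moreover have "0 < (\<epsilon> / c)\<^sup>2" using \<epsilon> c by simp
      ultimately obtain n0 where n0: "\<And>m n. n0 \<le> m \<Longrightarrow> n0 \<le> n \<Longrightarrow> dist (?P m) (?P n) < (\<epsilon> / c)\<^sup>2"
        unfolding Cauchy_def by metis
      have le: "norm (?S m - ?S n) < \<epsilon>" if "n \<le> m" "n0 \<le> n" for m n
      proof -
        have "\<bar>?P m - ?P n\<bar> < (\<epsilon> / c)\<^sup>2" using n0 [of m n] that by (simp add: dist_real_def)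
        then have "sqrt \<bar>?P m - ?P n\<bar> < \<epsilon> / c" using \<epsilon> c by (intro real_less_lsqrt) auto
        then have "c * sqrt \<bar>?P m - ?P n\<bar> < \<epsilon>" using c by (simp add: field_simps)
        with diff [OF that(1)] show ?thesis by linarith
      qed
      have "dist (?S m) (?S n) < \<epsilon>" if "n0 \<le> m" "n0 \<le> n" for m n
        using le [of n m] le [of m n] that unfolding dist_norm by (cases "n \<le> m") (auto simp: norm_minus_commute)
      then show "\<exists>n0. \<forall>m\<ge>n0. \<forall>n\<ge>n0. dist (?S m) (?S n) < \<epsilon>" by blast
    qed
    moreover have "?S n \<in> M" for n using x by (intro subspace_sum [OF M(1)] subspace_scale [OF M(1)]) auto
    ultimately show ?thesis by (intro mp [OF spec [OF M(2) [unfolded complete_def]]]) simp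
  qed
  define R where "R s = lim (\<lambda>n. \<Sum>i<n. s i *\<^sub>R x i)" for s
  have R: "R s \<in> M" "(\<lambda>n. \<Sum>i<n. s i *\<^sub>R x i) \<longlonglongrightarrow> R s" if "s \<in> lp_space 2" for s
    using conv [OF that] unfolding R_def by (auto simp: limI)
  have R_add: "R (\<lambda>n. s n + t n) = R s + R t" if "s \<in> lp_space 2" "t \<in> lp_space 2" for s t
    using LIMSEQ_unique [OF R(2) [OF lp_space_2_add [OF that]]] tendsto_add [OF R(2) [OF that(1)] R(2) [OF that(2)]]
    by (simp add: scaleR_add_left sum.distrib)
  have R_scale: "R (\<lambda>n. k * s n) = k *\<^sub>R R s" if "s \<in> lp_space 2" for s k
    using LIMSEQ_unique [OF R(2) [OF lp_space_2_scale [OF that, of k]]] tendsto_scaleR [OF tendsto_const R(2) [OF that], of k]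
    by (simp add: scaleR_sum_right)
  have L2: "(\<lambda>n. L2_set s {..<n}) \<longlonglongrightarrow> lp_norm 2 s" if "s \<in> lp_space 2" for s
  proof -
    have "(\<lambda>n. \<Sum>i<n. (s i)\<^sup>2) \<longlonglongrightarrow> (\<Sum>n. (s n)\<^sup>2)" using that by (simp add: lp_space_2 summable_LIMSEQ)
    then show ?thesis unfolding lp_norm_2 [OF that] L2_set_def by (rule tendsto_real_sqrt)
  qed
  have bounds: "norm (R s) \<le> c * lp_norm 2 s" "lp_norm 2 s \<le> c * norm (R s)" if "s \<in> lp_space 2" for s
  proof -
    note l = tendsto_norm [OF R(2) [OF that]]
    show "norm (R s) \<le> c * lp_norm 2 s"
      by (rule LIMSEQ_le [OF l tendsto_mult_left [OF L2 [OF that]]]) (use up in auto)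
    show "lp_norm 2 s \<le> c * norm (R s)"
      by (rule LIMSEQ_le [OF L2 [OF that] tendsto_mult_left [OF l]]) (use low in auto)
  qed
  have inj: "inj_on R (lp_space 2)"
  proof (rule inj_onI)
    fix s t assume s: "s \<in> lp_space 2" and t: "t \<in> lp_space 2" and eq: "R s = R t"
    define d where "d = (\<lambda>n. s n + (-1) * t n)"
    have d: "d \<in> lp_space 2" unfolding d_def by (intro lp_space_2_add lp_space_2_scale s t)
    have "R d = 0"
      unfolding d_def using R_add [OF s lp_space_2_scale [OF t, of "-1"]] R_scale [OF t, of "-1"] eq by simp
    then have "lp_norm 2 d \<le> 0" using bounds(2) [OF d] by simp
    then have "(\<Sum>n. (d n)\<^sup>2) \<le> 0" by (simp add: lp_norm_2 [OF d])
    then have "(\<Sum>n. (d n)\<^sup>2) = 0" using d by (simp add: lp_space_2 suminf_nonneg antisym)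
    then have "\<forall>n. (d n)\<^sup>2 = 0" using d by (subst (asm) suminf_eq_zero_iff) (auto simp: lp_space_2)
    then show "s = t" by (auto simp: d_def fun_eq_iff)
  qed
  define S where "S = inv_into (lp_space 2) R"
  have SR: "S (R s) = s" if "s \<in> lp_space 2" for s unfolding S_def using inj that by (rule inv_into_f_f)
  have "subspace (R ` lp_space 2)"
    unfolding subspace_def
  proof (intro conjI ballI allI)
    have z: "(\<lambda>_. 0) \<in> lp_space 2" by (simp add: lp_space_2)
    have "R (\<lambda>_. 0) = 0" using R_scale [OF z, of 0] by simp
    then show "0 \<in> R ` lp_space 2" using z by (metis imageI)
    fix u assume u: "u \<in> R ` lp_space 2"
    then obtain s where s: "s \<in> lp_space 2" "u = R s" by blast
    show "k *\<^sub>R u \<in> R ` lp_space 2" for k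
      using R_scale [OF s(1), of k] lp_space_2_scale [OF s(1), of k] s(2) by (metis imageI)
    fix v assume "v \<in> R ` lp_space 2"
    then obtain t where t: "t \<in> lp_space 2" "v = R t" by blast
    show "u + v \<in> R ` lp_space 2"
      using R_add [OF s(1) t(1)] lp_space_2_add [OF s(1) t(1)] s(2) t(2) by (metis imageI)
  qed
  moreover have "R ` lp_space 2 \<subseteq> M" using R(1) by blast
  moreover have "bij_betw S (R ` lp_space 2) (lp_space 2)"
    unfolding S_def using inj by (intro bij_betw_inv_into inj_on_imp_bij_betw)
  moreover have "S (u + v) n = S u n + S v n" if uv: "u \<in> R ` lp_space 2" "v \<in> R ` lp_space 2" for u v n
  proof -
    obtain s t where st: "s \<in> lp_space 2" "u = R s" "t \<in> lp_space 2" "v = R t" using uv by blast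
    have "S (u + v) = (\<lambda>n. s n + t n)"
      unfolding st R_add [OF st(1,3), symmetric] by (rule SR [OF lp_space_2_add [OF st(1,3)]])
    then show ?thesis by (simp add: st SR)
  qed
  moreover have "S (k *\<^sub>R u) n = k * S u n" if u: "u \<in> R ` lp_space 2" for u n k
  proof -
    obtain s where s: "s \<in> lp_space 2" "u = R s" using u by blast
    have "S (k *\<^sub>R u) = (\<lambda>n. k * s n)"
      unfolding s(2) R_scale [OF s(1), symmetric] by (rule SR [OF lp_space_2_scale [OF s(1)]])
    then show ?thesis by (simp add: s SR)
  qed
  moreover have "inverse c * norm u \<le> lp_norm 2 (S u) \<and> lp_norm 2 (S u) \<le> c * norm u" if u: "u \<in> R ` lp_space 2" for u
  proof -
    obtain s where s: "s \<in> lp_space 2" "u = R s" using u by blast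
    then show ?thesis using bounds [OF s(1)] c by (simp add: SR field_simps)
  qed
  ultimately show ?thesis by blast
qed

theorem embeds_l2_almost_isometrically:
  fixes M :: "'a::real_normed_vector set" and U :: "'u::real_normed_vector set"
  assumes M: "banach_subspace M" "separable_set M" "infinite_dimensional M" and U: "subspace U"
    and cat: "aleph0_categorical (BM_system (theory_of M) U) (theory_of M)"
  shows "embeds_lp_almost_isometrically 2 M"
  unfolding embeds_lp_almost_isometrically_def
proof (intro allI impI)
  fix c :: real assume c: "1 < c"
  have sub: "subspace M" and cpl: "complete M" using M(1) by (simp_all add: banach_subspace_def)
  have \<epsilon>: "0 < ln c" using c by simp
  obtain h :: "'a \<Rightarrow> linf" and N e f x where h: "linear_isometry_on M h"
    and "sep_model (theory_of M) N" and N: "e \<in> tuples N UNIV"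
    and on': "\<forall>n r. norm (\<Sum>i<n. r i *\<^sub>R e i) = L2_set r {..<n}"
    and f: "perturbation_map (BM_system (theory_of M) U (ln c)) N (h ` M) f"
    and x: "x \<in> tuples M UNIV" and hx: "h \<circ> x = f \<circ> e"
    using ex_perturbed_orthonormal_sequence [OF M cat \<epsilon>] by (elim exE conjE) blast
  have on: "norm (\<Sum>i<n. r i *\<^sub>R e i) = L2_set r {..<n}" for n r using on' by blast
  have xM: "x i \<in> M" for i using x by (simp add: tuples_def unit_ball_def)
  have hxi: "h (x i) = f (e i)" for i using fun_cong [OF hx, of i] by simp
  have hsum: "(\<Sum>i<n. r i *\<^sub>R x i) \<in> M \<and> h (\<Sum>i<n. r i *\<^sub>R x i) = (\<Sum>i<n. r i *\<^sub>R f (e i))" for n r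
  proof (induction n)
    case 0
    show ?case using linear_isometry_on_zero [OF sub h] subspace_0 [OF sub] by simp
  next
    case (Suc n)
    have "r n *\<^sub>R x n \<in> M" by (intro subspace_scale [OF sub] xM)
    moreover have "h (r n *\<^sub>R x n) = r n *\<^sub>R f (e n)"
      using h xM by (simp add: linear_isometry_on_def hxi)
    ultimately show ?case using Suc h by (simp add: linear_isometry_on_def subspace_add [OF sub])
  qed
  have nx: "norm (\<Sum>i<n. r i *\<^sub>R x i) = norm (\<Sum>i<n. r i *\<^sub>R f (e i))" for n r
    using hsum [of r n] h unfolding linear_isometry_on_def by metis
  have "norm (\<Sum>i<n. r i *\<^sub>R x i) \<le> c * L2_set r {..<n}" for n r
    using BM_perturbation_norm_bounds(1) [OF U \<epsilon> f N, of r n] c by (simp add: nx on)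
  moreover have "L2_set r {..<n} \<le> c * norm (\<Sum>i<n. r i *\<^sub>R x i)" for n r
    using BM_perturbation_norm_bounds(2) [OF U \<epsilon> f N, of r n] c by (simp add: nx on)
  ultimately show "\<exists>L S. subspace L \<and> L \<subseteq> M \<and> bij_betw S L (lp_space 2) \<and>
        (\<forall>x\<in>L. \<forall>y\<in>L. \<forall>n. S (x + y) n = S x n + S y n) \<and>
        (\<forall>t. \<forall>x\<in>L. \<forall>n. S (t *\<^sub>R x) n = t * S x n) \<and>
        (\<forall>x\<in>L. inverse c * norm x \<le> lp_norm 2 (S x) \<and> lp_norm 2 (S x) \<le> c * norm x)"
    using c by (intro embeds_l2_if_almost_orthonormal [OF sub cpl xM]) auto
qed

theorem theorem5p10:
  fixes M :: "'a::real_normed_vector set"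
    and U :: "'u::real_normed_vector set"
    and \<pp> :: "real \<Rightarrow> type_rels"
  assumes "banach_subspace M" and "separable_set M" and "infinite_dimensional M"
    and "perturbation_system TYPE('u) (theory_of M) \<pp> \<or>
         (monster_model (theory_of M) U \<and> \<pp> = BM_system (theory_of M) U)"
    and "aleph0_categorical \<pp> (theory_of M)"
  shows "(embeds_approximately \<pp> c0_coeff M \<or> (\<exists>p\<ge>1. embeds_approximately \<pp> (lp_coeff p) M)) \<and>
         embeds_approximately \<pp> (lp_coeff 2) M \<and>
         (monster_model (theory_of M) U \<and> \<pp> = BM_system (theory_of M) U \<longrightarrow>
            embeds_lp_almost_isometrically 2 M)"
proof (intro conjI impI)
  show l2: "embeds_approximately \<pp> (lp_coeff 2) M"
    by (rule embeds_l2_approximately [OF assms(1-3,5)])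
  then show "embeds_approximately \<pp> c0_coeff M \<or> (\<exists>p\<ge>1. embeds_approximately \<pp> (lp_coeff p) M)"
    by (intro disjI2 exI [of _ 2]) simp
  assume BM: "monster_model (theory_of M) U \<and> \<pp> = BM_system (theory_of M) U"
  then have "subspace U" by (simp add: monster_model_def is_model_def banach_subspace_def)
  then show "embeds_lp_almost_isometrically 2 M"
    using assms(1-3,5) BM by (intro embeds_l2_almost_isometrically) auto
qed

end
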